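(* Let $d\ge 1$ and $n\ge 0$ be integers, let $f\in H^2(B^d)$, and let $\widehat f_{j,\nu}^{\,n}=\langle f,Q_{j,\nu}^n\rangle_\Delta$ for $0\le j\le n/2$, $1\le\nu\le\sigma_{n-2j}$. For $1\le j\le n/2$, with $\beta_j=n-2j+\frac{d-2}{2}$, $$\widehat f_{j,\nu}^{\,n}=\frac{8j(j+1)}{d^2\operatorname{vol}(B^d)}\left[(\beta_j+j)(\beta_j+j+1)\int_{B^d}f(x)Q_{j,\nu}^n(x)\,dx-\frac12\int_{S^{d-1}}f(y')Y_\nu^{n-2j}(y')\,d\omega(y')\right];$$ furthermore, for $j=0$, $$\widehat f_{0,\nu}^{\,n}=\frac{d+2n}{d}\,\frac{1}{\omega_{d-1}}\int_{S^{d-1}}Y_\nu^{n}(y')f(y')\,d\omega(y').$$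
   Context: $\|x\|$ is the Euclidean norm on $\mathbb{R}^d$, $B^d=\{x\in\mathbb{R}^d:\|x\|\le 1\}$, $S^{d-1}=\{x:\|x\|=1\}$, $d\omega$ is the surface measure on $S^{d-1}$ (counting measure if $d=1$), $\omega_{d-1}=2\pi^{d/2}/\Gamma(d/2)$ is the surface area of $S^{d-1}$, and $\operatorname{vol}(B^d)=\omega_{d-1}/d$. $\Delta$ is the usual Laplace operator on $\mathbb{R}^d$. The inner product is $$\langle f,g\rangle_\Delta=\frac{1}{4d^2\operatorname{vol}(B^d)}\int_{B^d}\Delta[(1-\|x\|^2)f(x)]\,\Delta[(1-\|x\|^2)g(x)]\,dx.$$ $H^2(B^d)$ denotes the space of functions $f$ for which $\langle f,f\rangle_\Delta$ is finite, understood as: real-valued $f\in W^{1,2}(B^d)$ whose distributional Laplacian $\Delta[(1-\|x\|^2)f]$ belongs to $L^2(B^d)$; values of $f$ on $S^{d-1}$ are taken in the sense of traces. $\mathcal{H}_m^d$ is the space of homogeneous polynomials $Y$ of degree $m$ in $d$ variables with $\Delta Y=0$, $\sigma_m=\dim\mathcal{H}_m^d$, and for each $m\ge0$, $\{Y_\nu^m:1\le\nu\le\sigma_m\}$ is a basis of $\mathcal{H}_m^d$ that is orthonormal in the sense $\frac{1}{\omega_{d-1}}\int_{S^{d-1}}Y_\mu^m Y_\nu^m\,d\omega=\delta_{\mu,\nu}$. $P_j^{(\alpha,\beta)}$ is the Jacobi polynomial of degree $j$, orthogonal with respect to $(1-s)^\alpha(1+s)^\beta$ on $[-1,1]$, normalized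 by $P_j^{(\alpha,\beta)}(1)=\binom{j+\alpha}{j}$. The polynomials $Q_{j,\nu}^n$ are $$Q_{0,\nu}^n(x)=Y_\nu^n(x),\qquad Q_{j,\nu}^n(x)=(1-\|x\|^2)P_{j-1}^{(2,\,n-2j+\frac{d-2}{2})}(2\|x\|^2-1)Y_\nu^{n-2j}(x)\quad(1\le j\le n/2).$$
   Formalization: The constant in the formula for 1≤j≤n/2 is corrected from 8j(j+1)/(d² vol(B^d)) to 4j(j+1)/(d² vol(B^d)); as printed it fails, e.g. for d=1, n=2, j=1, Y=1, f(x)=x², where the coefficient is −16/5 but the printed formula gives −32/5. *)

theory Defs
  imports
    "HOL-Analysis.Analysis"
    "HOL-Computational_Algebra.Polynomial"
    "HOL-Library.Function_Algebras"
begin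

section \<open>The unit ball and the unit sphere\<close>

abbreviation ball_measure :: "(real^'n) measure"
  where "ball_measure \<equiv> lebesgue_on (cball 0 1)"

text \<open>
  Surface measure as the cone measure: \<open>\<omega>(E) = d \<cdot> |{r y. 0 < r \<le> 1, y \<in> E}|\<close>.
  For \<open>d = 1\<close> it gives mass 1 to each of the two points of the sphere, so it is counting measure.
\<close>

definition sphere_measure :: "(real^'n) measure"
  where "sphere_measure =
    scale_measure (of_nat CARD('n))
      (distr (restrict_space lborel (cball 0 1 - {0})) (restrict_space borel (sphere 0 1))
        (\<lambda>x. x /\<^sub>R norm x))"

text \<open>The surface area \<open>\<omega>\<^bsub>d-1\<^esub>\<close> of the unit sphere of \<open>\<real>\<^sup>d\<close>.\<close>

definition sphere_area :: "nat \<Rightarrow> real"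
  where "sphere_area d = 2 * pi powr (real d / 2) / Gamma (real d / 2)"

definition square_integrable :: "'a measure \<Rightarrow> ('a \<Rightarrow> real) \<Rightarrow> bool"
  where "square_integrable M f \<longleftrightarrow> f \<in> borel_measurable M \<and> integrable M (\<lambda>x. (f x)\<^sup>2)"


section \<open>Classical derivatives and test functions\<close>

definition partial :: "'n \<Rightarrow> (real^'n \<Rightarrow> real) \<Rightarrow> real^'n \<Rightarrow> real"
  where "partial i f x = frechet_derivative f (at x) (axis i 1)"

definition laplacian :: "(real^'n \<Rightarrow> real) \<Rightarrow> real^'n \<Rightarrow> real"
  where "laplacian f x = (\<Sum>i\<in>UNIV. partial i (partial i f) x)"

text \<open>Functions of class \<open>C\<^sup>k\<close> on the whole space.\<close>

primrec C_k :: "nat \<Rightarrow> (real^'n \<Rightarrow> real) \<Rightarrow> bool"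
  where
    "C_k 0 f \<longleftrightarrow> continuous_on UNIV f"
  | "C_k (Suc k) f \<longleftrightarrow> (\<forall>x. f differentiable (at x)) \<and> (\<forall>i. C_k k (partial i f))"

definition test_function :: "(real^'n \<Rightarrow> real) \<Rightarrow> bool"
  where "test_function \<phi> \<longleftrightarrow>
    (\<forall>k. C_k k \<phi>) \<and> (\<exists>K. compact K \<and> K \<subseteq> ball 0 1 \<and> (\<forall>x. x \<notin> K \<longrightarrow> \<phi> x = 0))"


section \<open>Sobolev spaces, traces and the inner product\<close>

definition has_weak_partial :: "'n \<Rightarrow> (real^'n \<Rightarrow> real) \<Rightarrow> (real^'n \<Rightarrow> real) \<Rightarrow> bool"
  where "has_weak_partial i f g \<longleftrightarrow>
    square_integrable ball_measure g \<and>
    (\<forall>\<phi>. test_function \<phi> \<longrightarrow>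
      (LINT x|ball_measure. f x * partial i \<phi> x) = - (LINT x|ball_measure. g x * \<phi> x))"

definition has_weak_laplacian :: "(real^'n \<Rightarrow> real) \<Rightarrow> (real^'n \<Rightarrow> real) \<Rightarrow> bool"
  where "has_weak_laplacian u w \<longleftrightarrow>
    square_integrable ball_measure w \<and>
    (\<forall>\<phi>. test_function \<phi> \<longrightarrow>
      (LINT x|ball_measure. u x * laplacian \<phi> x) = (LINT x|ball_measure. w x * \<phi> x))"

text \<open>
  Weak derivatives are unique up to null sets of the ball; the choice of a representative does not
  affect the integrals below.
\<close>

definition weak_partial :: "'n \<Rightarrow> (real^'n \<Rightarrow> real) \<Rightarrow> real^'n \<Rightarrow> real"
  where "weak_partial i f = (SOME g. has_weak_partial i f g)"

definition weak_laplacian :: "(real^'n \<Rightarrow> real) \<Rightarrow> real^'n \<Rightarrow> real"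
  where "weak_laplacian u = (SOME w. has_weak_laplacian u w)"

definition W12 :: "(real^'n \<Rightarrow> real) set"
  where "W12 = {f. square_integrable ball_measure f \<and> (\<forall>i. \<exists>g. has_weak_partial i f g)}"

definition H2 :: "(real^'n \<Rightarrow> real) set"
  where "H2 = {f \<in> W12. \<exists>w. has_weak_laplacian (\<lambda>x. (1 - (norm x)\<^sup>2) * f x) w}"

text \<open>
  The trace is the continuous extension to \<open>W\<^sup>1\<^sup>,\<^sup>2\<close> of the restriction to the sphere: \<open>g\<close> is a trace
  of \<open>f\<close> if some \<open>C\<^sup>1\<close> functions converge to \<open>f\<close> in \<open>W\<^sup>1\<^sup>,\<^sup>2\<close> of the ball while their restrictions
  converge to \<open>g\<close> in \<open>L\<^sup>2\<close> of the sphere. Every \<open>f\<close> in \<open>W\<^sup>1\<^sup>,\<^sup>2\<close> has such a \<open>g\<close>, unique up to null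
  sets.
\<close>

definition has_trace :: "(real^'n \<Rightarrow> real) \<Rightarrow> (real^'n \<Rightarrow> real) \<Rightarrow> bool"
  where "has_trace f g \<longleftrightarrow>
    square_integrable sphere_measure g \<and>
    (\<exists>\<phi>. (\<forall>k. C_k 1 (\<phi> k)) \<and>
      (\<lambda>k::nat. LINT x|ball_measure. (\<phi> k x - f x)\<^sup>2) \<longlonglongrightarrow> 0 \<and>
      (\<forall>i. (\<lambda>k. LINT x|ball_measure. (partial i (\<phi> k) x - weak_partial i f x)\<^sup>2) \<longlonglongrightarrow> 0) \<and>
      (\<lambda>k. LINT y|sphere_measure. (\<phi> k y - g y)\<^sup>2) \<longlonglongrightarrow> 0)"

definition sobolev_trace :: "(real^'n \<Rightarrow> real) \<Rightarrow> real^'n \<Rightarrow> real"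
  where "sobolev_trace f = (SOME g. has_trace f g)"

text \<open>
  The normalization makes \<open>\<langle>1, 1\<rangle> = 1\<close>. For \<open>d = 1\<close>, \<open>f(x) = x\<^sup>2\<close> and \<open>g(x) = 1 - x\<^sup>2\<close> it gives
  \<open>(1/8) \<integral>\<^bsub>[-1,1]\<^esub> (2 - 12 x\<^sup>2) (12 x\<^sup>2 - 4) dx = -16/5\<close>, which fixes the constant in
  front of the bracket in the formula for \<open>\<langle>f, Q\<^bsub>j,\<nu>\<^esub>\<rangle>\<close>, \<open>j \<ge> 1\<close>: here the bracket is \<open>1/5 - 1\<close>
  and the constant is \<open>4 j (j + 1) / (d\<^sup>2 vol(B)) = 4\<close>.
\<close>

definition inner_Delta :: "(real^'n \<Rightarrow> real) \<Rightarrow> (real^'n \<Rightarrow> real) \<Rightarrow> real"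
  where "inner_Delta f g =
    1 / (4 * (real CARD('n))\<^sup>2 * measure lebesgue (cball 0 1 :: (real^'n) set)) *
    (LINT x|ball_measure.
      weak_laplacian (\<lambda>x. (1 - (norm x)\<^sup>2) * f x) x * weak_laplacian (\<lambda>x. (1 - (norm x)\<^sup>2) * g x) x)"


section \<open>Spherical harmonics\<close>

definition homogeneous_polynomial :: "nat \<Rightarrow> (real^'n \<Rightarrow> real) \<Rightarrow> bool"
  where "homogeneous_polynomial m p \<longleftrightarrow>
    (\<exists>c. \<forall>x. p x = (\<Sum>\<alpha> | (\<Sum>i\<in>UNIV. \<alpha> i) = m. c \<alpha> * (\<Prod>i\<in>UNIV. (x $ i) ^ \<alpha> i)))"

definition harmonic_space :: "nat \<Rightarrow> (real^'n \<Rightarrow> real) set"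
  where "harmonic_space m = {p. homogeneous_polynomial m p \<and> (\<forall>x. laplacian p x = 0)}"

global_interpretation real_fun: vector_space "\<lambda>(c::real) (f::'a \<Rightarrow> real) x. c * f x"
  by standard (auto simp: fun_eq_iff algebra_simps)

definition harmonic_dim :: "'n::finite itself \<Rightarrow> nat \<Rightarrow> nat"
  where "harmonic_dim _ m = real_fun.dim (harmonic_space m :: (real^'n \<Rightarrow> real) set)"

definition orthonormal_harmonic_basis :: "nat \<Rightarrow> (nat \<Rightarrow> real^'n \<Rightarrow> real) \<Rightarrow> bool"
  where "orthonormal_harmonic_basis m B \<longleftrightarrow>
    inj_on B {1..harmonic_dim TYPE('n) m} \<and>
    real_fun.independent (B ` {1..harmonic_dim TYPE('n) m}) \<and>
    real_fun.span (B ` {1..harmonic_dim TYPE('n) m}) = harmonic_space m \<and>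
    (\<forall>\<mu>\<in>{1..harmonic_dim TYPE('n) m}. \<forall>\<nu>\<in>{1..harmonic_dim TYPE('n) m}.
      1 / sphere_area CARD('n) * (LINT y|sphere_measure. B \<mu> y * B \<nu> y) = (if \<mu> = \<nu> then 1 else 0))"


section \<open>Jacobi polynomials and the polynomials Q\<close>

text \<open>For \<open>\<alpha>, \<beta> > -1\<close>.\<close>

definition jacobi :: "real \<Rightarrow> real \<Rightarrow> nat \<Rightarrow> real poly"
  where "jacobi \<alpha> \<beta> j = (THE p.
    degree p = j \<and>
    (\<forall>q. degree q < j \<longrightarrow>
      (LINT s:{-1..1}|lborel. poly p s * poly q s * ((1 - s) powr \<alpha> * (1 + s) powr \<beta>)) = 0) \<and>
    poly p 1 = (real j + \<alpha>) gchoose j)"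

text \<open>The parameter \<open>Y\<close> is the family \<open>Y m \<nu>\<close> of spherical harmonics; \<open>Q\<close> is meant for \<open>2 j \<le> n\<close>.\<close>

definition Q_poly ::
    "(nat \<Rightarrow> nat \<Rightarrow> real^'n \<Rightarrow> real) \<Rightarrow> nat \<Rightarrow> nat \<Rightarrow> nat \<Rightarrow> real^'n \<Rightarrow> real"
  where "Q_poly Y n j \<nu> x =
    (if j = 0 then Y n \<nu> x
     else (1 - (norm x)\<^sup>2) *
       poly (jacobi 2 (real (n - 2 * j) + (real CARD('n) - 2) / 2) (j - 1)) (2 * (norm x)\<^sup>2 - 1) *
       Y (n - 2 * j) \<nu> x)"

end

theory Submission
  imports Defs
begin

text \<open>
  The inner product integrates the weak Laplacian of \<open>(1 - |x|\<^sup>2) f\<close> against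
  \<open>P = \<Delta>[(1 - |x|\<^sup>2) Q]\<close>. On the sphere \<open>(1 - |x|\<^sup>2) f\<close> vanishes and has
  normal derivative \<open>-2 f\<close>, so Green's formula suggests
  \<open>\<integral>\<^bsub>B\<^esub> \<Delta>[(1 - |x|\<^sup>2) f] P = \<integral>\<^bsub>B\<^esub> f (1 - |x|\<^sup>2) \<Delta>P - 2 \<integral>\<^bsub>S\<^esub> f P\<close>
  (lemma \<open>green_formula\<close>). Hence a coefficient only depends on \<open>\<Delta>P\<close> in the ball and on \<open>P\<close> on the
  sphere, and both are explicit. If \<open>Y\<close> is a harmonic homogeneous polynomial of degree \<open>m\<close> and
  \<open>\<beta> = m + (d - 2) / 2\<close>, then \<open>\<Delta>(g(|x|\<^sup>2) Y) = 4 (R g)(|x|\<^sup>2) Y\<close> with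
  \<open>R g = t g'' + (\<beta> + 1) g'\<close> (lemma \<open>laplacian_poly_norm_mult_harmonic\<close>).
  For \<open>Q = Y\<close> this makes \<open>P\<close> a multiple of \<open>Y\<close>, so that \<open>\<Delta>P = 0\<close> and only the sphere contributes.
  For \<open>j \<ge> 1\<close> put \<open>p(t) = P\<^bsub>j-1\<^esub>\<^bsup>(2,\<beta>)\<^esup>(2t - 1)\<close>; then \<open>R(R[(1 - t)\<^sup>2 p]) = j (j + 1) (j + \<beta>) (j + 1 + \<beta>) p\<close>
  (lemma \<open>radial_op_weighted_jacobi\<close>), so \<open>(1 - |x|\<^sup>2) \<Delta>P\<close> is a multiple of \<open>Q\<close>, while on the sphere
  \<open>P = 8 p(1) Y = 4 j (j + 1) Y\<close>.

  The function \<open>f\<close> only has weak first derivatives, and weak equations may only be tested against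
  smooth functions with compact support in the open ball. Green's formula is therefore applied to \<open>P\<close> times
  cut-off functions \<open>\<chi>\<^sub>k\<close>. The derivatives of \<open>\<chi>\<^sub>k\<close> blow up at the sphere, but \<open>(1 - |x|\<^sup>2) \<partial>\<^sub>i\<chi>\<^sub>k\<close>
  stays bounded and tends to \<open>0\<close> pointwise; since \<open>(1 - |x|\<^sup>2) f\<close> carries the factor \<open>1 - |x|\<^sup>2\<close>, this is
  all that is needed, and the limit contains \<open>f\<close> and its weak gradient only. The boundary integral
  arises because \<open>\<integral>\<^bsub>S\<^esub> F = \<integral>\<^bsub>B\<^esub> (d F + x \<bullet> \<nabla>F)\<close> for every \<open>C\<^sup>1\<close> function \<open>F\<close> (lemma \<open>integral_radial\<close>),
  which by continuity expresses the integral of the trace of \<open>f\<close> against \<open>P\<close> through \<open>f\<close> and its weak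
  gradient (lemma \<open>integral_trace\<close>).

  The trace and the weak Laplacian are chosen by Hilbert's operator, so it has to be shown that a trace exists and
  that weak Laplacians are unique almost everywhere. Both follow from one family of mollifiers, in which
  the function is first contracted towards the origin, so that the value at a point of the closed ball is an
  average over points of the open ball. They approximate \<open>f\<close> in \<open>W\<^sup>1\<^sup>,\<^sup>2\<close>, and \<open>integral_radial\<close> for
  \<open>F = \<phi>\<^sup>2\<close> bounds the \<open>L\<^sup>2\<close> norm on the sphere by the \<open>W\<^sup>1\<^sup>,\<^sup>2\<close> norm in the ball; so the restrictions of the
  approximations to the sphere form a Cauchy sequence.
\<close>

section \<open>Smooth functions\<close>

lemma partial_eq: "(f has_derivative D) (at x) \<Longrightarrow> partial i f x = D (axis i 1)"
  unfolding partial_def by (metis frechet_derivative_at)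

lemma partial_add:
  assumes "f differentiable (at x)" "g differentiable (at x)"
  shows "partial i (\<lambda>x. f x + g x) x = partial i f x + partial i g x"
  using assms unfolding frechet_derivative_works
  by (auto dest!: partial_eq[OF has_derivative_add, of f _ x g _ i] simp: partial_def)

lemma partial_mult:
  assumes "f differentiable (at x)" "g differentiable (at x)"
  shows "partial i (\<lambda>x. f x * g x) x = partial i f x * g x + f x * partial i g x"
  using partial_eq[OF has_derivative_mult[OF assms[unfolded frechet_derivative_works]], of i]
  by (simp add: partial_def)

lemma partial_const [simp]: "partial i (\<lambda>x. c) = (\<lambda>x. 0)"
  by (rule ext, subst partial_eq[OF has_derivative_const]) simp

lemma partial_coord: "partial i (\<lambda>x. x $ j) = (\<lambda>x. if i = j then 1 else 0)"
proof
  fix x :: "real^'a"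
  have "((\<lambda>x. x $ j) has_derivative (\<lambda>h. h $ j)) (at x)"
    by (rule bounded_linear_imp_has_derivative[OF bounded_linear_vec_nth])
  from partial_eq[OF this] show "partial i (\<lambda>x. x $ j) x = (if i = j then 1 else 0)"
    by (simp add: axis_def)
qed

lemma sum_axis: "(\<Sum>j\<in>UNIV. axis i 1 $ j * p j) = p i" for p :: "'n::finite \<Rightarrow> real"
  by (simp add: axis_def if_distrib[of "\<lambda>x. x * _"] cong: if_cong)

lemma derivative_eq_sum_partial:
  fixes f :: "real^'n \<Rightarrow> real"
  assumes "f differentiable (at x)"
  shows "(f has_derivative (\<lambda>h. \<Sum>i\<in>UNIV. h $ i * partial i f x)) (at x)"
proof -
  from assms have D: "(f has_derivative frechet_derivative f (at x)) (at x)"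
    by (simp add: frechet_derivative_works)
  have "frechet_derivative f (at x) h = (\<Sum>i\<in>UNIV. h $ i * partial i f x)" for h
  proof -
    interpret linear "frechet_derivative f (at x)"
      using D by (rule has_derivative_linear)
    have "h = (\<Sum>i\<in>UNIV. h $ i *\<^sub>R axis i 1)"
      by (metis (no_types, lifting) basis_expansion scalar_mult_eq_scaleR sum.cong)
    hence "frechet_derivative f (at x) h = frechet_derivative f (at x) (\<Sum>i\<in>UNIV. h $ i *\<^sub>R axis i 1)"
      by simp
    also have "\<dots> = (\<Sum>i\<in>UNIV. h $ i * partial i f x)"
      by (simp add: sum scaleR partial_def)
    finally show ?thesis .
  qed
  hence "frechet_derivative f (at x) = (\<lambda>h. \<Sum>i\<in>UNIV. h $ i * partial i f x)" by blast
  thus ?thesis using D by simp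
qed

lemma C_k_Suc_D: "C_k (Suc k) f \<Longrightarrow> C_k k f"
proof (induction k arbitrary: f)
  case 0
  then show ?case
    by (auto simp: continuous_on_eq_continuous_at intro: differentiable_imp_continuous_within)
qed simp

lemma C_k_le: "C_k k f \<Longrightarrow> j \<le> k \<Longrightarrow> C_k j f"
  by (induction k) (auto simp: le_Suc_eq simp del: C_k.simps dest: C_k_Suc_D)

lemma C_k_const: "C_k k (\<lambda>x. c)"
  by (induction k arbitrary: c) auto

lemma C_k_coord: "C_k k (\<lambda>x. x $ i)"
proof (cases k)
  case (Suc j)
  have "(\<lambda>x. x $ i) differentiable (at x)" for x :: "real^'a"
    using bounded_linear_imp_differentiable[OF bounded_linear_vec_nth] .
  thus ?thesis using Suc by (auto simp: partial_coord C_k_const)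
qed (simp add: continuous_on_component)

lemma C_k_add: "C_k k f \<Longrightarrow> C_k k g \<Longrightarrow> C_k k (\<lambda>x. f x + g x)"
proof (induction k arbitrary: f g)
  case (Suc k)
  have "partial i (\<lambda>x. f x + g x) = (\<lambda>x. partial i f x + partial i g x)" for i
    using Suc.prems by (auto simp: partial_add)
  thus ?case using Suc.prems Suc.IH by (auto intro!: differentiable_add)
qed (simp add: continuous_on_add)

lemma C_k_mult: "C_k k f \<Longrightarrow> C_k k g \<Longrightarrow> C_k k (\<lambda>x. f x * g x)"
proof (induction k arbitrary: f g)
  case (Suc k)
  have "partial i (\<lambda>x. f x * g x) = (\<lambda>x. partial i f x * g x + f x * partial i g x)" for i
    using Suc.prems by (auto simp: partial_mult)
  moreover have "C_k k f" "C_k k g" using Suc.prems by (auto intro: C_k_Suc_D simp del: C_k.simps)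
  ultimately show ?case using Suc.prems Suc.IH
    by (auto intro!: C_k_add differentiable_mult)
qed (simp add: continuous_on_mult)

definition smooth :: "(real^'n \<Rightarrow> real) \<Rightarrow> bool"
  where "smooth f \<longleftrightarrow> (\<forall>k. C_k k f)"

named_theorems smooth_intros

lemma smooth_const [smooth_intros]: "smooth (\<lambda>x. c)"
  and smooth_coord [smooth_intros]: "smooth (\<lambda>x. x $ i)"
  and smooth_add [smooth_intros]: "smooth f \<Longrightarrow> smooth g \<Longrightarrow> smooth (\<lambda>x. f x + g x)"
  and smooth_mult [smooth_intros]: "smooth f \<Longrightarrow> smooth g \<Longrightarrow> smooth (\<lambda>x. f x * g x)"
  by (auto simp: smooth_def C_k_const C_k_coord C_k_add C_k_mult)

lemma smooth_minus [smooth_intros]: "smooth f \<Longrightarrow> smooth (\<lambda>x. - f x)"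
  using smooth_mult[OF smooth_const[of "-1"]] by fastforce

lemma smooth_diff [smooth_intros]: "smooth f \<Longrightarrow> smooth g \<Longrightarrow> smooth (\<lambda>x. f x - g x)"
  using smooth_add[OF _ smooth_minus] by fastforce

lemma smooth_sum [smooth_intros]: "(\<And>i. i \<in> A \<Longrightarrow> smooth (f i)) \<Longrightarrow> smooth (\<lambda>x. \<Sum>i\<in>A. f i x)"
  by (induction A rule: infinite_finite_induct) (auto intro!: smooth_intros)

lemma smooth_prod [smooth_intros]: "(\<And>i. i \<in> A \<Longrightarrow> smooth (f i)) \<Longrightarrow> smooth (\<lambda>x. \<Prod>i\<in>A. f i x)"
  by (induction A rule: infinite_finite_induct) (auto intro!: smooth_intros)

lemma smooth_power [smooth_intros]: "smooth f \<Longrightarrow> smooth (\<lambda>x. f x ^ k)"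
  by (induction k) (auto intro!: smooth_intros)

lemma smooth_poly [smooth_intros]: "smooth f \<Longrightarrow> smooth (\<lambda>x. poly p (f x))"
  by (induction p) (auto intro!: smooth_intros)

lemma smooth_divide [smooth_intros]: "smooth f \<Longrightarrow> smooth (\<lambda>x. f x / c)"
  using smooth_mult[OF _ smooth_const[of "inverse c"]] by (simp add: divide_inverse)

lemma norm_power2_eq_sum: "(norm (x::real^'n))\<^sup>2 = (\<Sum>i\<in>UNIV. (x $ i)\<^sup>2)"
  by (simp add: norm_vec_def L2_set_def sum_nonneg)

lemma smooth_norm_power2 [smooth_intros]: "smooth (\<lambda>x. (norm x)\<^sup>2)"
  unfolding norm_power2_eq_sum by (intro smooth_intros)

lemma smooth_norm_affine [smooth_intros]:
  "smooth (\<lambda>x. (norm (a *\<^sub>R x + c))\<^sup>2)"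
  unfolding norm_power2_eq_sum by (simp add: smooth_intros)

lemma smooth_partial [smooth_intros]: "smooth f \<Longrightarrow> smooth (partial i f)"
  unfolding smooth_def by (metis C_k.simps(2))

lemma smooth_laplacian [smooth_intros]: "smooth f \<Longrightarrow> smooth (laplacian f)"
  unfolding laplacian_def by (auto intro!: smooth_intros)

lemma smooth_differentiable: "smooth f \<Longrightarrow> f differentiable (at x)"
  unfolding smooth_def by (metis C_k.simps(2))

lemma smooth_continuous: "smooth f \<Longrightarrow> continuous_on A f"
  unfolding smooth_def by (metis C_k.simps(1) continuous_on_subset subset_UNIV)

lemma smooth_partial_add:
  "smooth f \<Longrightarrow> smooth g \<Longrightarrow> partial i (\<lambda>x. f x + g x) = (\<lambda>x. partial i f x + partial i g x)"
  by (auto simp: partial_add smooth_differentiable)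

lemma smooth_partial_mult:
  "smooth f \<Longrightarrow> smooth g \<Longrightarrow>
    partial i (\<lambda>x. f x * g x) = (\<lambda>x. partial i f x * g x + f x * partial i g x)"
  by (auto simp: partial_mult smooth_differentiable)

lemma partial_chain:
  assumes "(\<phi> has_real_derivative d) (at (G x))" "G differentiable (at x)"
  shows "partial i (\<lambda>x. \<phi> (G x)) x = d * partial i G x"
proof -
  have "((\<lambda>x. \<phi> (G x)) has_derivative (\<lambda>h. (\<Sum>i\<in>UNIV. h $ i * partial i G x) * d)) (at x)"
    using has_derivative_compose[OF derivative_eq_sum_partial[OF assms(2)] assms(1)[unfolded has_field_derivative_def]]
    by (simp add: mult.commute)
  from partial_eq[OF this, of i] show ?thesis
    by (simp add: sum_axis)
qed

lemma differentiable_chain_real: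
  assumes "(\<phi> has_real_derivative d) (at (G x))" "G differentiable (at x)"
  shows "(\<lambda>x. \<phi> (G x)) differentiable (at x)"
  using assms(2) has_derivative_compose[of G _ x UNIV \<phi>, OF _ assms(1)[unfolded has_field_derivative_def]]
  unfolding differentiable_def by blast

lemma partial_norm_power2: "partial i (\<lambda>x. (norm x)\<^sup>2) = (\<lambda>x. 2 * x $ i)"
proof
  fix x :: "real^'a"
  have "((\<lambda>x. (norm x)\<^sup>2) has_derivative (\<lambda>h. 2 * (x \<bullet> h))) (at x)"
    unfolding power2_norm_eq_inner by (auto intro!: derivative_eq_intros simp: inner_commute)
  from partial_eq[OF this] show "partial i (\<lambda>x. (norm x)\<^sup>2) x = 2 * x $ i"
    by (simp add: inner_axis)
qed

section \<open>A flat function\<close>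

text \<open>
  The functions \<open>p(1/t) exp(-1/t)\<close>, continued by \<open>0\<close> to \<open>t \<le> 0\<close>. Admitting a polynomial factor \<open>p\<close> makes
  the family closed under differentiation, so smoothness is an induction within the family.
\<close>

definition flat :: "real poly \<Rightarrow> real \<Rightarrow> real"
  where "flat p t = (if t \<le> 0 then 0 else poly p (1 / t) * exp (- 1 / t))"

definition flat_deriv :: "real poly \<Rightarrow> real poly"
  where "flat_deriv p = [:0, 0, 1:] * (p - pderiv p)"

lemma poly_times_exp_tendsto_0: "((\<lambda>y. poly p y * exp (- y)) \<longlongrightarrow> 0) at_top" for p :: "real poly"
proof -
  have "((\<lambda>y. \<Sum>i\<le>degree p. coeff p i * (y ^ i / exp y)) \<longlongrightarrow> (\<Sum>i\<le>degree p. coeff p i * 0)) at_top"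
    by (intro tendsto_intros tendsto_power_div_exp_0)
  thus ?thesis by (simp add: poly_altdef sum_distrib_right exp_minus divide_inverse mult.assoc)
qed

lemma flat_tendsto_0: "(flat p \<longlongrightarrow> 0) (at 0)"
proof -
  have "((\<lambda>t. poly p (1 / t) * exp (- (1 / t))) \<longlongrightarrow> 0) (at_right 0)"
    using filterlim_compose[OF poly_times_exp_tendsto_0 filterlim_inverse_at_top_right]
    by (simp add: divide_inverse)
  hence 1: "(flat p \<longlongrightarrow> 0) (at_right 0)"
    by (rule Lim_transform_eventually)
       (auto simp: flat_def eventually_at_filter intro!: always_eventually)
  have 2: "(flat p \<longlongrightarrow> 0) (at_left 0)"
    by (rule Lim_transform_eventually[OF tendsto_const])
       (auto simp: flat_def eventually_at_filter intro!: always_eventually)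
  show ?thesis using 1 2 by (simp add: filterlim_split_at)
qed

text \<open>
  The only delicate point is \<open>t = 0\<close>: the difference quotient of \<open>flat p\<close> there is \<open>flat (pCons 0 p)\<close>,
  which tends to \<open>0\<close> because the exponential beats every polynomial.
\<close>

lemma flat_has_derivative: "(flat p has_real_derivative flat (flat_deriv p) t) (at t)"
proof -
  consider "t < 0" | "t = 0" | "t > 0" by linarith
  thus ?thesis
  proof cases
    case 1
    have "(flat p has_real_derivative 0) (at t)"
      by (rule has_field_derivative_transform_within_open[where f = "\<lambda>_. 0" and S = "{..<0}", OF DERIV_const])
         (use 1 in \<open>auto simp: flat_def\<close>)
    with 1 show ?thesis by (simp add: flat_def)
  next
    case 2
    have "(\<lambda>h. (flat p (0 + h) - flat p 0) / h) = flat (pCons 0 p)"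
      by (auto simp: flat_def fun_eq_iff)
    hence "(flat p has_real_derivative 0) (at 0)"
      unfolding has_field_derivative_iff using flat_tendsto_0[of "pCons 0 p"]
      by (simp add: flat_def)
    with 2 show ?thesis by (simp add: flat_def)
  next
    case 3
    have "((\<lambda>t. poly p (1 / t) * exp (- 1 / t)) has_real_derivative flat (flat_deriv p) t) (at t)"
      using 3
      by (auto intro!: derivative_eq_intros DERIV_chain'[OF _ poly_DERIV]
           simp: flat_def flat_deriv_def field_simps power2_eq_square)
    from this show ?thesis
      by (rule has_field_derivative_transform_within_open[of _ _ _ "{0<..}"])
         (use 3 in \<open>auto simp: flat_def\<close>)
  qed
qed

lemma smooth_flat [smooth_intros]:
  assumes "smooth G"
  shows "smooth (\<lambda>x. flat p (G x))"
proof -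
  have "C_k k (\<lambda>x. flat p (G x))" for k
  proof (induction k arbitrary: p)
    case 0
    have "continuous_on UNIV (flat p)"
      using flat_has_derivative by (meson DERIV_isCont continuous_at_imp_continuous_on)
    hence "continuous_on UNIV (\<lambda>x. flat p (G x))"
      by (rule continuous_on_compose2[OF _ smooth_continuous[OF assms]]) auto
    thus ?case by simp
  next
    case (Suc k)
    have "partial i (\<lambda>x. flat p (G x)) = (\<lambda>x. flat (flat_deriv p) (G x) * partial i G x)" for i
      using partial_chain[OF flat_has_derivative smooth_differentiable[OF assms]] by blast
    moreover have "C_k k (partial i G)" for i
      using smooth_partial[OF assms] by (simp add: smooth_def)
    ultimately show ?case
      using Suc differentiable_chain_real[OF flat_has_derivative smooth_differentiable[OF assms]]
      by (auto intro: C_k_mult)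
  qed
  thus ?thesis by (simp add: smooth_def)
qed

section \<open>Integrals over the ball\<close>

lemma finite_ball_measure: "finite_measure (ball_measure :: (real^'n) measure)"
  by (rule finite_measure_lebesgue_on) simp

interpretation ball_measure: finite_measure "ball_measure :: (real^'n) measure"
  by (rule finite_ball_measure)

lemma continuous_ball_measurable [measurable]:
  "continuous_on UNIV F \<Longrightarrow> F \<in> borel_measurable (ball_measure :: (real^'n) measure)"
  for F :: "real^'n \<Rightarrow> real"
  by (meson continuous_imp_measurable_on_sets_lebesgue continuous_on_subset lmeasurable_cball fmeasurableD subset_UNIV)

lemma continuous_ball_bounded:
  fixes F :: "real^'n \<Rightarrow> real"
  assumes "continuous_on UNIV F"
  obtains C where "C > 0" "\<And>x. x \<in> cball 0 r \<Longrightarrow> \<bar>F x\<bar> \<le> C"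
proof -
  have "compact (F ` cball 0 r)"
    by (rule compact_continuous_image[OF continuous_on_subset[OF assms]]) auto
  then obtain C where "C > 0" "\<forall>y\<in>F ` cball 0 r. norm y \<le> C"
    using compact_imp_bounded bounded_pos by blast
  with that show ?thesis by auto
qed

lemma integrable_bounded_mult:
  fixes F :: "real^'n \<Rightarrow> real"
  assumes "continuous_on UNIV F" "integrable ball_measure g"
  shows "integrable ball_measure (\<lambda>x. g x * F x)" "integrable ball_measure (\<lambda>x. F x * g x)"
proof -
  obtain C where C: "C > 0" "\<And>x. x \<in> cball 0 1 \<Longrightarrow> \<bar>F x\<bar> \<le> C"
    using continuous_ball_bounded[OF assms(1), of 1] by blast
  have [measurable]: "F \<in> borel_measurable ball_measure" "g \<in> borel_measurable ball_measure"
    using assms by auto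
  show *: "integrable ball_measure (\<lambda>x. g x * F x)"
  proof (rule Bochner_Integration.integrable_bound)
    show "integrable ball_measure (\<lambda>x. C * g x)" using assms by simp
    show "AE x in ball_measure. norm (g x * F x) \<le> norm (C * g x)"
      using C by (intro AE_I2) (auto simp: abs_mult mult.commute[of "\<bar>F _\<bar>"] mult.commute[of _ "\<bar>g _\<bar>"] intro!: mult_left_mono)
  qed measurable
  then show "integrable ball_measure (\<lambda>x. F x * g x)" by (simp add: mult.commute)
qed

lemma integrable_continuous_ball:
  fixes F :: "real^'n \<Rightarrow> real"
  shows "continuous_on UNIV F \<Longrightarrow> integrable ball_measure F"
  using integrable_bounded_mult[of F "\<lambda>_. 1"] by simp

lemma integral_ball_measure:
  fixes F :: "real^'n \<Rightarrow> real"
  assumes "F \<in> borel_measurable borel"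
  shows "(LINT x|ball_measure. F x) = (LINT x|lborel. indicator (cball 0 1) x * F x)"
proof -
  have "(LINT x|ball_measure. F x) = (LINT x|lebesgue. indicator (cball 0 1) x * F x)"
    by (subst integral_restrict_space) auto
  also have "\<dots> = (LINT x|lborel. indicator (cball 0 1) x * F x)"
    using assms by (intro integral_completion) (auto intro!: borel_measurable_times borel_measurable_indicator)
  finally show ?thesis .
qed

lemma lborel_integral_affine:
  fixes F :: "'a::euclidean_space \<Rightarrow> real"
  assumes "c \<noteq> 0" and [measurable]: "F \<in> borel_measurable borel"
  shows "(LINT x|lborel. F x) = \<bar>c\<bar> ^ DIM('a) * (LINT x|lborel. F (t + c *\<^sub>R x))"
  by (subst lborel_affine[OF assms(1), of t]) (simp add: integral_density integral_distr)

lemma integrable_indicator_continuous: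
  fixes F :: "real^'n \<Rightarrow> real"
  assumes "continuous_on UNIV F"
  shows "integrable lborel (\<lambda>x. indicator (cball 0 r) x * F x)"
  using borel_integrable_compact[of "cball 0 r" F] assms continuous_on_subset
  by (auto simp: mult.commute)

section \<open>Differentiation under the integral sign\<close>

text \<open>
  Dominated convergence applied to the difference quotients, which the mean value theorem bounds
  by the constant \<open>C\<close> on the convex set \<open>U\<close>.
\<close>

lemma has_derivative_lebesgue_integral:
  fixes K :: "'b \<Rightarrow> 'a::euclidean_space \<Rightarrow> real"
  assumes f: "integrable M f" and U: "open U" "convex U" "x \<in> U"
    and deriv: "\<And>w y. w \<in> space M \<Longrightarrow> y \<in> U \<Longrightarrow> (K w has_derivative K' w y) (at y)"
    and bound: "\<And>w y h. w \<in> space M \<Longrightarrow> y \<in> U \<Longrightarrow> \<bar>K' w y h\<bar> \<le> C * norm h"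
    and meas: "\<And>h. (\<lambda>w. K' w x h) \<in> borel_measurable M"
    and int: "\<And>y. y \<in> U \<Longrightarrow> integrable M (\<lambda>w. f w * K w y)"
  shows "((\<lambda>y. LINT w|M. f w * K w y) has_derivative (\<lambda>h. LINT w|M. f w * K' w x h)) (at x)"
proof -
  let ?F = "\<lambda>y. LINT w|M. f w * K w y" and ?D = "\<lambda>h. LINT w|M. f w * K' w x h"
  note [measurable] = meas borel_measurable_integrable[OF f]
  have K'int: "integrable M (\<lambda>w. f w * K' w x h)" for h
  proof (rule Bochner_Integration.integrable_bound[of _ "\<lambda>w. C * norm h * f w"])
    show "AE w in M. norm (f w * K' w x h) \<le> norm (C * norm h * f w)"
    proof (rule AE_I2)
      fix w assume w: "w \<in> space M"
      have "\<bar>K' w x h\<bar> \<le> \<bar>C * norm h\<bar>" using bound[OF w U(3), of h] by linarith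
      from mult_right_mono[OF this, of "\<bar>f w\<bar>"]
      show "norm (f w * K' w x h) \<le> norm (C * norm h * f w)" by (simp add: abs_mult mult_ac)
    qed
  qed (use f in auto)
  have lin: "linear (K' w x)" if "w \<in> space M" for w
    using deriv[OF that U(3)] by (rule has_derivative_linear)
  have "linear ?D"
  proof (rule linearI)
    fix a b :: 'a and r :: real
    have "?D (a + b) = (LINT w|M. f w * K' w x a + f w * K' w x b)"
      by (intro Bochner_Integration.integral_cong) (auto simp: linear_add[OF lin] algebra_simps)
    also have "\<dots> = ?D a + ?D b" by (intro Bochner_Integration.integral_add K'int)
    finally show "?D (a + b) = ?D a + ?D b" .
    have "?D (r *\<^sub>R a) = (LINT w|M. r * (f w * K' w x a))"
      by (intro Bochner_Integration.integral_cong) (auto simp: linear_scale[OF lin] algebra_simps)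
    thus "?D (r *\<^sub>R a) = r *\<^sub>R ?D a" by simp
  qed
  hence bl: "bounded_linear ?D" by (simp add: linear_conv_bounded_linear)
  have lip: "\<bar>K w y - K w x\<bar> \<le> C * norm (y - x)" if "w \<in> space M" "y \<in> U" for w y
  proof -
    have "norm (K w y - K w x) \<le> C * norm (y - x)"
    proof (rule differentiable_bound[OF U(2) _ _ that(2) U(3)])
      fix z assume z: "z \<in> U"
      show "(K w has_derivative K' w z) (at z within U)"
        using deriv[OF that(1) z] by (rule has_derivative_at_withinI)
      show "onorm (K' w z) \<le> C"
      proof (rule onorm_le)
        fix h show "norm (K' w z h) \<le> C * norm h" using bound[OF that(1) z, of h] by simp
      qed
    qed
    thus ?thesis by simp
  qed
  have "((\<lambda>y. norm ((?F y - ?F x) - ?D (y - x)) / norm (y - x)) \<longlongrightarrow> 0) (at x within U)"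
    unfolding tendsto_at_iff_sequentially comp_def
  proof (intro allI impI)
    fix X assume X: "\<forall>i. X i \<in> U - {x}" "X \<longlonglongrightarrow> x"
    let ?q = "\<lambda>i w. (K w (X i) - K w x - K' w x (X i - x)) / norm (X i - x)"
    have eq: "norm ((?F (X i) - ?F x) - ?D (X i - x)) / norm (X i - x) = norm (LINT w|M. f w * ?q i w)" for i
    proof -
      have "(LINT w|M. f w * ?q i w) =
          (LINT w|M. (f w * K w (X i) - f w * K w x - f w * K' w x (X i - x)) / norm (X i - x))"
        by (intro Bochner_Integration.integral_cong) (auto simp: algebra_simps diff_divide_distrib)
      also have "\<dots> = (?F (X i) - ?F x - ?D (X i - x)) / norm (X i - x)"
        using X(1) U(3) by (simp add: int K'int)
      finally have *: "(LINT w|M. f w * ?q i w) = (?F (X i) - ?F x - ?D (X i - x)) / norm (X i - x)" .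
      show ?thesis unfolding * by (simp add: abs_divide)
    qed
    have "(\<lambda>i. LINT w|M. f w * ?q i w) \<longlonglongrightarrow> (LINT w|M. 0)"
    proof (rule integral_dominated_convergence[where w = "\<lambda>w. 2 * C * \<bar>f w\<bar>"])
      show "integrable M (\<lambda>w. 2 * C * \<bar>f w\<bar>)" using f by simp
      show "(\<lambda>w. f w * ?q i w) \<in> borel_measurable M" for i
      proof -
        have "(\<lambda>w. (f w * K w (X i) - f w * K w x - f w * K' w x (X i - x)) / norm (X i - x)) \<in> borel_measurable M"
          using X(1)
          by (intro borel_measurable_divide borel_measurable_diff borel_measurable_const
              borel_measurable_integrable[OF int] borel_measurable_integrable[OF K'int] U(3)) auto
        thus ?thesis by (simp add: algebra_simps diff_divide_distrib)
      qed
      show "AE w in M. (\<lambda>i. f w * ?q i w) \<longlonglongrightarrow> 0"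
      proof (rule AE_I2)
        fix w assume w: "w \<in> space M"
        have "((\<lambda>y. norm ((K w y - K w x) - K' w x (y - x)) / norm (y - x)) \<longlongrightarrow> 0) (at x within U)"
          using has_derivative_at_withinI[OF deriv[OF w U(3)], of U] unfolding has_derivative_iff_norm by blast
        hence "(\<lambda>i. norm (?q i w)) \<longlonglongrightarrow> 0"
          using X unfolding tendsto_at_iff_sequentially comp_def by (auto simp: abs_divide)
        hence "(\<lambda>i. ?q i w) \<longlonglongrightarrow> 0" by (rule tendsto_norm_zero_cancel)
        thus "(\<lambda>i. f w * ?q i w) \<longlonglongrightarrow> 0" by (rule tendsto_mult_right_zero)
      qed
      show "AE w in M. norm (f w * ?q i w) \<le> 2 * C * \<bar>f w\<bar>" for i
      proof (rule AE_I2)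
        fix w assume w: "w \<in> space M"
        have "\<bar>K w (X i) - K w x - K' w x (X i - x)\<bar> \<le> 2 * C * norm (X i - x)"
          using lip[OF w, of "X i"] bound[OF w U(3), of "X i - x"] X(1) by auto
        moreover have "norm (X i - x) > 0" using X(1) by auto
        ultimately have "\<bar>?q i w\<bar> \<le> 2 * C" by (simp add: abs_divide divide_le_eq)
        thus "norm (f w * ?q i w) \<le> 2 * C * \<bar>f w\<bar>"
          by (metis abs_ge_zero abs_mult mult.commute mult_right_mono real_norm_def)
      qed
    qed auto
    hence "(\<lambda>i. LINT w|M. f w * ?q i w) \<longlonglongrightarrow> 0" by (simp only: Bochner_Integration.integral_zero)
    thus "(\<lambda>i. norm ((?F (X i) - ?F x) - ?D (X i - x)) / norm (X i - x)) \<longlonglongrightarrow> 0"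
      unfolding eq by (rule tendsto_norm_zero)
  qed
  hence "(?F has_derivative ?D) (at x within U)"
    using bl by (simp add: has_derivative_iff_norm)
  thus ?thesis using at_within_open[OF U(3,1)] by simp
qed

section \<open>Test functions\<close>

lemma test_function_smooth: "test_function \<phi> \<Longrightarrow> smooth \<phi>"
  by (auto simp: test_function_def smooth_def)

lemma partial_zero_outside:
  assumes "closed K" "\<And>x. x \<notin> K \<Longrightarrow> \<phi> x = 0" "x \<notin> K"
  shows "partial i \<phi> x = 0"
proof -
  have "(\<phi> has_derivative (\<lambda>_. 0)) (at x)"
    by (rule has_derivative_transform_within_open[of "\<lambda>_. 0" _ _ _ "- K"]) (use assms in auto)
  thus ?thesis by (simp add: partial_eq)
qed

lemma test_function_partial: "test_function \<phi> \<Longrightarrow> test_function (partial i \<phi>)"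
  unfolding test_function_def
  by (metis C_k.simps(2) compact_imp_closed partial_zero_outside)

lemma test_function_mult:
  assumes "smooth g" "test_function \<phi>"
  shows "test_function (\<lambda>x. g x * \<phi> x)" "test_function (\<lambda>x. \<phi> x * g x)"
proof -
  obtain K where "compact K" "K \<subseteq> ball 0 1" "\<forall>x. x \<notin> K \<longrightarrow> \<phi> x = 0"
    using assms by (auto simp: test_function_def)
  thus "test_function (\<lambda>x. g x * \<phi> x)" "test_function (\<lambda>x. \<phi> x * g x)"
    using smooth_mult[OF assms(1) test_function_smooth[OF assms(2)]]
      smooth_mult[OF test_function_smooth[OF assms(2)] assms(1)]
    by (auto simp: test_function_def smooth_def)
qed

lemma test_function_bounded:
  assumes "test_function \<phi>"
  shows "\<exists>C. \<forall>x. \<bar>\<phi> x\<bar> \<le> C"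
proof -
  obtain C where C: "C > 0" "\<And>x. x \<in> cball 0 1 \<Longrightarrow> \<bar>\<phi> x\<bar> \<le> C"
    using continuous_ball_bounded[OF smooth_continuous[OF test_function_smooth[OF assms]], of 1] by blast
  have "\<bar>\<phi> x\<bar> \<le> C" for x
  proof (cases "norm x \<le> 1")
    case False
    hence "\<phi> x = 0" using assms unfolding test_function_def by fastforce
    thus ?thesis using C by simp
  qed (use C in auto)
  thus ?thesis by blast
qed

text \<open>
  The integral of \<open>w \<mapsto> \<phi>(w + y)\<close> does not depend on \<open>y\<close>, so its derivative in \<open>y\<close> vanishes.
\<close>

lemma integral_partial_test_function:
  fixes \<phi> :: "real^'n \<Rightarrow> real"
  assumes "test_function \<phi>"
  shows "(LINT x|ball_measure. partial i \<phi> x) = 0"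
proof -
  have sm: "smooth \<phi>" by (rule test_function_smooth[OF assms])
  obtain K where K: "compact K" "K \<subseteq> ball 0 1" "\<And>x. x \<notin> K \<Longrightarrow> \<phi> x = 0"
    using assms by (auto simp: test_function_def)
  have outside: "\<phi> x = 0" "partial j \<phi> x = 0" if "norm x \<ge> 1" for x j
  proof -
    have "x \<notin> K" using K(2) that by auto
    thus "\<phi> x = 0" "partial j \<phi> x = 0"
      using K(3) partial_zero_outside[OF compact_imp_closed[OF K(1)] K(3)] by auto
  qed
  have cont: "continuous_on UNIV \<phi>" "continuous_on UNIV (partial j \<phi>)" for j
    by (auto intro!: smooth_continuous smooth_intros sm)
  obtain C where C: "\<And>j x. \<bar>partial j \<phi> x\<bar> \<le> C j"
    using test_function_bounded[OF test_function_partial[OF assms]] by metis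
  \<comment> \<open>The ball of radius 2 contains the supports of all translates by less than 1.\<close>
  let ?I = "indicator (cball 0 2) :: real^'n \<Rightarrow> real"
  let ?D = "\<lambda>x h. \<Sum>j\<in>UNIV. h $ j * partial j \<phi> x"
  have D: "((\<lambda>y. LINT w|lborel. ?I w * \<phi> (w + y)) has_derivative
      (\<lambda>h. LINT w|lborel. ?I w * ?D (w + 0) h)) (at 0)"
  proof (rule has_derivative_lebesgue_integral[where U = UNIV and C = "\<Sum>j\<in>UNIV. C j"])
    show "integrable lborel ?I"
      using integrable_indicator_continuous[of "\<lambda>_. 1" 2] by simp
    show "((\<lambda>y. \<phi> (w + y)) has_derivative ?D (w + y)) (at y)" for w y
    proof -
      have "((\<lambda>y. w + y) has_derivative (\<lambda>h. h)) (at y)"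
        by (auto intro!: derivative_eq_intros)
      from has_derivative_compose[OF this derivative_eq_sum_partial[OF smooth_differentiable[OF sm]]]
      show ?thesis .
    qed
    show "\<bar>?D (w + y) h\<bar> \<le> (\<Sum>j\<in>UNIV. C j) * norm h" for w y h
    proof -
      have "\<bar>?D (w + y) h\<bar> \<le> (\<Sum>j\<in>UNIV. \<bar>h $ j\<bar> * \<bar>partial j \<phi> (w + y)\<bar>)"
        using sum_abs[of "\<lambda>j. h $ j * partial j \<phi> (w + y)" UNIV] by (simp add: abs_mult)
      also have "\<dots> \<le> (\<Sum>j\<in>UNIV. norm h * C j)"
        by (intro sum_mono mult_mono component_le_norm_cart C) auto
      finally show ?thesis by (simp add: sum_distrib_left mult.commute)
    qed
    show "(\<lambda>w. ?D (w + 0) h) \<in> borel_measurable lborel" for h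
      unfolding add_0_right measurable_lborel2
      by (intro borel_measurable_continuous_onI continuous_on_sum continuous_on_mult continuous_on_const cont)
    show "integrable lborel (\<lambda>w. ?I w * \<phi> (w + y))" for y
      by (intro integrable_indicator_continuous continuous_on_compose2[OF cont(1)]
          continuous_on_add continuous_on_const continuous_on_id) auto
  qed auto
  have const: "(LINT w|lborel. ?I w * \<phi> (w + y)) = (LINT w|lborel. \<phi> w)" if "y \<in> ball 0 1" for y
  proof -
    have "?I w * \<phi> (w + y) = \<phi> (y + 1 *\<^sub>R w)" for w
    proof (cases "norm w \<le> 2")
      case False
      have "norm (y + w) \<ge> 1" using norm_triangle_ineq4[of "y + w" y] that False by auto
      with outside show ?thesis by (simp add: add.commute)
    qed (simp add: add.commute)
    moreover have "\<phi> \<in> borel_measurable borel"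
      using cont(1) by (simp add: borel_measurable_continuous_onI)
    ultimately show ?thesis using lborel_integral_affine[of 1 \<phi> y] by simp
  qed
  have "((\<lambda>y. LINT w|lborel. ?I w * \<phi> (w + y)) has_derivative (\<lambda>h. 0)) (at 0)"
    by (rule has_derivative_transform_within_open[of "\<lambda>_. LINT w|lborel. \<phi> w" _ _ UNIV "ball 0 1"])
       (auto simp: const)
  with D have "(\<lambda>h. LINT w|lborel. ?I w * ?D (w + 0) h) = (\<lambda>h. 0)"
    by (rule has_derivative_unique)
  hence "(LINT w|lborel. ?I w * ?D (w + 0) (axis i 1)) = 0" by metis
  moreover have "?D (w + 0) (axis i 1) = partial i \<phi> w" for w
    by (simp add: sum_axis)
  moreover have "?I w * partial i \<phi> w = indicator (cball 0 1) w * partial i \<phi> w" for w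
    using outside(2)[of w i] by (auto simp: indicator_def)
  ultimately have "(LINT w|lborel. indicator (cball 0 1) w * partial i \<phi> w) = 0"
    by (simp only:)
  thus ?thesis
    using cont(2) by (subst integral_ball_measure) (auto simp: borel_measurable_continuous_onI)
qed

section \<open>The surface measure\<close>

lemma scale_measure_eq_density: "scale_measure c M = density M (\<lambda>_. c)"
  by (rule measure_eqI) (auto simp: emeasure_density_const)

lemma sgn_measurable_sphere [measurable]:
  "(\<lambda>x. x /\<^sub>R norm x) \<in> restrict_space lborel (cball 0 1 - {0}) \<rightarrow>\<^sub>M
    restrict_space borel (sphere (0::real^'n) 1)"
proof (rule measurable_restrict_space2)
  show "(\<lambda>x. x /\<^sub>R norm x) \<in> borel_measurable (restrict_space lborel (cball (0::real^'n) 1 - {0}))"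
    by (rule measurable_restrict_space1) measurable
qed (auto simp: space_restrict_space)

lemma borel_sphere_measurable:
  "F \<in> borel_measurable borel \<Longrightarrow> F \<in> borel_measurable (sphere_measure :: (real^'n) measure)"
  for F :: "real^'n \<Rightarrow> real"
  unfolding sphere_measure_def measurable_cong_sets[OF sets_scale_measure refl]
  by (simp add: measurable_restrict_space1)

lemma finite_sphere_measure: "finite_measure (sphere_measure :: (real^'n) measure)"
proof (rule finite_measureI)
  let ?R = "restrict_space lborel (cball 0 1 - {0}) :: (real^'n) measure"
  let ?S = "restrict_space borel (sphere 0 1) :: (real^'n) measure"
  have "emeasure (distr ?R ?S (\<lambda>x. x /\<^sub>R norm x)) (space ?S) =
      emeasure ?R ((\<lambda>x. x /\<^sub>R norm x) -` space ?S \<inter> space ?R)"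
    by (rule emeasure_distr[OF sgn_measurable_sphere sets.top])
  also have "\<dots> \<le> emeasure ?R (space ?R)"
    by (rule emeasure_mono[OF _ sets.top]) blast
  also have "\<dots> \<le> emeasure lborel (cball (0::real^'n) 1)"
    by (subst emeasure_restrict_space) (auto simp: space_restrict_space intro!: emeasure_mono)
  also have "\<dots> < \<infinity>" by (intro emeasure_bounded_finite) simp
  finally have "emeasure (distr ?R ?S (\<lambda>x. x /\<^sub>R norm x)) (space ?S) < \<infinity>" .
  thus "emeasure (sphere_measure :: (real^'n) measure) (space sphere_measure) \<noteq> \<infinity>"
    unfolding sphere_measure_def space_scale_measure space_distr emeasure_scale_measure
    by (auto simp: ennreal_mult_eq_top_iff)
qed

interpretation sphere_measure: finite_measure "sphere_measure :: (real^'n) measure"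
  by (rule finite_sphere_measure)

text \<open>
  The surface measure is defined as a cone measure, so integrals over the sphere become integrals of
  functions that are homogeneous of degree \<open>0\<close> over the ball.
\<close>

lemma integral_sphere_measure:
  fixes F :: "real^'n \<Rightarrow> real"
  assumes [measurable]: "F \<in> borel_measurable borel"
  shows "(LINT y|sphere_measure. F y) = CARD('n) * (LINT x|ball_measure. F (x /\<^sub>R norm x))"
proof -
  let ?R = "restrict_space lborel (cball 0 1 - {0}) :: (real^'n) measure"
  have [measurable]: "F \<in> borel_measurable (restrict_space borel (sphere 0 1))"
    by (simp add: measurable_restrict_space1)
  have "(LINT y|sphere_measure. F y) =
      (LINT y|distr ?R (restrict_space borel (sphere 0 1)) (\<lambda>x. x /\<^sub>R norm x). real CARD('n) * F y)"
    unfolding sphere_measure_def scale_measure_eq_density ennreal_of_nat_eq_real_of_nat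
    by (subst integral_density) auto
  also have "\<dots> = CARD('n) * (LINT x|?R. F (x /\<^sub>R norm x))"
    by (subst integral_distr) auto
  also have "(LINT x|?R. F (x /\<^sub>R norm x)) = (LINT x|lborel. indicator (cball 0 1 - {0}) x * F (x /\<^sub>R norm x))"
    by (subst integral_restrict_space) auto
  also have "\<dots> = (LINT x|lborel. indicator (cball 0 1) x * F (x /\<^sub>R norm x))"
    by (rule integral_cong_AE) (auto intro!: AE_I'[of "{0}"] simp: indicator_def)
  also have "\<dots> = (LINT x|ball_measure. F (x /\<^sub>R norm x))"
    by (rule integral_ball_measure[symmetric]) measurable
  finally show ?thesis .
qed

text \<open>
  The derivative \<open>x \<bullet> \<nabla>F\<close> in radial direction.
\<close>

definition radial :: "(real^'n \<Rightarrow> real) \<Rightarrow> real^'n \<Rightarrow> real"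
  where "radial F x = (\<Sum>i\<in>UNIV. x $ i * partial i F x)"

lemma C1_continuous:
  assumes "C_k 1 F"
  shows "continuous_on UNIV F" "continuous_on UNIV (partial i F)" "continuous_on UNIV (radial F)"
    "F differentiable (at x)"
proof -
  have "C_k 0 F" using assms by (rule C_k_le) simp
  thus "continuous_on UNIV F" by simp
  show *: "continuous_on UNIV (partial i F)" for i using assms by simp
  show "F differentiable (at x)" using assms by simp
  show "continuous_on UNIV (radial F)"
    unfolding radial_def by (intro continuous_on_sum continuous_on_mult continuous_on_component continuous_on_id *)
qed

lemma dilation_has_derivative:
  fixes F :: "real^'n \<Rightarrow> real"
  assumes "C_k 1 F"
  shows "((\<lambda>r. LINT x|ball_measure. F (r *\<^sub>R x)) has_real_derivative (LINT x|ball_measure. radial F x)) (at 1)"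
proof -
  note cont = C1_continuous[OF assms]
  have "\<exists>C. \<forall>x\<in>cball 0 2. \<bar>radial F x\<bar> \<le> C \<and> (\<forall>j. \<bar>partial j F x\<bar> \<le> C)"
  proof -
    have "\<exists>C. \<forall>x\<in>cball 0 2. \<bar>partial j F x\<bar> \<le> C" for j
      using continuous_ball_bounded[OF cont(2)[of j], of 2] by metis
    then obtain C where C: "\<And>j x. x \<in> cball 0 2 \<Longrightarrow> \<bar>partial j F x\<bar> \<le> C j" by metis
    obtain D where D: "\<And>x. x \<in> cball 0 2 \<Longrightarrow> \<bar>radial F x\<bar> \<le> D"
      using continuous_ball_bounded[OF cont(3), of 2] by metis
    have "\<bar>partial j F x\<bar> \<le> (\<Sum>j\<in>UNIV. \<bar>C j\<bar>)" if "x \<in> cball 0 2" for x j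
      using C[OF that, of j] member_le_sum[of j UNIV "\<lambda>j. \<bar>C j\<bar>"] by auto
    thus ?thesis using D by (intro exI[of _ "max D (\<Sum>j\<in>UNIV. \<bar>C j\<bar>)"]) (auto simp: le_max_iff_disj)
  qed
  then obtain C where C: "\<And>x j. x \<in> cball 0 2 \<Longrightarrow> \<bar>partial j F x\<bar> \<le> C" by blast
  have C0: "C \<ge> 0" using C[of 0] by fastforce
  let ?D = "\<lambda>w r h. h * (\<Sum>j\<in>UNIV. w $ j * partial j F (r *\<^sub>R w))"
  have "((\<lambda>r. LINT w|ball_measure. 1 * F (r *\<^sub>R w)) has_derivative
      (\<lambda>h. LINT w|ball_measure. 1 * ?D w 1 h)) (at 1)"
  proof (rule has_derivative_lebesgue_integral[where U = "ball 1 1" and C = "CARD('n) * C"])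
    show "((\<lambda>r. F (r *\<^sub>R w)) has_derivative ?D w r) (at r)" for w r
    proof -
      have "((\<lambda>r. r *\<^sub>R w) has_derivative (\<lambda>h. h *\<^sub>R w)) (at r)"
        by (auto intro!: derivative_eq_intros)
      from has_derivative_compose[OF this derivative_eq_sum_partial[OF cont(4)]]
      show ?thesis by (simp add: sum_distrib_left mult.assoc)
    qed
    show "\<bar>?D w r h\<bar> \<le> CARD('n) * C * norm h" if "w \<in> space ball_measure" "r \<in> ball 1 1" for w :: "real^'n" and r h
    proof -
      have w: "norm w \<le> 1" "0 < r" "r < 2" using that by (auto simp: dist_real_def)
      hence "norm (r *\<^sub>R w) \<le> 2" using mult_mono[of r 2 "norm w" 1] by auto
      hence "\<bar>w $ j * partial j F (r *\<^sub>R w)\<bar> \<le> 1 * C" for j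
        unfolding abs_mult using w C[of "r *\<^sub>R w" j] component_le_norm_cart[of w j]
        by (intro mult_mono) auto
      hence "\<bar>\<Sum>j\<in>UNIV. w $ j * partial j F (r *\<^sub>R w)\<bar> \<le> CARD('n) * C"
        by (intro order.trans[OF sum_abs] sum_bounded_above[where K = C, simplified]) auto
      thus ?thesis by (simp add: abs_mult mult.commute[of _ "\<bar>h\<bar>"] mult_left_mono)
    qed
    show "(\<lambda>w. ?D w 1 h) \<in> borel_measurable ball_measure" for h
      unfolding scaleR_one
      by (intro continuous_ball_measurable continuous_on_sum continuous_on_mult continuous_on_const
          cont continuous_on_component continuous_on_id)
    show "integrable ball_measure (\<lambda>w. 1 * F (r *\<^sub>R w))" for r
      unfolding mult_1
      by (intro integrable_continuous_ball continuous_on_compose2[OF cont(1)]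
          continuous_on_scaleR continuous_on_const continuous_on_id) auto
  qed auto
  from this[unfolded mult_1 scaleR_one] show ?thesis
    unfolding has_field_derivative_def radial_def
    by (rule has_derivative_eq_rhs) (simp add: fun_eq_iff mult.commute)
qed

text \<open>
  Both sides are the derivative at \<open>r = 1\<close> of \<open>M(r) = \<integral>\<^bsub>|x| \<le> r\<^esub> F\<close>. Scaling gives
  \<open>M(r) = r\<^sup>d \<integral>\<^bsub>B\<^esub> F(r x) dx\<close>, whose derivative is the right-hand side. On the other hand, in the thin shell
  \<open>r < |x| \<le> 1\<close> the function \<open>F\<close> is uniformly close to \<open>G(x) = F(x/|x|)\<close>, and the integral of \<open>G\<close> over
  the shell is exactly \<open>(1 - r\<^sup>d) \<integral>\<^bsub>B\<^esub> G\<close>; so \<open>(M(1) - M(r)) / (1 - r\<^sup>d)\<close> tends to \<open>\<integral>\<^bsub>B\<^esub> G\<close>. This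
  argument avoids polar coordinates.
\<close>

lemma integral_radial:
  fixes F :: "real^'n \<Rightarrow> real"
  assumes "C_k 1 F"
  shows "(LINT y|sphere_measure. F y) = (LINT x|ball_measure. CARD('n) * F x + radial F x)"
proof -
  note cont = C1_continuous[OF assms]
  let ?d = "CARD('n)"
  have bm [measurable]: "F \<in> borel_measurable borel"
    using cont(1) by (rule borel_measurable_continuous_onI)
  define G where "G x = F (x /\<^sub>R norm x)" for x
  have [measurable]: "G \<in> borel_measurable borel" unfolding G_def by measurable
  define V where "V = (LINT x|lborel. indicator (cball (0::real^'n) 1) x :: real)"
  define M where "M r = (LINT x|lborel. indicator (cball 0 r) x * F x)" for r
  define g where "g = (LINT x|lborel. indicator (cball 0 1) x * G x)"
  have scale: "(LINT x|lborel. indicator (cball 0 r) x * H x) =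
      r ^ ?d * (LINT x|lborel. indicator (cball 0 1) x * H (r *\<^sub>R x))"
    if "r > 0" "H \<in> borel_measurable borel" for r and H :: "real^'n \<Rightarrow> real"
  proof -
    have "indicator (cball 0 r) (r *\<^sub>R x) = (indicator (cball 0 1) x :: real)" for x :: "real^'n"
      using that(1) by (auto simp: indicator_def)
    moreover have "(\<lambda>x. indicator (cball 0 r) x * H x) \<in> borel_measurable borel"
      using that(2) by (intro borel_measurable_times borel_measurable_indicator) auto
    ultimately show ?thesis
      using that(1) lborel_integral_affine[of r "\<lambda>x. indicator (cball 0 r) x * H x" 0] by simp
  qed
  have V: "(LINT x|lborel. indicator (cball (0::real^'n) r) x :: real) = r ^ ?d * V" if "r > 0" for r
    using scale[OF that, of "\<lambda>_. 1"] by (simp add: V_def)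
  have V0: "V \<ge> 0" unfolding V_def by simp
  have Gint: "integrable lborel (\<lambda>x. indicator (cball 0 r) x * G x)" for r
  proof -
    obtain C where C: "\<And>x. x \<in> cball 0 1 \<Longrightarrow> \<bar>F x\<bar> \<le> C"
      using continuous_ball_bounded[OF cont(1), of 1] by metis
    have "integrable lborel (\<lambda>x. indicator (cball (0::real^'n) r) x * C)"
      by (rule integrable_indicator_continuous) auto
    thus ?thesis
    proof (rule Bochner_Integration.integrable_bound)
      show "AE x in lborel. norm (indicator (cball 0 r) x * G x) \<le> norm (indicator (cball (0::real^'n) r) x * C)"
      proof (rule AE_I2)
        fix x :: "real^'n"
        have "\<bar>G x\<bar> \<le> C" unfolding G_def by (rule C) (cases "x = 0"; simp)
        thus "norm (indicator (cball 0 r) x * G x) \<le> norm (indicator (cball (0::real^'n) r) x * C)"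
          by (auto simp: indicator_def)
      qed
    qed (auto intro!: borel_measurable_times borel_measurable_indicator)
  qed
  have Gr: "(LINT x|lborel. indicator (cball 0 r) x * G x) = r ^ ?d * g" if "r > 0" for r
  proof -
    have "(r *\<^sub>R x) /\<^sub>R norm (r *\<^sub>R x) = x /\<^sub>R norm x" for x :: "real^'n"
      using that by (simp add: mult.commute[of "inverse r"] mult.assoc)
    hence "G (r *\<^sub>R x) = G x" for x by (simp only: G_def)
    moreover have "G \<in> borel_measurable borel" by measurable
    ultimately show ?thesis using scale[OF that, of G] by (simp add: g_def)
  qed
  define Q where "Q r = (M 1 - M r) / (1 - r ^ ?d)" for r
  have pow: "r ^ ?d < 1" if "0 < r" "r < 1" for r :: real
    using that by (intro power_less_one_iff[THEN iffD2]) auto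
  have Q: "(1 - r ^ ?d) * Q r = M 1 - M r" if "0 < r" "r < 1" for r
    using pow[OF that] by (simp add: Q_def)
  have Qlim: "(Q \<longlongrightarrow> g) (at_left 1)"
  proof (rule tendstoI)
    fix e :: real assume e: "e > 0"
    have "uniformly_continuous_on (cball 0 1) F"
      by (rule compact_uniformly_continuous[OF continuous_on_subset[OF cont(1)]]) auto
    moreover have "e / (V + 1) > 0" using V0 e by simp
    ultimately obtain \<delta> where \<delta>: "\<delta> > 0"
      "\<And>x y. x \<in> cball 0 1 \<Longrightarrow> y \<in> cball 0 1 \<Longrightarrow> dist y x < \<delta> \<Longrightarrow> dist (F y) (F x) < e / (V + 1)"
      unfolding uniformly_continuous_on_def by metis
    have "dist (Q r) g < e" if r: "0 < r" "1 - \<delta> < r" "r < 1" for r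
    proof -
      let ?I = "\<lambda>x::real^'n. indicator (cball 0 1) x - indicator (cball 0 r) x :: real"
      have Iint: "integrable lborel ?I"
        using integrable_indicator_continuous[of "\<lambda>_. 1"] by (intro Bochner_Integration.integrable_diff) auto
      have Iint': "(LINT x|lborel. ?I x) = V * (1 - r ^ ?d)"
        using V[OF r(1)] V[of 1] integrable_indicator_continuous[of "\<lambda>_. 1"]
        by (subst Bochner_Integration.integral_diff) (auto simp: algebra_simps)
      have FGint: "integrable lborel (\<lambda>x. ?I x * (F x - G x))"
        using Gint[of 1] Gint[of r] integrable_indicator_continuous[OF cont(1), of 1]
          integrable_indicator_continuous[OF cont(1), of r]
        by (simp add: algebra_simps)
      have "(M 1 - M r) - (1 - r ^ ?d) * g =
        (LINT x|lborel. indicator (cball 0 1) x * F x) - (LINT x|lborel. indicator (cball 0 r) x * F x)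
        - ((LINT x|lborel. indicator (cball 0 1) x * G x) - (LINT x|lborel. indicator (cball 0 r) x * G x))"
        using Gr[OF r(1)] by (simp add: M_def g_def algebra_simps)
      also have "\<dots> = (LINT x|lborel. (indicator (cball 0 1) x * F x - indicator (cball 0 r) x * F x)
          - (indicator (cball 0 1) x * G x - indicator (cball 0 r) x * G x))"
        using Gint integrable_indicator_continuous[OF cont(1)]
        by (simp del: Bochner_Integration.integral_mult_left_zero Bochner_Integration.integral_mult_right_zero)
      also have "\<dots> = (LINT x|lborel. ?I x * (F x - G x))"
        by (intro Bochner_Integration.integral_cong) (auto simp: algebra_simps)
      finally have eq: "(M 1 - M r) - (1 - r ^ ?d) * g = (LINT x|lborel. ?I x * (F x - G x))" .
      have "\<bar>LINT x|lborel. ?I x * (F x - G x)\<bar> \<le> (LINT x|lborel. \<bar>?I x * (F x - G x)\<bar>)"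
        by (rule integral_abs_bound)
      also have "\<dots> \<le> (LINT x|lborel. ?I x * (e / (V + 1)))"
      proof (rule integral_mono)
        fix x :: "real^'n"
        show "\<bar>?I x * (F x - G x)\<bar> \<le> ?I x * (e / (V + 1))"
        proof (cases "r < norm x \<and> norm x \<le> 1")
          case True
          hence x: "norm x > 0" using r by linarith
          have "x - x /\<^sub>R norm x = (1 - inverse (norm x)) *\<^sub>R x" by (simp add: algebra_simps)
          hence "dist x (x /\<^sub>R norm x) = \<bar>1 - inverse (norm x)\<bar> * norm x" by (simp add: dist_norm)
          also have "\<dots> = (inverse (norm x) - 1) * norm x"
            using one_le_inverse[OF x] True by simp
          also have "\<dots> = 1 - norm x" using x by (simp add: algebra_simps)
          finally have "dist x (x /\<^sub>R norm x) < \<delta>" using True r by auto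
          hence "dist (F x) (G x) < e / (V + 1)"
            unfolding G_def using True x by (intro \<delta>(2)) auto
          thus ?thesis using True r by (auto simp: dist_real_def indicator_def)
        next
          case False
          hence "?I x = 0" using r by (auto simp: indicator_def)
          thus ?thesis by simp
        qed
      qed (use FGint Iint in \<open>auto intro: integrable_abs\<close>)
      also have "\<dots> = (1 - r ^ ?d) * (V / (V + 1) * e)" using Iint' Iint by simp
      finally have "\<bar>(M 1 - M r) - (1 - r ^ ?d) * g\<bar> \<le> (1 - r ^ ?d) * (V / (V + 1) * e)"
        using eq by simp
      moreover have "(M 1 - M r) - (1 - r ^ ?d) * g = (1 - r ^ ?d) * (Q r - g)"
        unfolding right_diff_distrib Q[OF r(1,3)] by simp
      moreover have "\<bar>(1 - r ^ ?d) * (Q r - g)\<bar> = (1 - r ^ ?d) * \<bar>Q r - g\<bar>"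
        using pow[OF r(1,3)] by (simp add: abs_mult)
      ultimately have "(1 - r ^ ?d) * \<bar>Q r - g\<bar> \<le> (1 - r ^ ?d) * (V / (V + 1) * e)"
        by metis
      hence "\<bar>Q r - g\<bar> \<le> V / (V + 1) * e"
        by (rule mult_left_le_imp_le) (use pow[OF r(1,3)] in simp)
      also have "\<dots> < e" using e V0 by (simp add: field_simps)
      finally show ?thesis by (simp add: dist_real_def)
    qed
    moreover have "eventually (\<lambda>r. r \<in> {max 0 (1 - \<delta>)<..<1}) (at_left (1::real))"
      using \<delta>(1) by (intro eventually_at_left_real) auto
    ultimately show "eventually (\<lambda>r. dist (Q r) g < e) (at_left 1)"
      by (auto elim!: eventually_mono)
  qed
  let ?A = "\<lambda>r. LINT x|ball_measure. F (r *\<^sub>R x)"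
  have MA: "M r = r ^ ?d * ?A r" if "r > 0" for r
    using scale[OF that bm] by (simp add: M_def integral_ball_measure)
  have "((\<lambda>r. r ^ ?d * ?A r) has_real_derivative ?d * ?A 1 + (LINT x|ball_measure. radial F x)) (at 1)"
    using dilation_has_derivative[OF assms] by (auto intro!: derivative_eq_intros)
  hence "(M has_real_derivative ?d * ?A 1 + (LINT x|ball_measure. radial F x)) (at 1)"
    by (rule has_field_derivative_transform_within_open[where S = "{0<..}"]) (auto simp: MA)
  hence 1: "((\<lambda>r. (M r - M 1) / (r - 1)) \<longlongrightarrow> ?d * ?A 1 + (LINT x|ball_measure. radial F x)) (at_left 1)"
    using has_field_derivative_at_within[of M _ 1 "{..<1}"] unfolding has_field_derivative_iff by simp
  have "((\<lambda>r. r ^ ?d) has_real_derivative ?d) (at 1)" by (auto intro!: derivative_eq_intros)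
  hence "((\<lambda>r. (r ^ ?d - 1) / (r - 1)) \<longlongrightarrow> real ?d) (at_left 1)"
    using has_field_derivative_at_within[of "\<lambda>r. r ^ ?d" "real ?d" 1 "{..<1}"] by (simp add: has_field_derivative_iff)
  with Qlim have 2: "((\<lambda>r. Q r * ((r ^ ?d - 1) / (r - 1))) \<longlongrightarrow> g * ?d) (at_left 1)"
    by (intro tendsto_mult)
  have "eventually (\<lambda>r. r \<in> {0<..<1}) (at_left (1::real))"
    by (intro eventually_at_left_real) auto
  hence "eventually (\<lambda>r. Q r * ((r ^ ?d - 1) / (r - 1)) = (M r - M 1) / (r - 1)) (at_left 1)"
  proof eventually_elim
    case (elim r)
    hence "Q r * (r ^ ?d - 1) = M r - M 1" using Q[of r] by (simp add: algebra_simps)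
    thus ?case by (metis times_divide_eq_right)
  qed
  from tendsto_unique[OF _ Lim_transform_eventually[OF 2 this] 1]
  have "g * ?d = ?d * ?A 1 + (LINT x|ball_measure. radial F x)" by simp
  moreover have "(LINT y|sphere_measure. F y) = ?d * g"
    unfolding integral_sphere_measure[OF bm] g_def G_def by (subst integral_ball_measure) measurable
  moreover have "(LINT x|ball_measure. ?d * F x + radial F x) = ?d * ?A 1 + (LINT x|ball_measure. radial F x)"
    using integrable_continuous_ball[OF cont(1)] integrable_continuous_ball[OF cont(3)] by simp
  ultimately show ?thesis by (simp add: mult.commute)
qed

section \<open>Square-integrable functions\<close>

lemma square_integrable_mult:
  assumes "square_integrable M f" "square_integrable M g"
  shows "integrable M (\<lambda>x. f x * g x)"
proof (rule Bochner_Integration.integrable_bound)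
  show "integrable M (\<lambda>x. (f x)\<^sup>2 + (g x)\<^sup>2)"
    using assms by (auto simp: square_integrable_def)
  have "\<bar>a * b\<bar> \<le> a\<^sup>2 + b\<^sup>2" for a b :: real
    using sum_squares_bound[of "\<bar>a\<bar>" "\<bar>b\<bar>"] mult_nonneg_nonneg[of "\<bar>a\<bar>" "\<bar>b\<bar>"]
    unfolding abs_mult power2_abs mult.assoc by linarith
  thus "AE x in M. norm (f x * g x) \<le> norm ((f x)\<^sup>2 + (g x)\<^sup>2)" by auto
  show "(\<lambda>x. f x * g x) \<in> borel_measurable M"
    using assms by (intro borel_measurable_times) (auto simp: square_integrable_def)
qed

lemma square_integrable_cmult:
  "square_integrable M f \<Longrightarrow> square_integrable M (\<lambda>x. c * f x)"
  unfolding square_integrable_def power_mult_distrib by (simp add: borel_measurable_times)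

lemma square_integrable_add:
  assumes "square_integrable M f" "square_integrable M g"
  shows "square_integrable M (\<lambda>x. f x + g x)"
  unfolding square_integrable_def
proof
  show "(\<lambda>x. f x + g x) \<in> borel_measurable M"
    using assms by (intro borel_measurable_add) (simp_all add: square_integrable_def)
  have "integrable M (\<lambda>x. (f x)\<^sup>2 + (g x)\<^sup>2 + 2 * (f x * g x))"
    using assms square_integrable_mult[OF assms]
    by (intro Bochner_Integration.integrable_add integrable_mult_right) (simp_all add: square_integrable_def)
  thus "integrable M (\<lambda>x. (f x + g x)\<^sup>2)"
    by (simp add: power2_sum mult.assoc)
qed

lemma square_integrable_diff:
  assumes "square_integrable M f" "square_integrable M g"
  shows "square_integrable M (\<lambda>x. f x - g x)"
  using square_integrable_add[OF assms(1) square_integrable_cmult[OF assms(2), of "-1"]] by simp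

lemma (in finite_measure) square_integrable_const: "square_integrable M (\<lambda>x. c)"
  by (simp add: square_integrable_def)

lemma (in finite_measure) square_integrable_integrable:
  "square_integrable M f \<Longrightarrow> integrable M f"
  using square_integrable_mult[OF _ square_integrable_const[of 1]] by simp

lemma square_integrable_continuous_ball:
  "continuous_on UNIV F \<Longrightarrow> square_integrable ball_measure F" for F :: "real^'n \<Rightarrow> real"
  unfolding square_integrable_def
  by (auto intro!: continuous_ball_measurable integrable_continuous_ball continuous_on_power)

text \<open>
  A measurable function is the almost everywhere limit of continuous functions. Truncating at a
  level \<open>M\<close> makes the convergence dominated, and the truncation error is small for large \<open>M\<close>.
\<close>

lemma continuous_dense_L2:
  fixes g :: "real^'n \<Rightarrow> real"
  assumes g: "square_integrable ball_measure g" and "\<delta> > 0"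
  obtains h where "continuous_on UNIV h" "(LINT x|ball_measure. (g x - h x)\<^sup>2) < \<delta>"
proof -
  define tr :: "nat \<Rightarrow> real \<Rightarrow> real" where "tr M y = max (- real M) (min (real M) y)" for M y
  have tr_le: "\<bar>tr M y\<bar> \<le> real M" "\<bar>y - tr M y\<bar> \<le> \<bar>y\<bar>" for M y by (auto simp: tr_def)
  have tr_cont: "continuous_on A (tr M)" for A M
    unfolding tr_def by (intro continuous_on_max continuous_on_min continuous_on_const continuous_on_id)
  have [measurable]: "tr M \<in> borel_measurable borel" for M
    using tr_cont by (rule borel_measurable_continuous_onI)
  have gm [measurable]: "g \<in> borel_measurable ball_measure" and gi: "integrable ball_measure (\<lambda>x. (g x)\<^sup>2)"
    using g by (auto simp: square_integrable_def)
  have "(\<lambda>M. LINT x|ball_measure. (g x - tr M (g x))\<^sup>2) \<longlonglongrightarrow> (LINT x|(ball_measure::(real^'n) measure). 0)"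
  proof (rule integral_dominated_convergence[OF _ _ gi])
    show "AE x in ball_measure. (\<lambda>M. (g x - tr M (g x))\<^sup>2) \<longlonglongrightarrow> 0"
    proof (rule AE_I2)
      fix x
      obtain N where N: "\<bar>g x\<bar> \<le> real N" using real_arch_simple by blast
      have "\<forall>\<^sub>F M in sequentially. (g x - tr M (g x))\<^sup>2 = 0"
        using eventually_ge_at_top[of N]
        by eventually_elim (use N in \<open>auto simp: tr_def min_def max_def\<close>)
      thus "(\<lambda>M. (g x - tr M (g x))\<^sup>2) \<longlonglongrightarrow> 0" by (rule tendsto_eventually)
    qed
    show "AE x in ball_measure. norm ((g x - tr M (g x))\<^sup>2) \<le> (g x)\<^sup>2" for M
      using tr_le(2) by (intro AE_I2) (simp add: abs_le_square_iff)
  qed measurable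
  hence "\<forall>\<^sub>F M in sequentially. (LINT x|ball_measure. (g x - tr M (g x))\<^sup>2) < \<delta> / 4"
    by (intro order_tendstoD(2)[where y = 0]) (use \<open>\<delta> > 0\<close> in simp_all)
  then obtain M where M: "(LINT x|ball_measure. (g x - tr M (g x))\<^sup>2) < \<delta> / 4"
    by (meson eventually_sequentially order_refl)
  have "g measurable_on cball 0 1"
    using gm by (subst measurable_on_iff_borel_measurable) auto
  then obtain N H where H: "negligible N" "\<And>n. continuous_on UNIV (H n)"
    "\<And>x. x \<notin> N \<Longrightarrow> (\<lambda>n. H n x) \<longlonglongrightarrow> (if x \<in> cball 0 1 then g x else 0)"
    unfolding measurable_on_def by metis
  have Hc: "continuous_on UNIV (\<lambda>x. tr M (H n x))" for n
    by (rule continuous_on_compose2[OF tr_cont H(2)]) auto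
  note [measurable] = continuous_ball_measurable[OF Hc]
  have "(\<lambda>n. LINT x|ball_measure. (tr M (g x) - tr M (H n x))\<^sup>2) \<longlonglongrightarrow> (LINT x|(ball_measure::(real^'n) measure). 0)"
  proof (rule integral_dominated_convergence[where w = "\<lambda>_. (2 * real M)\<^sup>2"])
    show "AE x in ball_measure. (\<lambda>n. (tr M (g x) - tr M (H n x))\<^sup>2) \<longlonglongrightarrow> 0"
    proof (rule AE_I')
      show "N \<inter> cball 0 1 \<in> null_sets ball_measure"
        using H(1) by (subst null_sets_restrict_space)
          (auto simp: negligible_iff_null_sets intro: null_set_Int2)
      show "{x \<in> space ball_measure. \<not> (\<lambda>n. (tr M (g x) - tr M (H n x))\<^sup>2) \<longlonglongrightarrow> 0} \<subseteq> N \<inter> cball 0 1"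
      proof (rule subsetI, rule ccontr)
        fix x assume x: "x \<in> {x \<in> space ball_measure. \<not> (\<lambda>n. (tr M (g x) - tr M (H n x))\<^sup>2) \<longlonglongrightarrow> 0}"
          "x \<notin> N \<inter> cball 0 1"
        hence "(\<lambda>n. H n x) \<longlonglongrightarrow> g x" using H(3)[of x] by auto
        hence "(\<lambda>n. tr M (H n x)) \<longlonglongrightarrow> tr M (g x)"
          using tr_cont[of UNIV M] by (metis continuous_on_tendsto_compose UNIV_I always_eventually)
        hence "(\<lambda>n. (tr M (g x) - tr M (H n x))\<^sup>2) \<longlonglongrightarrow> (tr M (g x) - tr M (g x))\<^sup>2"
          by (intro tendsto_power tendsto_diff tendsto_const)
        with x show False by simp
      qed
    qed
    show "AE x in ball_measure. norm ((tr M (g x) - tr M (H n x))\<^sup>2) \<le> (2 * real M)\<^sup>2" for n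
    proof (rule AE_I2)
      fix x
      have b: "\<bar>tr M (g x) - tr M (H n x)\<bar> \<le> 2 * real M"
        using tr_le(1)[of M "g x"] tr_le(1)[of M "H n x"] by linarith
      show "norm ((tr M (g x) - tr M (H n x))\<^sup>2) \<le> (2 * real M)\<^sup>2"
        using power_mono[OF b abs_ge_zero, of 2] by simp
    qed
  qed auto
  hence "\<forall>\<^sub>F n in sequentially. (LINT x|ball_measure. (tr M (g x) - tr M (H n x))\<^sup>2) < \<delta> / 4"
    by (intro order_tendstoD(2)[where y = 0]) (use \<open>\<delta> > 0\<close> in simp_all)
  then obtain n where n: "(LINT x|ball_measure. (tr M (g x) - tr M (H n x))\<^sup>2) < \<delta> / 4"
    by (meson eventually_sequentially order_refl)
  have trg: "square_integrable ball_measure (\<lambda>x. tr M (g x))"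
    unfolding square_integrable_def
  proof
    show "integrable ball_measure (\<lambda>x. (tr M (g x))\<^sup>2)"
      using tr_le(1)[of M]
      by (intro ball_measure.integrable_const_bound[where B = "(real M)\<^sup>2"] AE_I2) (auto simp: power2_le_iff_abs_le)
  qed measurable
  note sq = square_integrable_diff[OF g trg] square_integrable_diff[OF trg square_integrable_continuous_ball[OF Hc]]
    square_integrable_diff[OF g square_integrable_continuous_ball[OF Hc]]
  have "(LINT x|ball_measure. (g x - tr M (H n x))\<^sup>2) \<le>
      (LINT x|ball_measure. 2 * (g x - tr M (g x))\<^sup>2 + 2 * (tr M (g x) - tr M (H n x))\<^sup>2)"
  proof (rule integral_mono)
    fix x
    show "(g x - tr M (H n x))\<^sup>2 \<le> 2 * (g x - tr M (g x))\<^sup>2 + 2 * (tr M (g x) - tr M (H n x))\<^sup>2"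
      using zero_le_power2[of "(g x - tr M (g x)) - (tr M (g x) - tr M (H n x))"]
      by (simp add: power2_eq_square algebra_simps)
  qed (use sq in \<open>auto simp: square_integrable_def\<close>)
  also have "\<dots> = 2 * (LINT x|ball_measure. (g x - tr M (g x))\<^sup>2) + 2 * (LINT x|ball_measure. (tr M (g x) - tr M (H n x))\<^sup>2)"
    using sq by (simp add: square_integrable_def)
  also have "\<dots> < \<delta>" using M n by simp
  finally show ?thesis using Hc that by blast
qed

section \<open>Mollification\<close>

definition bump :: "real^'n \<Rightarrow> real"
  where "bump z = flat 1 (1 / 4 - (norm z)\<^sup>2)"

text \<open>
  The dimension is passed as a type, since \<open>bump_mass\<close> depends on nothing else.
\<close>

definition bump_mass :: "'n::finite itself \<Rightarrow> real"
  where "bump_mass _ = (LINT z|lborel. bump (z::real^'n))"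

text \<open>
  In terms of the unit-mass bump \<open>\<rho>\<close> this is \<open>\<epsilon>\<^bsup>-d\<^esup> \<rho>((w - (1 - \<epsilon>) x) / \<epsilon>)\<close>. The contraction of \<open>x\<close> by the factor
  \<open>1 - \<epsilon>\<close> keeps the support in \<open>w\<close> inside the open ball for every \<open>x\<close> of the closed ball, so that it is an
  admissible test function up to the boundary.
\<close>

definition mollifier :: "real \<Rightarrow> real^'n \<Rightarrow> real^'n \<Rightarrow> real"
  where "mollifier \<epsilon> x w =
    bump ((1 / \<epsilon>) *\<^sub>R w + (- ((1 - \<epsilon>) / \<epsilon>)) *\<^sub>R x) / (\<epsilon> ^ CARD('n) * bump_mass TYPE('n))"

definition mollify :: "real \<Rightarrow> (real^'n \<Rightarrow> real) \<Rightarrow> real^'n \<Rightarrow> real"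
  where "mollify \<epsilon> g x = (LINT w|ball_measure. g w * mollifier \<epsilon> x w)"

lemma bump_nonneg: "bump z \<ge> 0"
  by (simp add: bump_def flat_def)

lemma smooth_bump: "smooth (bump :: real^'n \<Rightarrow> real)"
  unfolding bump_def[abs_def] by (intro smooth_intros)

lemma bump_eq_0: "norm z \<ge> 1 / 2 \<Longrightarrow> bump z = 0"
  using power_mono[of "1 / 2" "norm z" 2] by (simp add: bump_def flat_def power2_eq_square)

lemma bump_pos: "norm z < 1 / 2 \<Longrightarrow> bump z > 0"
  using power_strict_mono[of "norm z" "1 / 2" 2] by (simp add: bump_def flat_def power2_eq_square)

lemma test_function_bump: "test_function (bump :: real^'n \<Rightarrow> real)"
  unfolding test_function_def
proof
  show "\<forall>k. C_k k (bump :: real^'n \<Rightarrow> real)" using smooth_bump by (simp add: smooth_def)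
  show "\<exists>K. compact K \<and> K \<subseteq> ball 0 1 \<and> (\<forall>x. x \<notin> K \<longrightarrow> bump (x::real^'n) = 0)"
    by (intro exI[of _ "cball 0 (1 / 2)"]) (auto intro: bump_eq_0)
qed

lemma bump_measurable [measurable]: "bump \<in> borel_measurable borel"
  by (intro borel_measurable_continuous_onI smooth_continuous smooth_bump)

lemma integrable_bump: "integrable lborel (bump :: real^'n \<Rightarrow> real)"
proof -
  have *: "indicator (cball 0 1) x * bump x = bump x" for x :: "real^'n"
    by (auto simp: indicator_def bump_eq_0)
  show ?thesis
    using integrable_indicator_continuous[OF smooth_continuous[OF smooth_bump[where 'n = 'n]], of 1]
    unfolding * .
qed

lemma bump_mass_pos: "bump_mass TYPE('n::finite) > 0"
proof -
  have "bump_mass TYPE('n) \<noteq> 0"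
  proof
    assume "bump_mass TYPE('n) = 0"
    hence "AE z in lborel. bump (z::real^'n) = 0"
      unfolding bump_mass_def using integral_nonneg_eq_0_iff_AE[OF integrable_bump] bump_nonneg by auto
    hence "AE z in lebesgue. z \<notin> ball (0::real^'n) (1 / 2)"
    proof (intro AE_completion, eventually_elim)
      case (elim z)
      with bump_pos[of z] show ?case by auto
    qed
    hence "ball (0::real^'n) (1 / 2) \<in> null_sets lebesgue"
      by (rule iffD2[OF AE_iff_null_sets, rotated]) auto
    moreover have "\<not> negligible (ball (0::real^'n) (1 / 2))"
      by (rule open_not_negligible) auto
    ultimately show False by (simp add: negligible_iff_null_sets)
  qed
  moreover have "bump_mass TYPE('n) \<ge> 0" unfolding bump_mass_def by (simp add: bump_nonneg)
  ultimately show ?thesis by simp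
qed

lemma mollifier_nonneg: "\<epsilon> > 0 \<Longrightarrow> mollifier \<epsilon> x w \<ge> 0"
  for x :: "real^'n"
  using bump_mass_pos[where 'n = 'n] unfolding mollifier_def by (intro divide_nonneg_nonneg) (auto simp: bump_nonneg less_imp_le)

lemma has_derivative_affine:
  assumes "F differentiable (at (a *\<^sub>R x + c))"
  shows "((\<lambda>x. F (a *\<^sub>R x + c)) has_derivative
    (\<lambda>h. \<Sum>i\<in>UNIV. h $ i * (a * partial i F (a *\<^sub>R x + c)))) (at x)"
proof -
  have "((\<lambda>x. a *\<^sub>R x + c) has_derivative (\<lambda>h. a *\<^sub>R h)) (at x)"
    by (auto intro!: derivative_eq_intros)
  from has_derivative_compose[OF this derivative_eq_sum_partial[OF assms]]
  show ?thesis by (simp add: mult_ac)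
qed

lemma partial_affine:
  assumes "F differentiable (at (a *\<^sub>R x + c))"
  shows "partial i (\<lambda>x. F (a *\<^sub>R x + c)) x = a * partial i F (a *\<^sub>R x + c)"
  using partial_eq[OF has_derivative_affine[OF assms], of i]
  by (simp add: sum_axis)

lemma mollifier_continuous: "continuous_on UNIV (\<lambda>w. mollifier \<epsilon> x w)" "continuous_on UNIV (\<lambda>x. mollifier \<epsilon> x w)"
  unfolding mollifier_def divide_inverse
  by (intro continuous_on_mult continuous_on_const
      continuous_on_compose2[OF smooth_continuous[OF smooth_bump, of UNIV]]
      continuous_on_add continuous_on_scaleR continuous_on_id subset_UNIV)+

lemma integrable_mollifier:
  fixes g :: "real^'n \<Rightarrow> real"
  assumes "integrable ball_measure g"
  shows "integrable ball_measure (\<lambda>w. g w * mollifier \<epsilon> x w)"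
  by (rule integrable_bounded_mult(1)[OF mollifier_continuous(1) assms])

lemma mollifier_support:
  assumes "0 < \<epsilon>" "norm (w - (1 - \<epsilon>) *\<^sub>R x) \<ge> \<epsilon> / 2"
  shows "mollifier \<epsilon> x w = 0"
proof -
  have "(1 / \<epsilon>) *\<^sub>R w + (- ((1 - \<epsilon>) / \<epsilon>)) *\<^sub>R x = (1 / \<epsilon>) *\<^sub>R (w - (1 - \<epsilon>) *\<^sub>R x)"
    by (simp add: algebra_simps divide_inverse)
  hence "norm ((1 / \<epsilon>) *\<^sub>R w + (- ((1 - \<epsilon>) / \<epsilon>)) *\<^sub>R x) = norm (w - (1 - \<epsilon>) *\<^sub>R x) / \<epsilon>"
    using assms(1) by simp
  also have "\<dots> \<ge> 1 / 2" using assms by (simp add: le_divide_eq)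
  finally show ?thesis unfolding mollifier_def by (simp add: bump_eq_0)
qed

lemma test_function_mollifier:
  fixes x :: "real^'n"
  assumes "0 < \<epsilon>" "\<epsilon> < 1" "norm x \<le> 1"
  shows "test_function (\<lambda>w. mollifier \<epsilon> x w)"
  unfolding test_function_def
proof
  have "smooth (\<lambda>w. mollifier \<epsilon> x w)"
    unfolding mollifier_def bump_def by (intro smooth_intros)
  thus "\<forall>k. C_k k (\<lambda>w. mollifier \<epsilon> x w)" by (simp add: smooth_def)
  let ?K = "cball ((1 - \<epsilon>) *\<^sub>R x) (\<epsilon> / 2)"
  have "(1 - \<epsilon>) * norm x \<le> 1 - \<epsilon>" using assms by (intro mult_left_le) auto
  moreover have "norm ((1 - \<epsilon>) *\<^sub>R x) = (1 - \<epsilon>) * norm x" using assms by simp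
  ultimately have "norm w < 1" if "w \<in> ?K" for w
    using that norm_triangle_ineq2[of w "(1 - \<epsilon>) *\<^sub>R x"] assms
    unfolding mem_cball dist_norm norm_minus_commute[of _ w] by linarith
  moreover have "mollifier \<epsilon> x w = 0" if "w \<notin> ?K" for w
    using that by (intro mollifier_support assms) (auto simp: dist_norm norm_minus_commute)
  ultimately show "\<exists>K. compact K \<and> K \<subseteq> ball 0 1 \<and> (\<forall>w. w \<notin> K \<longrightarrow> mollifier \<epsilon> x w = 0)"
    by (intro exI[of _ ?K]) auto
qed

text \<open>
  Affine substitutions. In the second integral the contraction of \<open>x\<close> produces the factor
  \<open>(1 - \<epsilon>)\<^bsup>-d\<^esup>\<close>.
\<close>

lemma mollifier_integral:
  fixes x w :: "real^'n"
  assumes "0 < \<epsilon>" "\<epsilon> < 1"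
  shows "(LINT w|lborel. mollifier \<epsilon> x w) = 1"
    and "(LINT x|lborel. mollifier \<epsilon> x w) = (1 / (1 - \<epsilon>)) ^ CARD('n)"
proof -
  have M: "bump_mass TYPE('n) > 0" by (rule bump_mass_pos)
  have [measurable]: "(\<lambda>w. mollifier \<epsilon> x w) \<in> borel_measurable borel" "(\<lambda>x. mollifier \<epsilon> x w) \<in> borel_measurable borel"
    for x w :: "real^'n"
    by (intro borel_measurable_continuous_onI mollifier_continuous)+
  have "mollifier \<epsilon> x ((1 - \<epsilon>) *\<^sub>R x + \<epsilon> *\<^sub>R v) = bump v / (\<epsilon> ^ CARD('n) * bump_mass TYPE('n))" for v
    using assms by (simp add: mollifier_def scaleR_add_right)
  thus "(LINT w|lborel. mollifier \<epsilon> x w) = 1"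
    using assms M lborel_integral_affine[of \<epsilon> "\<lambda>w. mollifier \<epsilon> x w" "(1 - \<epsilon>) *\<^sub>R x"]
    by (simp add: bump_mass_def)
  have "- ((1 - \<epsilon>) / \<epsilon>) * (1 / (1 - \<epsilon>)) = - (1 / \<epsilon>)" "- ((1 - \<epsilon>) / \<epsilon>) * - (\<epsilon> / (1 - \<epsilon>)) = 1"
    using assms by simp_all
  hence "(1 / \<epsilon>) *\<^sub>R w + (- ((1 - \<epsilon>) / \<epsilon>)) *\<^sub>R ((1 / (1 - \<epsilon>)) *\<^sub>R w + (- (\<epsilon> / (1 - \<epsilon>))) *\<^sub>R v) = v" for v
    by (simp only: scaleR_add_right scaleR_scaleR) simp
  hence "mollifier \<epsilon> ((1 / (1 - \<epsilon>)) *\<^sub>R w + (- (\<epsilon> / (1 - \<epsilon>))) *\<^sub>R v) w = bump v / (\<epsilon> ^ CARD('n) * bump_mass TYPE('n))" for v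
    by (simp only: mollifier_def)
  thus "(LINT x|lborel. mollifier \<epsilon> x w) = (1 / (1 - \<epsilon>)) ^ CARD('n)"
    using assms M lborel_integral_affine[of "- (\<epsilon> / (1 - \<epsilon>))" "\<lambda>x. mollifier \<epsilon> x w" "(1 / (1 - \<epsilon>)) *\<^sub>R w"]
    by (simp add: bump_mass_def power_divide)
qed

lemma mollifier_integral_ball:
  fixes x w :: "real^'n"
  assumes "0 < \<epsilon>" "\<epsilon> < 1"
  shows "norm x \<le> 1 \<Longrightarrow> (LINT w|ball_measure. mollifier \<epsilon> x w) = 1"
    and "(LINT x|ball_measure. mollifier \<epsilon> x w) \<le> (1 / (1 - \<epsilon>)) ^ CARD('n)"
proof -
  have bm: "(\<lambda>w. mollifier \<epsilon> x w) \<in> borel_measurable borel" "(\<lambda>x. mollifier \<epsilon> x w) \<in> borel_measurable borel"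
    for x w :: "real^'n"
    by (intro borel_measurable_continuous_onI mollifier_continuous)+
  show "(LINT w|ball_measure. mollifier \<epsilon> x w) = 1" if x: "norm x \<le> 1"
  proof -
    have eq: "indicator (cball 0 1) w * mollifier \<epsilon> x w = mollifier \<epsilon> x w" for w
    proof (cases "norm w \<le> 1")
      case False
      have "test_function (\<lambda>w. mollifier \<epsilon> x w)" by (rule test_function_mollifier[OF assms x])
      then obtain K where "K \<subseteq> ball 0 1" "\<And>w. w \<notin> K \<Longrightarrow> mollifier \<epsilon> x w = 0"
        unfolding test_function_def by blast
      with False have "mollifier \<epsilon> x w = 0" by force
      thus ?thesis by simp
    qed simp
    show ?thesis unfolding integral_ball_measure[OF bm(1)] eq by (rule mollifier_integral(1)[OF assms])
  qed
  show "(LINT x|ball_measure. mollifier \<epsilon> x w) \<le> (1 / (1 - \<epsilon>)) ^ CARD('n)"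
  proof -
    have i: "integrable lborel (\<lambda>x. mollifier \<epsilon> x w)"
    proof (rule ccontr)
      assume "\<not> ?thesis"
      hence "(LINT x|lborel. mollifier \<epsilon> x w) = 0" by (rule not_integrable_integral_eq)
      thus False using mollifier_integral(2)[OF assms, of w] assms by simp
    qed
    have "(LINT x|lborel. indicator (cball 0 1) x * mollifier \<epsilon> x w) \<le> (LINT x|lborel. mollifier \<epsilon> x w)"
      using mollifier_nonneg[OF assms(1)] integrable_indicator_continuous[OF mollifier_continuous(2)[of \<epsilon> w], of 1]
      by (intro integral_mono i) (auto simp: indicator_def)
    thus ?thesis using bm mollifier_integral(2)[OF assms, of w] by (simp add: integral_ball_measure)
  qed
qed

lemma continuous_on_integral_kernel:
  fixes k :: "'b \<Rightarrow> real^'n \<Rightarrow> real"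
  assumes g: "integrable M g" and k: "\<And>w. w \<in> space M \<Longrightarrow> continuous_on UNIV (k w)"
    and C: "\<And>w x. w \<in> space M \<Longrightarrow> \<bar>k w x\<bar> \<le> C"
    and m: "\<And>x. (\<lambda>w. k w x) \<in> borel_measurable M"
  shows "continuous_on UNIV (\<lambda>x. LINT w|M. g w * k w x)"
proof (rule continuous_on_sequentiallyI)
  fix X and a :: "real^'n" assume X: "X \<longlonglongrightarrow> a"
  show "(\<lambda>n. LINT w|M. g w * k w (X n)) \<longlonglongrightarrow> (LINT w|M. g w * k w a)"
  proof (rule integral_dominated_convergence[where w = "\<lambda>w. C * \<bar>g w\<bar>"])
    show "integrable M (\<lambda>w. C * \<bar>g w\<bar>)" using g by simp
    show "AE w in M. (\<lambda>n. g w * k w (X n)) \<longlonglongrightarrow> g w * k w a"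
    proof (rule AE_I2)
      fix w assume "w \<in> space M"
      from k[OF this] X have "(\<lambda>n. k w (X n)) \<longlonglongrightarrow> k w a"
        by (auto simp: continuous_on_eq_continuous_at continuous_at_sequentially o_def)
      thus "(\<lambda>n. g w * k w (X n)) \<longlonglongrightarrow> g w * k w a" by (intro tendsto_mult tendsto_const)
    qed
    show "AE w in M. norm (g w * k w (X n)) \<le> C * \<bar>g w\<bar>" for n
    proof (rule AE_I2)
      fix w assume "w \<in> space M"
      from mult_left_mono[OF C[OF this], of "\<bar>g w\<bar>" "X n"]
      show "norm (g w * k w (X n)) \<le> C * \<bar>g w\<bar>" by (simp add: abs_mult mult.commute)
    qed
  qed (use g m in \<open>auto intro: borel_measurable_times\<close>)
qed

text \<open>
  A derivative in \<open>x\<close> of the kernel is \<open>-(1 - \<epsilon>)\<close> times its derivative in \<open>w\<close>; the latter is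
  the form in which a weak derivative of \<open>g\<close> can be used.
\<close>

lemma mollify_C1:
  fixes g :: "real^'n \<Rightarrow> real"
  assumes g: "integrable ball_measure g" and \<epsilon>: "0 < \<epsilon>" "\<epsilon> < 1"
  shows "C_k 1 (mollify \<epsilon> g)"
    and "partial i (mollify \<epsilon> g) x = - (1 - \<epsilon>) * (LINT w|ball_measure. g w * partial i (mollifier \<epsilon> x) w)"
proof -
  define c where "c = \<epsilon> ^ CARD('n) * bump_mass TYPE('n)"
  let ?z = "\<lambda>x w::real^'n. (1 / \<epsilon>) *\<^sub>R w + (- ((1 - \<epsilon>) / \<epsilon>)) *\<^sub>R x"
  define P where "P i x w = inverse c * (- ((1 - \<epsilon>) / \<epsilon>) * partial i bump (?z x w))" for i x w
  have mol: "mollifier \<epsilon> x w = inverse c * bump (?z x w)" for x w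
    by (simp add: mollifier_def c_def divide_inverse)
  have bd: "bump differentiable (at z)" for z :: "real^'n"
    by (rule smooth_differentiable[OF smooth_bump])
  have Pw: "partial i (mollifier \<epsilon> x) w = inverse c * ((1 / \<epsilon>) * partial i bump (?z x w))" for i x w
  proof -
    have "(\<lambda>w. bump (?z x w)) differentiable (at w)"
      using has_derivative_affine[OF bd, where a = "1 / \<epsilon>" and x = w and c = "- ((1 - \<epsilon>) / \<epsilon>) *\<^sub>R x"] by (auto simp: differentiable_def)
    hence "partial i (\<lambda>w. inverse c * bump (?z x w)) w = inverse c * partial i (\<lambda>w. bump (?z x w)) w"
      by (subst partial_mult) auto
    thus ?thesis
      unfolding mol[abs_def] using partial_affine[OF bd, where a = "1 / \<epsilon>" and x = w and c = "- ((1 - \<epsilon>) / \<epsilon>) *\<^sub>R x" and i = i] by simp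
  qed
  have D: "((\<lambda>x. mollifier \<epsilon> x w) has_derivative (\<lambda>h. \<Sum>i\<in>UNIV. h $ i * P i x w)) (at x)" for x w
  proof -
    have "((\<lambda>x. bump (- ((1 - \<epsilon>) / \<epsilon>) *\<^sub>R x + (1 / \<epsilon>) *\<^sub>R w)) has_derivative
      (\<lambda>h. \<Sum>i\<in>UNIV. h $ i * (- ((1 - \<epsilon>) / \<epsilon>) * partial i bump (- ((1 - \<epsilon>) / \<epsilon>) *\<^sub>R x + (1 / \<epsilon>) *\<^sub>R w)))) (at x)"
      by (rule has_derivative_affine[OF bd])
    hence "((\<lambda>x. bump (?z x w)) has_derivative
      (\<lambda>h. \<Sum>i\<in>UNIV. h $ i * (- ((1 - \<epsilon>) / \<epsilon>) * partial i bump (?z x w)))) (at x)"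
      by (simp only: add.commute)
    from has_derivative_mult_right[OF this, of "inverse c"]
    show ?thesis unfolding mol P_def by (simp only: sum_distrib_left mult.left_commute)
  qed
  have Pc: "continuous_on UNIV (\<lambda>w. P i x w)" "continuous_on UNIV (\<lambda>x. P i x w)" for i x w
    unfolding P_def
    by (intro continuous_on_mult continuous_on_const
        continuous_on_compose2[OF smooth_continuous[OF smooth_partial[OF smooth_bump], of UNIV]]
        continuous_on_add continuous_on_scaleR continuous_on_id subset_UNIV)+
  have "\<exists>C. \<forall>x w. \<bar>P i x w\<bar> \<le> C" for i
  proof -
    obtain C where C: "\<And>z. \<bar>partial i bump (z::real^'n)\<bar> \<le> C"
      using test_function_bounded[OF test_function_partial[OF test_function_bump]] by blast
    have "\<bar>P i x w\<bar> \<le> \<bar>inverse c\<bar> * (\<bar>(1 - \<epsilon>) / \<epsilon>\<bar> * C)" for x w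
      unfolding P_def abs_mult abs_minus_cancel by (intro mult_left_mono C) auto
    thus ?thesis by blast
  qed
  then obtain C where C: "\<And>i x w. \<bar>P i x w\<bar> \<le> C i" by metis
  have DT: "(mollify \<epsilon> g has_derivative (\<lambda>h. LINT w|ball_measure. g w * (\<Sum>i\<in>UNIV. h $ i * P i x w))) (at x)" for x
    unfolding mollify_def[abs_def]
  proof (rule has_derivative_lebesgue_integral[OF g, where U = UNIV and C = "\<Sum>i\<in>UNIV. C i"])
    show "\<bar>\<Sum>i\<in>UNIV. h $ i * P i y w\<bar> \<le> (\<Sum>i\<in>UNIV. C i) * norm h" for w y h
    proof -
      have "\<bar>\<Sum>i\<in>UNIV. h $ i * P i y w\<bar> \<le> (\<Sum>i\<in>UNIV. \<bar>h $ i\<bar> * \<bar>P i y w\<bar>)"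
        using sum_abs[of "\<lambda>j. h $ j * P j y w" UNIV] by (simp add: abs_mult)
      also have "\<dots> \<le> (\<Sum>i\<in>UNIV. norm h * C i)"
        by (intro sum_mono mult_mono component_le_norm_cart C) auto
      finally show ?thesis by (simp add: sum_distrib_left mult.commute)
    qed
    show "(\<lambda>w. \<Sum>i\<in>UNIV. h $ i * P i x w) \<in> borel_measurable ball_measure" for h
      by (intro continuous_ball_measurable continuous_on_sum continuous_on_mult continuous_on_const Pc)
    show "integrable ball_measure (\<lambda>w. g w * mollifier \<epsilon> y w)" for y
      by (rule integrable_mollifier[OF g])
  qed (use D in auto)
  have PT: "partial i (mollify \<epsilon> g) x = (LINT w|ball_measure. g w * P i x w)" for i x
    using partial_eq[OF DT, of i x]
    by (simp add: sum_axis)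
  have "continuous_on UNIV (partial i (mollify \<epsilon> g))" for i
    unfolding PT[abs_def]
    by (rule continuous_on_integral_kernel[OF g, where C = "C i"]) (auto intro: C Pc continuous_ball_measurable)
  moreover have "mollify \<epsilon> g differentiable (at x)" for x using DT by (auto simp: differentiable_def)
  ultimately show "C_k 1 (mollify \<epsilon> g)" by simp
  have "g w * P i x w = - (1 - \<epsilon>) * (g w * partial i (mollifier \<epsilon> x) w)" for w
    unfolding P_def Pw divide_inverse
    by (simp only: mult_ac mult_minus_left mult_minus_right mult_1_left mult_1_right)
  thus "partial i (mollify \<epsilon> g) x = - (1 - \<epsilon>) * (LINT w|ball_measure. g w * partial i (mollifier \<epsilon> x) w)"
    unfolding PT by (simp only: integral_mult_right_zero)
qed

lemma mollify_weak_partial: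
  fixes f g :: "real^'n \<Rightarrow> real"
  assumes "integrable ball_measure f" "has_weak_partial i f g" "0 < \<epsilon>" "\<epsilon> < 1" "norm x \<le> 1"
  shows "partial i (mollify \<epsilon> f) x = (1 - \<epsilon>) * mollify \<epsilon> g x"
proof -
  have "(LINT w|ball_measure. f w * partial i (mollifier \<epsilon> x) w) = - mollify \<epsilon> g x"
    using assms(2) test_function_mollifier[OF assms(3-5)] unfolding has_weak_partial_def mollify_def by blast
  thus ?thesis using mollify_C1(2)[OF assms(1,3,4), of i x] by (simp add: algebra_simps)
qed

lemma mollify_diff:
  fixes f g :: "real^'n \<Rightarrow> real"
  assumes "integrable ball_measure f" "integrable ball_measure g"
  shows "mollify \<epsilon> (\<lambda>x. f x - g x) x = mollify \<epsilon> f x - mollify \<epsilon> g x"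
  unfolding mollify_def left_diff_distrib
  by (intro Bochner_Integration.integral_diff integrable_mollifier assms)

lemma mollify_continuous:
  "integrable ball_measure g \<Longrightarrow> 0 < \<epsilon> \<Longrightarrow> \<epsilon> < 1 \<Longrightarrow> continuous_on UNIV (mollify \<epsilon> g)"
  for g :: "real^'n \<Rightarrow> real"
  by (rule C1_continuous(1)[OF mollify_C1(1)])

text \<open>
  Jensen's inequality for the probability density \<open>mollifier \<epsilon> x\<close>, obtained from the nonnegativity
  of the variance.
\<close>

lemma mollify_power2_le:
  fixes g :: "real^'n \<Rightarrow> real"
  assumes g: "square_integrable ball_measure g" and \<epsilon>: "0 < \<epsilon>" "\<epsilon> < 1" and x: "norm x \<le> 1"
  shows "(mollify \<epsilon> g x)\<^sup>2 \<le> mollify \<epsilon> (\<lambda>w. (g w)\<^sup>2) x"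
proof -
  define m where "m = mollify \<epsilon> g x"
  let ?K = "mollifier \<epsilon> x"
  have i: "integrable ball_measure (\<lambda>w. (g w)\<^sup>2 * ?K w)" "integrable ball_measure (\<lambda>w. g w * ?K w)"
      "integrable ball_measure ?K"
    using g integrable_mollifier[of "\<lambda>_. 1" \<epsilon> x] ball_measure.square_integrable_integrable[OF g]
    by (auto simp: square_integrable_def intro!: integrable_mollifier)
  have "0 \<le> (LINT w|ball_measure. (g w - m)\<^sup>2 * ?K w)"
    by (intro integral_nonneg_AE AE_I2) (simp add: mollifier_nonneg \<epsilon>)
  also have "\<dots> = (LINT w|ball_measure. (g w)\<^sup>2 * ?K w - 2 * m * (g w * ?K w) + m\<^sup>2 * ?K w)"
    by (intro Bochner_Integration.integral_cong) (auto simp: power2_diff algebra_simps)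
  also have "\<dots> = mollify \<epsilon> (\<lambda>w. (g w)\<^sup>2) x - 2 * m * mollify \<epsilon> g x + m\<^sup>2 * (LINT w|ball_measure. ?K w)"
    using i by (simp add: mollify_def)
  also have "\<dots> = mollify \<epsilon> (\<lambda>w. (g w)\<^sup>2) x - m\<^sup>2"
    using mollifier_integral_ball(1)[OF \<epsilon> x] by (simp add: m_def power2_eq_square)
  finally show ?thesis by (simp add: m_def)
qed

lemma mollify_L1_bound:
  fixes g :: "real^'n \<Rightarrow> real"
  assumes g: "integrable ball_measure g" and nn: "\<And>w. g w \<ge> 0" and \<epsilon>: "0 < \<epsilon>" "\<epsilon> < 1"
  shows "(LINT x|ball_measure. mollify \<epsilon> g x) \<le> (1 / (1 - \<epsilon>)) ^ CARD('n) * (LINT w|ball_measure. g w)"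
proof -
  let ?B = "ball_measure :: (real^'n) measure"
  interpret P: pair_sigma_finite ?B ?B ..
  have "(\<lambda>p. mollifier \<epsilon> (fst p) (snd p)) \<in> borel_measurable (borel :: ((real^'n) \<times> (real^'n)) measure)"
    unfolding mollifier_def divide_inverse
    by (intro borel_measurable_continuous_onI continuous_on_mult continuous_on_const
        continuous_on_compose2[OF smooth_continuous[OF smooth_bump, of UNIV]]
        continuous_on_add continuous_on_scaleR continuous_on_fst continuous_on_snd continuous_on_id subset_UNIV)+
  hence 1: "(\<lambda>p. mollifier \<epsilon> (fst p) (snd p)) \<in> borel_measurable (borel \<Otimes>\<^sub>M borel :: ((real^'n) \<times> (real^'n)) measure)"
    by (simp add: borel_prod)
  have id: "(\<lambda>x. x) \<in> ?B \<rightarrow>\<^sub>M borel"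
    by (simp add: measurable_completion measurable_restrict_space1)
  have "(\<lambda>p. (fst p, snd p)) \<in> ?B \<Otimes>\<^sub>M ?B \<rightarrow>\<^sub>M borel \<Otimes>\<^sub>M borel"
    by (intro measurable_Pair measurable_compose[OF measurable_fst id] measurable_compose[OF measurable_snd id])
  from measurable_compose[OF this 1]
  have "(\<lambda>p. mollifier \<epsilon> (fst p) (snd p)) \<in> borel_measurable (?B \<Otimes>\<^sub>M ?B)" by simp
  hence meas: "(\<lambda>p. g (snd p) * mollifier \<epsilon> (fst p) (snd p)) \<in> borel_measurable (?B \<Otimes>\<^sub>M ?B)"
    using g by (intro borel_measurable_times measurable_compose[OF measurable_snd]) auto
  have "integrable (?B \<Otimes>\<^sub>M ?B) (\<lambda>p. g (snd p) * mollifier \<epsilon> (fst p) (snd p))"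
  proof (rule P.Fubini_integrable[OF meas])
    have "norm (g w * mollifier \<epsilon> x w) = g w * mollifier \<epsilon> x w" for w x
      using mult_nonneg_nonneg[OF nn[of w] mollifier_nonneg[OF \<epsilon>(1), of x w]] by simp
    thus "integrable ?B (\<lambda>x. LINT y|?B. norm (g (snd (x, y)) * mollifier \<epsilon> (fst (x, y)) (snd (x, y))))"
      using integrable_continuous_ball[OF mollify_continuous[OF g \<epsilon>]]
      unfolding mollify_def[abs_def] by simp
    show "AE x in ?B. integrable ?B (\<lambda>y. g (snd (x, y)) * mollifier \<epsilon> (fst (x, y)) (snd (x, y)))"
      using integrable_mollifier[OF g] by (intro AE_I2) simp
  qed
  hence int: "integrable (?B \<Otimes>\<^sub>M ?B) (case_prod (\<lambda>x w. g w * mollifier \<epsilon> x w))"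
    by (simp only: case_prod_unfold)
  have "(LINT x|?B. mollify \<epsilon> g x) = (LINT w|?B. LINT x|?B. g w * mollifier \<epsilon> x w)"
    unfolding mollify_def by (rule P.Fubini_integral[OF int, symmetric])
  also have "\<dots> \<le> (LINT w|?B. (1 / (1 - \<epsilon>)) ^ CARD('n) * g w)"
  proof (rule integral_mono)
    show "integrable ?B (\<lambda>w. LINT x|?B. g w * mollifier \<epsilon> x w)"
      using P.integrable_snd[OF int] by simp
    show "(LINT x|?B. g w * mollifier \<epsilon> x w) \<le> (1 / (1 - \<epsilon>)) ^ CARD('n) * g w" for w
      using mult_left_mono[OF mollifier_integral_ball(2)[OF \<epsilon>, of w] nn, of w] by (simp add: mult.commute)
  qed (use g in simp)
  finally show ?thesis by simp
qed

text \<open>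
  Jensen's inequality reduces this to the \<open>L\<^sup>1\<close> bound for \<open>g\<^sup>2\<close>. The factor stays bounded as \<open>\<epsilon>\<close> tends to \<open>0\<close>, which is
  what allows the passage from continuous functions to all square-integrable ones.
\<close>

lemma mollify_L2_bound:
  fixes g :: "real^'n \<Rightarrow> real"
  assumes g: "square_integrable ball_measure g" and \<epsilon>: "0 < \<epsilon>" "\<epsilon> < 1"
  shows "(LINT x|ball_measure. (mollify \<epsilon> g x)\<^sup>2) \<le> (1 / (1 - \<epsilon>)) ^ CARD('n) * (LINT w|ball_measure. (g w)\<^sup>2)"
proof -
  have g2: "integrable ball_measure (\<lambda>w. (g w)\<^sup>2)" using g by (simp add: square_integrable_def)
  note gi = ball_measure.square_integrable_integrable[OF g]
  have "(LINT x|ball_measure. (mollify \<epsilon> g x)\<^sup>2) \<le> (LINT x|ball_measure. mollify \<epsilon> (\<lambda>w. (g w)\<^sup>2) x)"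
    using mollify_power2_le[OF g \<epsilon>]
    by (intro integral_mono integrable_continuous_ball continuous_on_power mollify_continuous gi g2 \<epsilon>) auto
  also have "\<dots> \<le> (1 / (1 - \<epsilon>)) ^ CARD('n) * (LINT w|ball_measure. (g w)\<^sup>2)"
    by (rule mollify_L1_bound[OF g2 _ \<epsilon>]) simp
  finally show ?thesis .
qed

text \<open>
  The values do not exceed \<open>1 / 2\<close>, which keeps \<open>1 / (1 - \<epsilon>)\<close> below \<open>2\<close> in the bounds for mollifications.
\<close>

definition scale_seq :: "nat \<Rightarrow> real"
  where "scale_seq k = 1 / (real k + 2)"

lemma scale_seq: "0 < scale_seq k" "scale_seq k < 1" "scale_seq k \<le> 1 / 2" "scale_seq \<longlonglongrightarrow> 0"
proof -
  show "0 < scale_seq k" "scale_seq k < 1" "scale_seq k \<le> 1 / 2" by (auto simp: scale_seq_def field_simps)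
  have "(\<lambda>k. inverse (real (k + 2))) \<longlonglongrightarrow> 0"
    by (rule LIMSEQ_ignore_initial_segment[OF lim_inverse_n])
  thus "scale_seq \<longlonglongrightarrow> 0" by (simp add: scale_seq_def[abs_def] divide_inverse add.commute)
qed

lemma mollify_continuous_limit:
  fixes h :: "real^'n \<Rightarrow> real"
  assumes h: "continuous_on UNIV h" and \<delta>: "\<delta> > 0"
  shows "\<forall>\<^sub>F k in sequentially. \<forall>x\<in>cball 0 1. \<bar>mollify (scale_seq k) h x - h x\<bar> \<le> \<delta>"
proof -
  have "uniformly_continuous_on (cball 0 1) h"
    by (rule compact_uniformly_continuous[OF continuous_on_subset[OF h]]) auto
  then obtain \<eta> where \<eta>: "\<eta> > 0"
    "\<And>x y. x \<in> cball 0 1 \<Longrightarrow> y \<in> cball 0 1 \<Longrightarrow> dist y x < \<eta> \<Longrightarrow> dist (h y) (h x) < \<delta>"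
    using \<delta> unfolding uniformly_continuous_on_def by metis
  have "\<forall>\<^sub>F k in sequentially. scale_seq k < \<eta> / 2"
    using scale_seq(4) \<eta>(1) by (intro order_tendstoD(2)[where y = 0]) auto
  thus ?thesis
  proof eventually_elim
    case (elim k)
    let ?e = "scale_seq k"
    note e = scale_seq(1,2)[of k]
    show ?case
    proof
      fix x :: "real^'n" assume "x \<in> cball 0 1"
      hence x: "norm x \<le> 1" by simp
      note hi = integrable_continuous_ball[OF h]
      have Ki: "integrable ball_measure (mollifier ?e x)" using integrable_mollifier[of "\<lambda>_. 1" ?e x] by simp
      have "mollify ?e h x - h x = (LINT w|ball_measure. h w * mollifier ?e x w) - (LINT w|ball_measure. h x * mollifier ?e x w)"
        using mollifier_integral_ball(1)[OF e x] by (simp add: mollify_def)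
      also have "\<dots> = (LINT w|ball_measure. (h w - h x) * mollifier ?e x w)"
        unfolding left_diff_distrib
        by (intro Bochner_Integration.integral_diff[symmetric] integrable_mollifier hi integrable_mult_right Ki)
      finally have "\<bar>mollify ?e h x - h x\<bar> \<le> (LINT w|ball_measure. \<bar>(h w - h x) * mollifier ?e x w\<bar>)"
        by (simp only: integral_abs_bound)
      also have "\<dots> \<le> (LINT w|ball_measure. \<delta> * mollifier ?e x w)"
      proof (rule integral_mono)
        show "integrable ball_measure (\<lambda>w. \<bar>(h w - h x) * mollifier ?e x w\<bar>)"
          by (intro integrable_abs integrable_mollifier Bochner_Integration.integrable_diff hi) simp
        show "\<bar>(h w - h x) * mollifier ?e x w\<bar> \<le> \<delta> * mollifier ?e x w" if "w \<in> space ball_measure" for w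
        proof (cases "norm (w - (1 - ?e) *\<^sub>R x) < ?e / 2")
          case True
          have "w - x = (w - (1 - ?e) *\<^sub>R x) - ?e *\<^sub>R x" by (simp add: algebra_simps)
          hence "norm (w - x) \<le> norm (w - (1 - ?e) *\<^sub>R x) + norm (?e *\<^sub>R x)" by (metis norm_triangle_ineq4)
          moreover have "norm (?e *\<^sub>R x) \<le> ?e" using x e by (simp add: mult_left_le)
          ultimately have "dist w x < \<eta>" using True elim e unfolding dist_norm by linarith
          hence "dist (h w) (h x) < \<delta>" using x that by (intro \<eta>(2)) auto
          hence "\<bar>h w - h x\<bar> \<le> \<delta>" by (simp add: dist_real_def)
          from mult_right_mono[OF this mollifier_nonneg[OF e(1)], of x w]
          show ?thesis using mollifier_nonneg[OF e(1), of x w] by (simp add: abs_mult)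
        next
          case False
          hence "mollifier ?e x w = 0" by (intro mollifier_support e) simp
          thus ?thesis by simp
        qed
      qed (use Ki in simp)
      also have "\<dots> = \<delta>" using mollifier_integral_ball(1)[OF e x] by simp
      finally show "\<bar>mollify ?e h x - h x\<bar> \<le> \<delta>" .
    qed
  qed
qed

text \<open>
  For continuous functions the convergence is uniform; a general \<open>g\<close> is approximated by a continuous \<open>h\<close>,
  and the error \<open>g - h\<close> is controlled by the uniform \<open>L\<^sup>2\<close> bound.
\<close>

lemma mollify_L2_limit:
  fixes g :: "real^'n \<Rightarrow> real"
  assumes g: "square_integrable ball_measure g"
  shows "(\<lambda>k. LINT x|ball_measure. (mollify (scale_seq k) g x - g x)\<^sup>2) \<longlonglongrightarrow> 0"
proof (rule LIMSEQ_I)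
  fix r :: real assume r: "r > 0"
  define V where "V = measure ball_measure (space (ball_measure :: (real^'n) measure))"
  \<comment> \<open>The factor 3 comes from splitting a square of three terms, the power of 2 from the bound for mollifications.\<close>
  define C where "C = 3 * ((2::real) ^ CARD('n) + 1)"
  have C: "C > 0" by (simp add: C_def add_pos_pos)
  have V: "V \<ge> 0" by (simp add: V_def)
  obtain h where h: "continuous_on UNIV h" "(LINT x|ball_measure. (g x - h x)\<^sup>2) < r / (2 * C)"
    using continuous_dense_L2[OF g, of "r / (2 * C)"] r C by auto
  \<comment> \<open>Small enough that a uniform error below this bound contributes less than half of the target accuracy.\<close>
  define \<delta> where "\<delta> = sqrt (r / (12 * (V + 1)))"
  have \<delta>: "\<delta> > 0" "3 * (\<delta>\<^sup>2 * V) < r / 2"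
  proof -
    show "\<delta> > 0" using r V by (simp add: \<delta>_def)
    have "\<delta>\<^sup>2 = r / (12 * (V + 1))" using r V by (simp add: \<delta>_def)
    moreover have "V / (V + 1) < 1" using V by simp
    ultimately have "3 * (\<delta>\<^sup>2 * V) = r / 4 * (V / (V + 1))" "r / 4 * (V / (V + 1)) \<le> r / 4 * 1"
      using V r by (auto intro!: mult_left_mono simp: divide_simps)
    thus "3 * (\<delta>\<^sup>2 * V) < r / 2" using r by simp
  qed
  have "\<forall>\<^sub>F k in sequentially. (LINT x|ball_measure. (mollify (scale_seq k) g x - g x)\<^sup>2) < r"
    using mollify_continuous_limit[OF h(1) \<delta>(1)]
  proof eventually_elim
    case (elim k)
    let ?e = "scale_seq k"
    note e = scale_seq(1,2)[of k]
    note sh = square_integrable_continuous_ball[OF h(1)]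
    note gi = ball_measure.square_integrable_integrable[OF g] and hi = integrable_continuous_ball[OF h(1)]
    have gh: "square_integrable ball_measure (\<lambda>x. g x - h x)" by (rule square_integrable_diff[OF g sh])
    note ghi = ball_measure.square_integrable_integrable[OF gh]
    let ?A = "\<lambda>x. (mollify ?e (\<lambda>x. g x - h x) x)\<^sup>2" and ?Bh = "\<lambda>x. (mollify ?e h x - h x)\<^sup>2" and ?D = "\<lambda>x. (g x - h x)\<^sup>2"
    have Ai: "integrable ball_measure ?A"
      by (intro integrable_continuous_ball continuous_on_power mollify_continuous ghi e)
    have Bi: "integrable ball_measure ?Bh"
      by (intro integrable_continuous_ball continuous_on_power continuous_on_diff mollify_continuous hi h(1) e)
    have Di: "integrable ball_measure ?D" using gh by (simp add: square_integrable_def)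
    have "square_integrable ball_measure (\<lambda>x. mollify ?e g x - g x)"
      by (intro square_integrable_diff square_integrable_continuous_ball mollify_continuous gi e g)
    hence "integrable ball_measure (\<lambda>x. (mollify ?e g x - g x)\<^sup>2)" by (simp add: square_integrable_def)
    hence "(LINT x|ball_measure. (mollify ?e g x - g x)\<^sup>2) \<le> (LINT x|ball_measure. 3 * ?A x + 3 * ?Bh x + 3 * ?D x)"
    proof (rule integral_mono)
      fix x
      have "mollify ?e g x - g x = mollify ?e (\<lambda>x. g x - h x) x + (mollify ?e h x - h x) - (g x - h x)"
        using mollify_diff[OF gi hi] by simp
      moreover have "(a + b - c)\<^sup>2 \<le> 3 * a\<^sup>2 + 3 * b\<^sup>2 + 3 * c\<^sup>2" for a b c :: real
      proof -
        have "0 \<le> (a - b)\<^sup>2 + (a + c)\<^sup>2 + (b + c)\<^sup>2" by simp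
        thus ?thesis by (simp add: power2_eq_square algebra_simps)
      qed
      ultimately show "(mollify ?e g x - g x)\<^sup>2 \<le> 3 * ?A x + 3 * ?Bh x + 3 * ?D x" by (simp only:)
    qed (use Ai Bi Di in simp)
    also have "\<dots> = 3 * (LINT x|ball_measure. ?A x) + 3 * (LINT x|ball_measure. ?Bh x) + 3 * (LINT x|ball_measure. ?D x)"
      using Ai Bi Di by simp
    also have "(LINT x|ball_measure. ?A x) \<le> 2 ^ CARD('n) * (LINT x|ball_measure. ?D x)"
    proof -
      have "1 / (1 - ?e) \<le> 2" using scale_seq(3)[of k] by (simp add: divide_le_eq)
      hence "(1 / (1 - ?e)) ^ CARD('n) \<le> 2 ^ CARD('n)" using e by (intro power_mono) auto
      from order.trans[OF mollify_L2_bound[OF gh e] mult_right_mono[OF this]]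
      show ?thesis by simp
    qed
    also have "(LINT x|ball_measure. ?Bh x) \<le> (LINT x|(ball_measure::(real^'n) measure). \<delta>\<^sup>2)"
    proof (rule integral_mono[OF Bi])
      fix x :: "real^'n" assume "x \<in> space ball_measure"
      hence "\<bar>mollify ?e h x - h x\<bar> \<le> \<delta>" using elim by simp
      from power_mono[OF this, of 2] show "(mollify ?e h x - h x)\<^sup>2 \<le> \<delta>\<^sup>2" by simp
    qed simp
    also have "(LINT x|(ball_measure::(real^'n) measure). \<delta>\<^sup>2) = \<delta>\<^sup>2 * V" by (simp add: V_def)
    finally have "(LINT x|ball_measure. (mollify ?e g x - g x)\<^sup>2) \<le> C * (LINT x|ball_measure. ?D x) + 3 * (\<delta>\<^sup>2 * V)"
      by (simp add: C_def algebra_simps)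
    also have "C * (LINT x|ball_measure. ?D x) < r / 2"
      using h(2) C by (simp add: pos_less_divide_eq mult.commute)
    finally show ?case using \<delta>(2) by simp
  qed
  then obtain K where "\<And>k. k \<ge> K \<Longrightarrow> (LINT x|ball_measure. (mollify (scale_seq k) g x - g x)\<^sup>2) < r"
    by (auto simp: eventually_sequentially)
  thus "\<exists>K. \<forall>k\<ge>K. norm ((LINT x|ball_measure. (mollify (scale_seq k) g x - g x)\<^sup>2) - 0) < r"
    by (intro exI[of _ K]) simp
qed

text \<open>
  The mollifiers are test functions, so all mollifications of \<open>g\<close> vanish on the ball, and
  they converge to \<open>g\<close> in mean square.
\<close>

lemma AE_zero_if_orthogonal_to_test_functions:
  fixes g :: "real^'n \<Rightarrow> real"
  assumes g: "square_integrable ball_measure g"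
    and 0: "\<And>\<phi>. test_function \<phi> \<Longrightarrow> (LINT x|ball_measure. g x * \<phi> x) = 0"
  shows "AE x in ball_measure. g x = 0"
proof -
  have "(mollify (scale_seq k) g x - g x)\<^sup>2 = (g x)\<^sup>2" if "x \<in> space ball_measure" for k x
    using 0[OF test_function_mollifier[OF scale_seq(1,2)[of k]], of x] that by (simp add: mollify_def)
  hence "(LINT x|ball_measure. (mollify (scale_seq k) g x - g x)\<^sup>2) = (LINT x|ball_measure. (g x)\<^sup>2)" for k
    by (intro Bochner_Integration.integral_cong) auto
  with mollify_L2_limit[OF g] have "(LINT x|ball_measure. (g x)\<^sup>2) = 0"
    by (simp add: LIMSEQ_const_iff)
  moreover have "integrable ball_measure (\<lambda>x. (g x)\<^sup>2)" using g by (simp add: square_integrable_def)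
  ultimately show ?thesis by (subst (asm) integral_nonneg_eq_0_iff_AE) auto
qed

lemma mollify_W12_limit:
  fixes f g :: "real^'n \<Rightarrow> real"
  assumes f: "square_integrable ball_measure f" and g: "has_weak_partial i f g"
  shows "(\<lambda>k. LINT x|ball_measure. (partial i (mollify (scale_seq k) f) x - g x)\<^sup>2) \<longlonglongrightarrow> 0"
proof -
  have sg: "square_integrable ball_measure g" using g by (simp add: has_weak_partial_def)
  note fi = ball_measure.square_integrable_integrable[OF f] and gi = ball_measure.square_integrable_integrable[OF sg]
  define D where "D k = (LINT x|ball_measure. (mollify (scale_seq k) g x - g x)\<^sup>2)" for k
  define N where "N = (LINT x|ball_measure. (g x)\<^sup>2)"
  define E where "E k = (LINT x|ball_measure. (partial i (mollify (scale_seq k) f) x - g x)\<^sup>2)" for k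
  have "E k \<le> 2 * D k + 2 * (scale_seq k)\<^sup>2 * N" for k
  proof -
    let ?e = "scale_seq k"
    note e = scale_seq(1,2)[of k]
    have i1: "integrable ball_measure (\<lambda>x. (mollify ?e g x - g x)\<^sup>2)" "integrable ball_measure (\<lambda>x. (g x)\<^sup>2)"
      using square_integrable_diff[OF square_integrable_continuous_ball[OF mollify_continuous[OF gi e]] sg] sg
      by (simp_all add: square_integrable_def)
    have "(LINT x|ball_measure. (partial i (mollify ?e f) x - g x)\<^sup>2) \<le>
        (LINT x|ball_measure. 2 * (mollify ?e g x - g x)\<^sup>2 + 2 * ?e\<^sup>2 * (g x)\<^sup>2)"
    proof (rule integral_mono)
      show "integrable ball_measure (\<lambda>x. (partial i (mollify ?e f) x - g x)\<^sup>2)"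
        using square_integrable_diff[OF square_integrable_continuous_ball[OF C1_continuous(2)[OF mollify_C1(1)[OF fi e]]] sg]
        by (simp add: square_integrable_def)
      fix x :: "real^'n" assume "x \<in> space ball_measure"
      hence eq: "partial i (mollify ?e f) x - g x = (1 - ?e) * (mollify ?e g x - g x) - ?e * g x"
        using mollify_weak_partial[OF fi g e, of x] by (simp add: algebra_simps)
      have "(a - b)\<^sup>2 \<le> 2 * a\<^sup>2 + 2 * b\<^sup>2" for a b :: real
        using zero_le_power2[of "a + b"] by (simp add: power2_eq_square algebra_simps)
      hence "(partial i (mollify ?e f) x - g x)\<^sup>2 \<le> 2 * ((1 - ?e) * (mollify ?e g x - g x))\<^sup>2 + 2 * (?e * g x)\<^sup>2"
        unfolding eq by blast
      also have "\<dots> = 2 * ((1 - ?e)\<^sup>2 * (mollify ?e g x - g x)\<^sup>2) + 2 * ?e\<^sup>2 * (g x)\<^sup>2"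
        by (simp add: power_mult_distrib)
      also have "(1 - ?e)\<^sup>2 * (mollify ?e g x - g x)\<^sup>2 \<le> 1 * (mollify ?e g x - g x)\<^sup>2"
        using e by (intro mult_right_mono power_le_one) auto
      finally show "(partial i (mollify ?e f) x - g x)\<^sup>2 \<le> 2 * (mollify ?e g x - g x)\<^sup>2 + 2 * ?e\<^sup>2 * (g x)\<^sup>2"
        by simp
    qed (use i1 in simp)
    also have "\<dots> = 2 * D k + 2 * ?e\<^sup>2 * N" using i1 by (simp add: D_def N_def)
    finally show ?thesis by (simp only: E_def)
  qed
  moreover have "D \<longlonglongrightarrow> 0" using mollify_L2_limit[OF sg] by (simp only: D_def[abs_def])
  hence "(\<lambda>k. 2 * D k + 2 * (scale_seq k)\<^sup>2 * N) \<longlonglongrightarrow> 2 * 0 + 2 * 0\<^sup>2 * N"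
    by (intro tendsto_add tendsto_mult tendsto_power tendsto_const scale_seq(4))
  moreover have "0 \<le> E k" for k by (simp add: E_def)
  ultimately have "E \<longlonglongrightarrow> 0"
    by (intro Lim_null_comparison[OF always_eventually, of E "\<lambda>k. 2 * D k + 2 * (scale_seq k)\<^sup>2 * N"]) simp_all
  thus ?thesis by (simp only: E_def[abs_def])
qed

section \<open>Limits in mean square\<close>

text \<open>
  The Cauchy--Schwarz inequality with an additional \<open>1\<close>: evaluating the nonnegative quadratic
  \<open>\<integral> (t f - u)\<^sup>2\<close> at \<open>t = I / (A + 1)\<close> instead of the minimizer \<open>I / A\<close> avoids a case distinction for \<open>A = 0\<close>.
\<close>

lemma integral_mult_power2_le:
  assumes "square_integrable M f" "square_integrable M u"
  shows "(LINT x|M. f x * u x)\<^sup>2 \<le> ((LINT x|M. (f x)\<^sup>2) + 1) * (LINT x|M. (u x)\<^sup>2)"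
proof -
  define A where "A = (LINT x|M. (f x)\<^sup>2)"
  define I where "I = (LINT x|M. f x * u x)"
  define U where "U = (LINT x|M. (u x)\<^sup>2)"
  have A: "A \<ge> 0" by (simp add: A_def)
  have i: "integrable M (\<lambda>x. f x * u x)" "integrable M (\<lambda>x. (f x)\<^sup>2)" "integrable M (\<lambda>x. (u x)\<^sup>2)"
    using assms square_integrable_mult[OF assms] by (auto simp: square_integrable_def)
  define t where "t = I / (A + 1)"
  have "0 \<le> (LINT x|M. (t * f x - u x)\<^sup>2)" by simp
  also have "\<dots> = (LINT x|M. t\<^sup>2 * (f x)\<^sup>2 - 2 * t * (f x * u x) + (u x)\<^sup>2)"
    by (intro Bochner_Integration.integral_cong) (auto simp: power2_diff power_mult_distrib algebra_simps)
  also have "\<dots> = t\<^sup>2 * A - 2 * t * I + U"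
    using i by (simp add: A_def I_def U_def)
  finally have "0 \<le> t\<^sup>2 * A - 2 * t * I + U" .
  moreover have I: "I = t * (A + 1)" using A by (simp add: t_def)
  ultimately have "t\<^sup>2 * (A + 2) \<le> U" by (simp add: power2_eq_square algebra_simps)
  moreover have "t\<^sup>2 * (A + 1) \<le> t\<^sup>2 * (A + 2)" by (intro mult_left_mono) auto
  ultimately have "t\<^sup>2 * (A + 1) \<le> U" by (rule order.trans[rotated])
  hence "(A + 1) * (t\<^sup>2 * (A + 1)) \<le> (A + 1) * U" using A by (intro mult_left_mono) auto
  moreover have "I\<^sup>2 = (A + 1) * (t\<^sup>2 * (A + 1))" unfolding I by (simp add: power2_eq_square mult_ac)
  ultimately show ?thesis unfolding A_def I_def U_def by simp
qed

lemma L2_limit_integral: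
  assumes h: "\<And>k. square_integrable M (h k)" and f: "square_integrable M f" and F: "square_integrable M F"
    and lim: "(\<lambda>k. LINT x|M. (h k x - f x)\<^sup>2) \<longlonglongrightarrow> 0"
  shows "(\<lambda>k. LINT x|M. F x * h k x) \<longlonglongrightarrow> (LINT x|M. F x * f x)"
proof -
  let ?C = "(LINT x|M. (F x)\<^sup>2) + 1"
  define J where "J k = (LINT x|M. F x * (h k x - f x))" for k
  have le: "(J k)\<^sup>2 \<le> ?C * (LINT x|M. (h k x - f x)\<^sup>2)" for k
    unfolding J_def by (rule integral_mult_power2_le[OF F square_integrable_diff[OF h f]])
  have "(\<lambda>k. (J k)\<^sup>2) \<longlonglongrightarrow> 0"
    by (rule Lim_null_comparison[OF always_eventually tendsto_mult_right_zero[OF lim, of ?C]]) (use le in simp)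
  hence "(\<lambda>k. sqrt ((J k)\<^sup>2)) \<longlonglongrightarrow> sqrt 0" by (rule tendsto_real_sqrt)
  hence "J \<longlonglongrightarrow> 0" by (simp add: tendsto_rabs_zero_iff)
  hence "(\<lambda>k. (LINT x|M. F x * f x) + J k) \<longlonglongrightarrow> (LINT x|M. F x * f x) + 0"
    by (intro tendsto_add tendsto_const)
  moreover have "(LINT x|M. F x * f x) + J k = (LINT x|M. F x * h k x)" for k
    unfolding J_def right_diff_distrib
    using square_integrable_mult[OF F f] square_integrable_mult[OF F h] by simp
  ultimately show ?thesis by simp
qed

lemma integral_power2_diff_le:
  assumes "square_integrable M f" "square_integrable M g" "square_integrable M h"
  shows "(LINT x|M. (f x - g x)\<^sup>2) \<le> 2 * (LINT x|M. (f x - h x)\<^sup>2) + 2 * (LINT x|M. (g x - h x)\<^sup>2)"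
proof -
  note i = square_integrable_diff[OF assms(1,2)] square_integrable_diff[OF assms(1,3)] square_integrable_diff[OF assms(2,3)]
  have "(LINT x|M. (f x - g x)\<^sup>2) \<le> (LINT x|M. 2 * (f x - h x)\<^sup>2 + 2 * (g x - h x)\<^sup>2)"
  proof (rule integral_mono)
    fix x
    show "(f x - g x)\<^sup>2 \<le> 2 * (f x - h x)\<^sup>2 + 2 * (g x - h x)\<^sup>2"
      using zero_le_power2[of "(f x - h x) + (g x - h x)"] by (simp add: power2_eq_square algebra_simps)
  qed (use i in \<open>simp_all add: square_integrable_def\<close>)
  also have "\<dots> = 2 * (LINT x|M. (f x - h x)\<^sup>2) + 2 * (LINT x|M. (g x - h x)\<^sup>2)"
    using i by (simp add: square_integrable_def)
  finally show ?thesis .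
qed

text \<open>
  The weighted inequality \<open>a \<le> 2\<^sup>-\<^sup>k + 2\<^sup>k a\<^sup>2\<close> turns the geometric decay of the squared \<open>L\<^sup>2\<close> distances into
  geometric decay of the \<open>L\<^sup>1\<close> distances, so the telescoping series converges absolutely almost everywhere.
\<close>

lemma (in finite_measure) AE_convergent_of_fast_L2:
  assumes \<psi>: "\<And>k. square_integrable M (\<psi> k)"
    and fast: "\<And>k. (LINT x|M. (\<psi> (Suc k) x - \<psi> k x)\<^sup>2) \<le> (1 / 4) ^ k"
  shows "AE x in M. convergent (\<lambda>k. \<psi> k x)"
proof -
  define u where "u k x = \<bar>\<psi> (Suc k) x - \<psi> k x\<bar>" for k x
  define V where "V = measure M (space M)"
  have V: "V \<ge> 0" by (simp add: V_def)
  have sq: "square_integrable M (\<lambda>x. \<psi> (Suc k) x - \<psi> k x)" for k by (intro square_integrable_diff \<psi>)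
  have [measurable]: "u k \<in> borel_measurable M" for k
    using sq[of k] unfolding u_def square_integrable_def by (auto intro: borel_measurable_abs)
  have ui: "integrable M (u k)" for k
    unfolding u_def using square_integrable_integrable[OF sq] by simp
  have ub: "(LINT x|M. u k x) \<le> (V + 1) * (1 / 2) ^ k" for k
  proof -
    have "(LINT x|M. u k x) \<le> (LINT x|M. (1 / 2) ^ k + 2 ^ k * (\<psi> (Suc k) x - \<psi> k x)\<^sup>2)"
    proof (rule integral_mono[OF ui])
      show "integrable M (\<lambda>x. (1 / 2) ^ k + 2 ^ k * (\<psi> (Suc k) x - \<psi> k x)\<^sup>2)"
        using sq[of k] by (simp add: square_integrable_def)
      fix x
      let ?a = "\<bar>\<psi> (Suc k) x - \<psi> k x\<bar>"
      have p: "(2::real) ^ k * (1 / 2) ^ k = 1" by (simp flip: power_mult_distrib)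
      have "0 \<le> 2 ^ k * (?a - (1 / 2) ^ k)\<^sup>2" by simp
      also have "\<dots> = 2 ^ k * ?a\<^sup>2 - 2 * (2 ^ k * (1 / 2) ^ k) * ?a + (2 ^ k * (1 / 2) ^ k) * (1 / 2) ^ k"
        by (simp add: power2_eq_square algebra_simps del: power_mult_distrib)
      finally have "2 * ?a \<le> (1 / 2) ^ k + 2 ^ k * ?a\<^sup>2" unfolding p by simp
      moreover have "a \<le> R" if "2 * a \<le> R" "0 \<le> a" for a R :: real using that by linarith
      ultimately have "?a \<le> (1 / 2) ^ k + 2 ^ k * ?a\<^sup>2" using abs_ge_zero by blast
      thus "u k x \<le> (1 / 2) ^ k + 2 ^ k * (\<psi> (Suc k) x - \<psi> k x)\<^sup>2" by (simp add: u_def)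
    qed
    also have "\<dots> = (1 / 2) ^ k * V + 2 ^ k * (LINT x|M. (\<psi> (Suc k) x - \<psi> k x)\<^sup>2)"
      using sq[of k] by (simp add: square_integrable_def V_def)
    also have "\<dots> \<le> (1 / 2) ^ k * V + 2 ^ k * (1 / 4) ^ k"
      by (intro add_left_mono mult_left_mono fast) simp
    also have "(2::real) ^ k * (1 / 4) ^ k = (1 / 2) ^ k" by (simp flip: power_mult_distrib)
    finally show ?thesis by (simp add: algebra_simps)
  qed
  have "(\<integral>\<^sup>+x. (\<Sum>k. ennreal (u k x)) \<partial>M) = (\<Sum>k. \<integral>\<^sup>+x. ennreal (u k x) \<partial>M)"
    by (rule nn_integral_suminf) simp
  also have "\<dots> = (\<Sum>k. ennreal (LINT x|M. u k x))"
    using ui by (subst nn_integral_eq_integral) (auto simp: u_def)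
  also have "\<dots> \<le> (\<Sum>k. ennreal ((V + 1) * (1 / 2) ^ k))"
    by (intro suminf_le ennreal_leI ub) auto
  also have "\<dots> = ennreal (\<Sum>k. (V + 1) * (1 / 2) ^ k)"
    using V by (intro suminf_ennreal2) (auto intro: summable_mult summable_geometric)
  finally have "(\<integral>\<^sup>+x. (\<Sum>k. ennreal (u k x)) \<partial>M) \<noteq> \<infinity>"
    by (metis ennreal_less_top infinity_ennreal_def order_le_less_trans order_less_irrefl)
  hence "AE x in M. (\<Sum>k. ennreal (u k x)) \<noteq> \<infinity>"
    by (intro nn_integral_PInf_AE) auto
  thus ?thesis
  proof eventually_elim
    case (elim x)
    hence "summable (\<lambda>k. u k x)"
      by (intro summable_suminf_not_top) (auto simp: u_def)
    hence "summable (\<lambda>k. \<psi> (Suc k) x - \<psi> k x)"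
      unfolding u_def by (rule summable_rabs_cancel)
    hence "convergent (\<lambda>n. \<Sum>k<n. \<psi> (Suc k) x - \<psi> k x)" by (simp add: summable_iff_convergent)
    hence "convergent (\<lambda>n. \<psi> n x - \<psi> 0 x)" by (simp only: sum_lessThan_telescope[of "\<lambda>k. \<psi> k x"])
    thus ?case by (simp add: convergent_diff_const_right_iff)
  qed
qed

text \<open>
  The Riesz--Fischer theorem. A subsequence \<open>\<psi>\<close> converges almost everywhere, Fatou's lemma bounds the
  distances to its limit, and the Cauchy property transfers the convergence to the whole sequence.
\<close>

lemma (in finite_measure) L2_complete:
  assumes \<phi>: "\<And>k. square_integrable M (\<phi> k)"
    and Cauchy: "\<And>e. e > 0 \<Longrightarrow> \<exists>N. \<forall>m\<ge>N. \<forall>n\<ge>N. (LINT x|M. (\<phi> m x - \<phi> n x)\<^sup>2) < e"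
  obtains g where "square_integrable M g" "(\<lambda>k. LINT x|M. (\<phi> k x - g x)\<^sup>2) \<longlonglongrightarrow> 0"
proof -
  obtain N where N: "\<And>k m n. m \<ge> N k \<Longrightarrow> n \<ge> N k \<Longrightarrow> (LINT x|M. (\<phi> m x - \<phi> n x)\<^sup>2) < (1 / 4) ^ k"
    using Cauchy[of "(1 / 4) ^ _"] by (metis zero_less_divide_1_iff zero_less_numeral zero_less_power)
  \<comment> \<open>Partial sums dominate all earlier thresholds, so one index serves for all of them.\<close>
  define r where "r k = (\<Sum>i\<le>k. N i)" for k
  have r: "r k \<ge> N i" if "i \<le> k" for i k
    unfolding r_def using that by (intro member_le_sum) auto
  define \<psi> where "\<psi> k = \<phi> (r k)" for k
  have \<psi>: "square_integrable M (\<psi> k)" for k by (simp add: \<psi>_def \<phi>)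
  have \<psi>d: "(LINT x|M. (\<psi> m x - \<psi> k x)\<^sup>2) \<le> (1 / 4) ^ k" if "m \<ge> k" for m k
    unfolding \<psi>_def using N[of k "r m" "r k"] r[of k m] r[of k k] that by simp
  have [measurable]: "\<psi> k \<in> borel_measurable M" for k using \<psi>[of k] by (simp add: square_integrable_def)
  have conv: "AE x in M. convergent (\<lambda>k. \<psi> k x)"
    by (rule AE_convergent_of_fast_L2[OF \<psi>]) (simp add: \<psi>d)
  define g where "g x = lim (\<lambda>k. \<psi> k x)" for x
  have gm [measurable]: "g \<in> borel_measurable M" unfolding g_def by measurable
  have nn: "(\<integral>\<^sup>+x. ennreal ((\<psi> k x - g x)\<^sup>2) \<partial>M) \<le> ennreal ((1 / 4) ^ k)" for k
  proof -
    have "(\<integral>\<^sup>+x. ennreal ((\<psi> k x - g x)\<^sup>2) \<partial>M) = (\<integral>\<^sup>+x. liminf (\<lambda>m. ennreal ((\<psi> m x - \<psi> k x)\<^sup>2)) \<partial>M)"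
    proof (rule nn_integral_cong_AE)
      show "AE x in M. ennreal ((\<psi> k x - g x)\<^sup>2) = liminf (\<lambda>m. ennreal ((\<psi> m x - \<psi> k x)\<^sup>2))"
        using conv
      proof eventually_elim
        case (elim x)
        hence "(\<lambda>m. \<psi> m x) \<longlonglongrightarrow> g x" by (simp add: g_def convergent_LIMSEQ_iff)
        hence "(\<lambda>m. ennreal ((\<psi> m x - \<psi> k x)\<^sup>2)) \<longlonglongrightarrow> ennreal ((g x - \<psi> k x)\<^sup>2)"
          by (intro tendsto_ennrealI tendsto_power tendsto_diff tendsto_const)
        hence "liminf (\<lambda>m. ennreal ((\<psi> m x - \<psi> k x)\<^sup>2)) = ennreal ((g x - \<psi> k x)\<^sup>2)"
          by (intro lim_imp_Liminf) auto
        thus ?case by (simp add: power2_commute)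
      qed
    qed
    also have "\<dots> \<le> liminf (\<lambda>m. \<integral>\<^sup>+x. ennreal ((\<psi> m x - \<psi> k x)\<^sup>2) \<partial>M)"
      by (rule nn_integral_liminf) simp
    also have "\<dots> \<le> ennreal ((1 / 4) ^ k)"
    proof (rule Liminf_le)
      have "(\<integral>\<^sup>+x. ennreal ((\<psi> m x - \<psi> k x)\<^sup>2) \<partial>M) \<le> ennreal ((1 / 4) ^ k)" if "m \<ge> k" for m
        using square_integrable_diff[OF \<psi>[of m] \<psi>[of k]] \<psi>d[OF that]
        by (subst nn_integral_eq_integral) (auto simp: square_integrable_def intro!: ennreal_leI)
      thus "\<forall>\<^sub>F m in sequentially. (\<integral>\<^sup>+x. ennreal ((\<psi> m x - \<psi> k x)\<^sup>2) \<partial>M) \<le> ennreal ((1 / 4) ^ k)"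
        by (auto simp: eventually_sequentially)
    qed simp
    finally show ?thesis .
  qed
  have dsq: "square_integrable M (\<lambda>x. \<psi> k x - g x)" for k
    unfolding square_integrable_def
  proof
    show "integrable M (\<lambda>x. (\<psi> k x - g x)\<^sup>2)"
    proof (rule integrableI_nonneg)
      show "(\<integral>\<^sup>+x. ennreal ((\<psi> k x - g x)\<^sup>2) \<partial>M) < \<infinity>"
        using nn[of k] by (rule order_le_less_trans) simp
    qed auto
  qed simp
  have g: "square_integrable M g"
    using square_integrable_diff[OF \<psi>[of 0] dsq[of 0]] by simp
  have dle: "(LINT x|M. (\<psi> k x - g x)\<^sup>2) \<le> (1 / 4) ^ k" for k
    using nn[of k] dsq[of k] by (subst (asm) nn_integral_eq_integral) (auto simp: square_integrable_def)
  have "(\<lambda>k. LINT x|M. (\<phi> k x - g x)\<^sup>2) \<longlonglongrightarrow> 0"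
  proof (rule LIMSEQ_I)
    fix e :: real assume e: "e > 0"
    have "(\<lambda>k. (1 / 4 :: real) ^ k) \<longlonglongrightarrow> 0" by (rule LIMSEQ_power_zero) simp
    from LIMSEQ_D[OF this, of "e / 4"] obtain k where k: "(1 / 4 :: real) ^ k < e / 4" using e by auto
    have "(LINT x|M. (\<phi> n x - g x)\<^sup>2) < e" if n: "n \<ge> r k" for n
    proof -
      have "(LINT x|M. (\<phi> n x - g x)\<^sup>2) \<le> 2 * (LINT x|M. (\<phi> n x - \<psi> k x)\<^sup>2) + 2 * (LINT x|M. (g x - \<psi> k x)\<^sup>2)"
        by (rule integral_power2_diff_le[OF \<phi> g \<psi>])
      also have "(LINT x|M. (g x - \<psi> k x)\<^sup>2) = (LINT x|M. (\<psi> k x - g x)\<^sup>2)" by (simp add: power2_commute)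
      also have "\<dots> \<le> (1 / 4) ^ k" by (rule dle)
      also have "(LINT x|M. (\<phi> n x - \<psi> k x)\<^sup>2) \<le> (1 / 4) ^ k"
        unfolding \<psi>_def using n r[of k k] by (intro less_imp_le[OF N]) auto
      finally show ?thesis using k by simp
    qed
    thus "\<exists>K. \<forall>n\<ge>K. norm ((LINT x|M. (\<phi> n x - g x)\<^sup>2) - 0) < e" by (intro exI[of _ "r k"]) simp
  qed
  with g that show ?thesis by blast
qed

section \<open>The trace\<close>

lemma square_integrable_continuous_sphere:
  fixes F :: "real^'n \<Rightarrow> real"
  assumes "continuous_on UNIV F"
  shows "square_integrable sphere_measure F"
  unfolding square_integrable_def
proof
  show m: "F \<in> borel_measurable sphere_measure"
    by (intro borel_sphere_measurable borel_measurable_continuous_onI assms)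
  have sp: "space (sphere_measure :: (real^'n) measure) = sphere 0 1"
    by (simp add: sphere_measure_def space_scale_measure space_restrict_space)
  obtain C where C: "\<And>x. x \<in> cball 0 1 \<Longrightarrow> \<bar>F x\<bar> \<le> C"
    using continuous_ball_bounded[OF assms, of 1] by blast
  show "integrable sphere_measure (\<lambda>x. (F x)\<^sup>2)"
  proof (rule sphere_measure.integrable_const_bound[where B = "C\<^sup>2"])
    show "AE x in sphere_measure. norm ((F x)\<^sup>2) \<le> C\<^sup>2"
    proof (rule AE_I2)
      fix x :: "real^'n" assume "x \<in> space sphere_measure"
      hence "\<bar>F x\<bar> \<le> C" using sp by (intro C) auto
      from power_mono[OF this abs_ge_zero, of 2] show "norm ((F x)\<^sup>2) \<le> C\<^sup>2" by simp
    qed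
  qed (use m in simp)
qed

lemma radial_mult:
  assumes "C_k 1 F" "C_k 1 G"
  shows "radial (\<lambda>x. F x * G x) x = F x * radial G x + G x * radial F x"
  using C1_continuous(4)[OF assms(1)] C1_continuous(4)[OF assms(2)]
  by (simp add: radial_def partial_mult sum.distrib sum_distrib_left algebra_simps)

text \<open>
  Apply \<open>integral_radial\<close> to \<open>\<phi>\<^sup>2\<close> and split \<open>2 \<phi> x\<^sub>i \<partial>\<^sub>i\<phi> \<le> \<phi>\<^sup>2 + (\<partial>\<^sub>i\<phi>)\<^sup>2\<close>.
\<close>

lemma trace_inequality:
  fixes \<phi> :: "real^'n \<Rightarrow> real"
  assumes \<phi>: "C_k 1 \<phi>"
  shows "(LINT y|sphere_measure. (\<phi> y)\<^sup>2) \<le>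
    2 * CARD('n) * (LINT x|ball_measure. (\<phi> x)\<^sup>2) + (\<Sum>i\<in>UNIV. LINT x|ball_measure. (partial i \<phi> x)\<^sup>2)"
proof -
  note cont = C1_continuous[OF \<phi>]
  have i: "integrable ball_measure (\<lambda>x. (\<phi> x)\<^sup>2)" "integrable ball_measure (\<lambda>x. (partial i \<phi> x)\<^sup>2)" for i
    by (intro integrable_continuous_ball continuous_on_power cont)+
  have "(LINT y|sphere_measure. \<phi> y * \<phi> y) = (LINT x|ball_measure. CARD('n) * (\<phi> x * \<phi> x) + radial (\<lambda>x. \<phi> x * \<phi> x) x)"
    by (rule integral_radial[OF C_k_mult[OF \<phi> \<phi>]])
  also have "\<dots> = (LINT x|ball_measure. CARD('n) * (\<phi> x * \<phi> x) + 2 * (\<phi> x * radial \<phi> x))"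
    by (simp add: radial_mult[OF \<phi> \<phi>])
  also have "\<dots> \<le> (LINT x|ball_measure. 2 * CARD('n) * (\<phi> x)\<^sup>2 + (\<Sum>i\<in>UNIV. (partial i \<phi> x)\<^sup>2))"
  proof (rule integral_mono)
    show "integrable ball_measure (\<lambda>x. CARD('n) * (\<phi> x * \<phi> x) + 2 * (\<phi> x * radial \<phi> x))"
      by (intro integrable_continuous_ball continuous_on_add continuous_on_mult continuous_on_const cont)
    show "integrable ball_measure (\<lambda>x. 2 * CARD('n) * (\<phi> x)\<^sup>2 + (\<Sum>i\<in>UNIV. (partial i \<phi> x)\<^sup>2))"
      using i by simp
    fix x :: "real^'n" assume "x \<in> space ball_measure"
    hence x: "norm x \<le> 1" by simp
    have "2 * (\<phi> x * (x $ i * partial i \<phi> x)) \<le> (\<phi> x)\<^sup>2 + (partial i \<phi> x)\<^sup>2" for i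
    proof -
      have "\<bar>x $ i\<bar> \<le> 1" using component_le_norm_cart[of x i] x by linarith
      from power_mono[OF this abs_ge_zero, of 2] have xi: "(x $ i)\<^sup>2 \<le> 1" by simp
      have "2 * (\<phi> x * (x $ i * partial i \<phi> x)) \<le> (\<phi> x)\<^sup>2 + (x $ i)\<^sup>2 * (partial i \<phi> x)\<^sup>2"
        using sum_squares_bound[of "\<phi> x" "x $ i * partial i \<phi> x"] by (simp add: power_mult_distrib mult.assoc)
      also have "(x $ i)\<^sup>2 * (partial i \<phi> x)\<^sup>2 \<le> 1 * (partial i \<phi> x)\<^sup>2" by (intro mult_right_mono xi) simp
      finally show ?thesis by simp
    qed
    hence "(\<Sum>i\<in>UNIV. 2 * (\<phi> x * (x $ i * partial i \<phi> x))) \<le> (\<Sum>i\<in>(UNIV::'n set). (\<phi> x)\<^sup>2 + (partial i \<phi> x)\<^sup>2)"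
      by (intro sum_mono)
    thus "CARD('n) * (\<phi> x * \<phi> x) + 2 * (\<phi> x * radial \<phi> x) \<le> 2 * CARD('n) * (\<phi> x)\<^sup>2 + (\<Sum>i\<in>UNIV. (partial i \<phi> x)\<^sup>2)"
      by (simp add: radial_def sum_distrib_left sum.distrib power2_eq_square mult_ac)
  qed
  also have "\<dots> = 2 * CARD('n) * (LINT x|ball_measure. (\<phi> x)\<^sup>2) + (\<Sum>i\<in>UNIV. LINT x|ball_measure. (partial i \<phi> x)\<^sup>2)"
    using i by simp
  finally show ?thesis by (simp add: power2_eq_square)
qed

lemma W12_weak_partial:
  assumes "f \<in> W12"
  shows "has_weak_partial i f (weak_partial i f)"
  unfolding weak_partial_def by (rule someI_ex[of "has_weak_partial i f"]) (use assms in \<open>auto simp: W12_def\<close>)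

text \<open>
  By the trace inequality the mollifications of \<open>f\<close>, which are Cauchy in \<open>W\<^sup>1\<^sup>,\<^sup>2\<close> of the ball, are
  also Cauchy in \<open>L\<^sup>2\<close> of the sphere.
\<close>

lemma sobolev_trace_exists:
  fixes f :: "real^'n \<Rightarrow> real"
  assumes f: "f \<in> W12"
  shows "has_trace f (sobolev_trace f)"
proof -
  have sf: "square_integrable ball_measure f" using f by (simp add: W12_def)
  note fi = ball_measure.square_integrable_integrable[OF sf]
  define \<phi> where "\<phi> k = mollify (scale_seq k) f" for k
  have C1: "C_k 1 (\<phi> k)" for k unfolding \<phi>_def by (rule mollify_C1(1)[OF fi scale_seq(1,2)])
  define D where "D k = (LINT x|ball_measure. (\<phi> k x - f x)\<^sup>2)" for k
  define E where "E i k = (LINT x|ball_measure. (partial i (\<phi> k) x - weak_partial i f x)\<^sup>2)" for i k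
  have D: "D \<longlonglongrightarrow> 0" using mollify_L2_limit[OF sf] by (simp only: D_def[abs_def] \<phi>_def)
  have E: "E i \<longlonglongrightarrow> 0" for i
    using mollify_W12_limit[OF sf W12_weak_partial[OF f]] by (simp only: E_def[abs_def] \<phi>_def)
  have swp: "square_integrable ball_measure (weak_partial i f)" for i
    using W12_weak_partial[OF f, of i] by (simp add: has_weak_partial_def)
  define H where "H k = 2 * ((2 * real CARD('n)) * D k + (\<Sum>i\<in>UNIV. E i k))" for k
  have H: "H \<longlonglongrightarrow> 2 * ((2 * real CARD('n)) * 0 + (\<Sum>i\<in>(UNIV::'n set). 0))"
    unfolding H_def[abs_def] by (intro tendsto_mult tendsto_add tendsto_sum tendsto_const D E)
  have bound: "(LINT y|sphere_measure. (\<phi> m y - \<phi> n y)\<^sup>2) \<le> H m + H n" for m n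
  proof -
    have dC1: "C_k 1 (\<lambda>x. \<phi> m x - \<phi> n x)"
      using C_k_add[OF C1[of m] C_k_mult[OF C_k_const[of 1 "-1"] C1[of n]]] by simp
    have pd: "partial i (\<lambda>x. \<phi> m x - \<phi> n x) x = partial i (\<phi> m) x - partial i (\<phi> n) x" for i x
      using partial_eq[OF has_derivative_diff[OF derivative_eq_sum_partial derivative_eq_sum_partial], of "\<phi> m" x "\<phi> n" i]
        C1_continuous(4)[OF C1[of m]] C1_continuous(4)[OF C1[of n]]
      by (simp add: sum_axis)
    have "(LINT y|sphere_measure. (\<phi> m y - \<phi> n y)\<^sup>2) \<le>
      2 * CARD('n) * (LINT x|ball_measure. (\<phi> m x - \<phi> n x)\<^sup>2) +
      (\<Sum>i\<in>UNIV. LINT x|ball_measure. (partial i (\<phi> m) x - partial i (\<phi> n) x)\<^sup>2)"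
      using trace_inequality[OF dC1] unfolding pd .
    also have "(LINT x|ball_measure. (\<phi> m x - \<phi> n x)\<^sup>2) \<le> 2 * D m + 2 * D n"
      unfolding D_def by (intro integral_power2_diff_le square_integrable_continuous_ball C1_continuous(1)[OF C1] sf)
    also have "(\<Sum>i\<in>UNIV. LINT x|ball_measure. (partial i (\<phi> m) x - partial i (\<phi> n) x)\<^sup>2) \<le> (\<Sum>i\<in>UNIV. 2 * E i m + 2 * E i n)"
      unfolding E_def by (intro sum_mono integral_power2_diff_le square_integrable_continuous_ball C1_continuous(2)[OF C1] swp)
    finally show ?thesis by (simp add: H_def sum.distrib sum_distrib_left algebra_simps)
  qed
  have sS: "square_integrable sphere_measure (\<phi> k)" for k
    by (rule square_integrable_continuous_sphere[OF C1_continuous(1)[OF C1]])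
  obtain g where g: "square_integrable sphere_measure g" "(\<lambda>k. LINT y|sphere_measure. (\<phi> k y - g y)\<^sup>2) \<longlonglongrightarrow> 0"
  proof (rule sphere_measure.L2_complete[OF sS])
    fix e :: real assume "e > 0"
    hence "\<forall>\<^sub>F k in sequentially. H k < e / 2"
      using H by (intro order_tendstoD(2)[where y = 0]) auto
    then obtain N where N: "\<And>k. k \<ge> N \<Longrightarrow> H k < e / 2" by (auto simp: eventually_sequentially)
    have "(LINT y|sphere_measure. (\<phi> m y - \<phi> n y)\<^sup>2) < e" if "m \<ge> N" "n \<ge> N" for m n
      using bound[of m n] N[OF that(1)] N[OF that(2)] by linarith
    thus "\<exists>N. \<forall>m\<ge>N. \<forall>n\<ge>N. (LINT y|sphere_measure. (\<phi> m y - \<phi> n y)\<^sup>2) < e" by blast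
  qed
  have "has_trace f g"
    unfolding has_trace_def using g C1 D E
    by (auto simp: D_def[abs_def] E_def[abs_def] simp del: C_k.simps)
  thus ?thesis unfolding sobolev_trace_def by (rule someI[of "has_trace f"])
qed

text \<open>
  For \<open>C\<^sup>1\<close> functions this is \<open>integral_radial\<close> applied to the product with \<open>P\<close>; both sides are continuous
  along the approximating sequence that defines a trace. In particular the left-hand side is the
  same for all traces of \<open>f\<close>.
\<close>

lemma integral_trace:
  fixes f P :: "real^'n \<Rightarrow> real"
  assumes f: "f \<in> W12" and g: "has_trace f g" and P: "C_k 1 P"
  shows "(LINT y|sphere_measure. P y * g y) =
    (LINT x|ball_measure. CARD('n) * P x * f x) + (LINT x|ball_measure. radial P x * f x) +
    (\<Sum>i\<in>UNIV. LINT x|ball_measure. (P x * x $ i) * weak_partial i f x)"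
proof -
  have sf: "square_integrable ball_measure f" using f by (simp add: W12_def)
  have swp: "square_integrable ball_measure (weak_partial i f)" for i
    using W12_weak_partial[OF f, of i] by (simp add: has_weak_partial_def)
  from g obtain \<phi> where sg: "square_integrable sphere_measure g" and C1: "\<And>k. C_k 1 (\<phi> k)"
    and l1: "(\<lambda>k::nat. LINT x|ball_measure. (\<phi> k x - f x)\<^sup>2) \<longlonglongrightarrow> 0"
    and l2: "\<And>i. (\<lambda>k. LINT x|ball_measure. (partial i (\<phi> k) x - weak_partial i f x)\<^sup>2) \<longlonglongrightarrow> 0"
    and l3: "(\<lambda>k. LINT y|sphere_measure. (\<phi> k y - g y)\<^sup>2) \<longlonglongrightarrow> 0"
    unfolding has_trace_def by blast
  note cP = C1_continuous[OF P] and c\<phi> = C1_continuous[OF C1]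
  have cPi: "continuous_on UNIV (\<lambda>x. P x * x $ i)" for i
    by (intro continuous_on_mult cP continuous_on_component continuous_on_id)
  have cPd: "continuous_on UNIV (\<lambda>x. CARD('n) * P x)"
    by (intro continuous_on_mult cP continuous_on_const)
  have eq: "(LINT y|sphere_measure. P y * \<phi> k y) =
    (LINT x|ball_measure. CARD('n) * P x * \<phi> k x) + (LINT x|ball_measure. radial P x * \<phi> k x) +
    (\<Sum>i\<in>UNIV. LINT x|ball_measure. (P x * x $ i) * partial i (\<phi> k) x)" for k
  proof -
    have i: "integrable ball_measure (\<lambda>x. CARD('n) * P x * \<phi> k x)" "integrable ball_measure (\<lambda>x. radial P x * \<phi> k x)"
      "integrable ball_measure (\<lambda>x. (P x * x $ i) * partial i (\<phi> k) x)" for i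
      by (intro integrable_continuous_ball continuous_on_mult cPi cPd cP c\<phi>)+
    have "(LINT y|sphere_measure. P y * \<phi> k y) = (LINT x|ball_measure. CARD('n) * (P x * \<phi> k x) + radial (\<lambda>x. P x * \<phi> k x) x)"
      by (rule integral_radial[OF C_k_mult[OF P C1]])
    also have "\<dots> = (LINT x|ball_measure. CARD('n) * P x * \<phi> k x + radial P x * \<phi> k x +
        (\<Sum>i\<in>UNIV. (P x * x $ i) * partial i (\<phi> k) x))"
      unfolding radial_mult[OF P C1] by (simp add: radial_def[of "\<phi> k"] sum_distrib_left mult_ac add_ac)
    also have "\<dots> = (LINT x|ball_measure. CARD('n) * P x * \<phi> k x) + (LINT x|ball_measure. radial P x * \<phi> k x) +
      (\<Sum>i\<in>UNIV. LINT x|ball_measure. (P x * x $ i) * partial i (\<phi> k) x)"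
      using i by (simp del: integral_mult_right_zero integral_mult_left_zero)
    finally show ?thesis .
  qed
  note sB = square_integrable_continuous_ball
  have "(\<lambda>k. (LINT x|ball_measure. CARD('n) * P x * \<phi> k x) + (LINT x|ball_measure. radial P x * \<phi> k x) +
    (\<Sum>i\<in>UNIV. LINT x|ball_measure. (P x * x $ i) * partial i (\<phi> k) x)) \<longlonglongrightarrow>
    (LINT x|ball_measure. CARD('n) * P x * f x) + (LINT x|ball_measure. radial P x * f x) +
    (\<Sum>i\<in>UNIV. LINT x|ball_measure. (P x * x $ i) * weak_partial i f x)"
    by (intro tendsto_add tendsto_sum L2_limit_integral[OF sB[OF c\<phi>(1)] sf sB[OF cPd] l1]
      L2_limit_integral[OF sB[OF c\<phi>(1)] sf sB[OF cP(3)] l1] L2_limit_integral[OF sB[OF c\<phi>(2)] swp sB[OF cPi] l2])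
  moreover have "(\<lambda>k. LINT y|sphere_measure. P y * \<phi> k y) \<longlonglongrightarrow> (LINT y|sphere_measure. P y * g y)"
    by (rule L2_limit_integral[OF square_integrable_continuous_sphere[OF c\<phi>(1)] sg
      square_integrable_continuous_sphere[OF cP(1)] l3])
  ultimately show ?thesis unfolding eq by (rule LIMSEQ_unique[rotated])
qed

section \<open>Cut-off functions\<close>

text \<open>
  \<open>cutoff k\<close> vanishes where \<open>1 - |x|\<^sup>2 \<le> 1 / (k + 1)\<close> and increases to \<open>1\<close> in the open ball as \<open>k\<close> grows.
\<close>

definition cutoff :: "nat \<Rightarrow> real^'n \<Rightarrow> real"
  where "cutoff k x = flat 1 (real (Suc k) * (1 - (norm x)\<^sup>2) - 1)"

text \<open>
  The function \<open>t b'(t - 1)\<close> for the profile \<open>b(t) = exp(-1/t)\<close> of the cut-off functions: it describes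
  \<open>(1 - |x|\<^sup>2) \<partial>\<^sub>i\<close> of a cut-off, where the factor \<open>k + 1\<close> from the chain rule is absorbed in \<open>t\<close>.
\<close>

definition cutoff_slope :: "real \<Rightarrow> real"
  where "cutoff_slope t = t * flat [:0, 0, 1:] (t - 1)"

lemma test_function_cutoff: "test_function (cutoff k :: real^'n \<Rightarrow> real)"
  unfolding test_function_def
proof
  have "smooth (cutoff k :: real^'n \<Rightarrow> real)"
    unfolding cutoff_def[abs_def] by (intro smooth_intros)
  thus "\<forall>j. C_k j (cutoff k :: real^'n \<Rightarrow> real)" by (simp add: smooth_def)
  define r where "r = sqrt (1 - 1 / real (Suc k))"
  have r: "r < 1" by (simp add: r_def)
  have "cutoff k x = 0" if "norm x > r" for x :: "real^'n"
  proof -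
    have "sqrt (1 - 1 / real (Suc k)) < sqrt ((norm x)\<^sup>2)" using that by (simp add: r_def)
    hence "1 - 1 / real (Suc k) < (norm x)\<^sup>2" by (simp only: real_sqrt_less_iff)
    hence "real (Suc k) * (1 - (norm x)\<^sup>2) \<le> real (Suc k) * (1 / real (Suc k))"
      by (intro mult_left_mono) auto
    thus ?thesis by (simp add: cutoff_def flat_def)
  qed
  with r show "\<exists>K. compact K \<and> K \<subseteq> ball 0 1 \<and> (\<forall>x. x \<notin> K \<longrightarrow> cutoff k (x :: real^'n) = 0)"
    by (intro exI[of _ "cball 0 r"]) auto
qed

lemma partial_bowl: "partial i (\<lambda>x. 1 - (norm x)\<^sup>2) = (\<lambda>x. - 2 * x $ i)"
proof
  fix x :: "real^'a"
  show "partial i (\<lambda>x. 1 - (norm x)\<^sup>2) x = - 2 * x $ i"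
    using partial_eq[OF has_derivative_diff[OF has_derivative_const[of 1]
        derivative_eq_sum_partial[OF smooth_differentiable[OF smooth_norm_power2]]], where i = i and x = x]
    by (simp add: partial_norm_power2 sum_axis)
qed

lemma smooth_bowl: "smooth (\<lambda>x. 1 - (norm x)\<^sup>2)"
  by (intro smooth_intros)

lemma partial_cutoff:
  "(1 - (norm x)\<^sup>2) * partial i (cutoff k) x = - 2 * x $ i * cutoff_slope (real (Suc k) * (1 - (norm x)\<^sup>2))"
proof -
  let ?G = "\<lambda>x. real (Suc k) * (1 - (norm x)\<^sup>2) + - 1"
  have "partial i ?G x = real (Suc k) * (- 2 * x $ i)"
    by (subst partial_add; (intro smooth_differentiable smooth_intros)?)
       (subst partial_mult; (intro smooth_differentiable smooth_intros)?; simp add: partial_bowl)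
  moreover have "partial i (\<lambda>x. flat 1 (?G x)) x = flat (flat_deriv 1) (?G x) * partial i ?G x"
    by (intro partial_chain flat_has_derivative smooth_differentiable smooth_intros)
  moreover have "flat_deriv 1 = [:0, 0, 1:]" by (simp add: flat_deriv_def pderiv_1)
  ultimately show ?thesis by (simp add: cutoff_def[abs_def] cutoff_slope_def)
qed

text \<open>
  With \<open>y = 1 / (t - 1)\<close> the function is \<open>(y + y\<^sup>2) exp(-y)\<close>, at most \<open>2\<close> since
  \<open>exp y \<ge> 1 + y + y\<^sup>2 / 2\<close>, and small when \<open>t\<close> is large.
\<close>

lemma cutoff_slope_bounds:
  "\<bar>cutoff_slope t\<bar> \<le> 2" "t > 1 \<Longrightarrow> \<bar>cutoff_slope t\<bar> \<le> 1 / (t - 1) + (1 / (t - 1))\<^sup>2"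
proof -
  have eq: "cutoff_slope t = (y + y\<^sup>2) * exp (- y)" if "t > 1" "y = 1 / (t - 1)" for y
  proof -
    have ty: "t * y = 1 + y" using that by (simp add: field_simps)
    have "t * y\<^sup>2 = (t * y) * y" by (simp add: power2_eq_square)
    hence "t * y\<^sup>2 = y + y\<^sup>2" unfolding ty by (simp add: power2_eq_square algebra_simps)
    moreover have "cutoff_slope t = t * y\<^sup>2 * exp (- y)"
      using that by (simp add: cutoff_slope_def flat_def power2_eq_square)
    ultimately show ?thesis by (simp only:)
  qed
  show "\<bar>cutoff_slope t\<bar> \<le> 2"
  proof (cases "t > 1")
    case True
    define y where "y = 1 / (t - 1)"
    have y: "y \<ge> 0" using True by (simp add: y_def)
    have "y + y\<^sup>2 \<le> 2 * exp y" using exp_lower_Taylor_quadratic[OF y] y by (simp add: power2_eq_square)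
    hence "(y + y\<^sup>2) * exp (- y) \<le> 2 * exp y * exp (- y)" by (intro mult_right_mono) auto
    also have "\<dots> = 2" by (simp add: mult.assoc flip: exp_add)
    finally show ?thesis using eq[OF True y_def] y by simp
  next
    case False
    thus ?thesis by (simp add: cutoff_slope_def flat_def)
  qed
  show "\<bar>cutoff_slope t\<bar> \<le> 1 / (t - 1) + (1 / (t - 1))\<^sup>2" if "t > 1"
  proof -
    define y where "y = 1 / (t - 1)"
    have y: "y \<ge> 0" using that by (simp add: y_def)
    have "(y + y\<^sup>2) * exp (- y) \<le> (y + y\<^sup>2) * 1" using y by (intro mult_left_mono) auto
    thus ?thesis using eq[OF that y_def] y by (simp add: y_def)
  qed
qed

lemma inverse_shift_tendsto_0: "((\<lambda>t::real. 1 / (t - 1)) \<longlongrightarrow> 0) at_top"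
proof -
  have "filterlim (\<lambda>t::real. - 1 + t) at_top at_top"
    by (rule filterlim_tendsto_add_at_top[OF tendsto_const filterlim_ident])
  from tendsto_divide_0[OF tendsto_const filterlim_at_top_imp_at_infinity[OF this], of 1]
  show ?thesis by simp
qed

lemma cutoff_slope_tendsto_0: "(cutoff_slope \<longlongrightarrow> 0) at_top"
proof (rule Lim_null_comparison)
  show "\<forall>\<^sub>F t in at_top. norm (cutoff_slope t) \<le> 1 / (t - 1) + (1 / (t - 1))\<^sup>2"
    using eventually_gt_at_top[of 1] by eventually_elim (simp add: cutoff_slope_bounds)
  show "((\<lambda>t::real. 1 / (t - 1) + (1 / (t - 1))\<^sup>2) \<longlongrightarrow> 0) at_top"
    using tendsto_add[OF inverse_shift_tendsto_0 tendsto_power[OF inverse_shift_tendsto_0, of 2]] by simp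
qed

lemma flat_tendsto_1: "((\<lambda>t. flat 1 (t - 1)) \<longlongrightarrow> 1) at_top"
proof -
  have "((\<lambda>t::real. exp (- (1 / (t - 1)))) \<longlongrightarrow> exp (- 0)) at_top"
    by (intro tendsto_exp tendsto_minus inverse_shift_tendsto_0)
  hence "((\<lambda>t::real. exp (- (1 / (t - 1)))) \<longlongrightarrow> 1) at_top" by simp
  moreover have "\<forall>\<^sub>F t in at_top. exp (- (1 / (t - 1))) = flat 1 (t - 1)"
    using eventually_gt_at_top[of 1] by eventually_elim (simp add: flat_def)
  ultimately show ?thesis by (rule Lim_transform_eventually)
qed

lemma continuous_flat: "continuous_on A (flat p)"
  using flat_has_derivative by (meson DERIV_isCont continuous_at_imp_continuous_on)

lemma AE_ball_interior: "AE x in (ball_measure :: (real^'n) measure). norm x < 1"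
proof (rule AE_I')
  show "sphere 0 1 \<in> null_sets (ball_measure :: (real^'n) measure)"
    by (subst null_sets_restrict_space) (auto simp: negligible_sphere negligible_iff_null_sets[symmetric])
qed auto

text \<open>
  In the open ball the argument \<open>(k + 1) (1 - |x|\<^sup>2)\<close> tends to infinity, and the sphere is a null set.
\<close>

lemma cutoff_limit:
  fixes F :: "real^'n \<Rightarrow> real" and \<theta> :: "real \<Rightarrow> real"
  assumes F: "integrable ball_measure F" and \<theta>: "continuous_on UNIV \<theta>" "\<And>t. \<bar>\<theta> t\<bar> \<le> C" "(\<theta> \<longlongrightarrow> L) at_top"
  shows "(\<lambda>k. LINT x|ball_measure. F x * \<theta> (real (Suc k) * (1 - (norm x)\<^sup>2))) \<longlonglongrightarrow> (LINT x|ball_measure. F x * L)"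
proof (rule integral_dominated_convergence[where w = "\<lambda>x. C * \<bar>F x\<bar>"])
  show "integrable ball_measure (\<lambda>x. C * \<bar>F x\<bar>)" using F by simp
  show "(\<lambda>x. F x * \<theta> (real (Suc k) * (1 - (norm x)\<^sup>2))) \<in> borel_measurable ball_measure" for k
  proof (intro borel_measurable_times borel_measurable_integrable[OF F] continuous_ball_measurable)
    show "continuous_on UNIV (\<lambda>x. \<theta> (real (Suc k) * (1 - (norm (x::real^'n))\<^sup>2)))"
      by (rule continuous_on_compose2[OF \<theta>(1) smooth_continuous subset_UNIV]) (intro smooth_intros)
  qed
  show "AE x in ball_measure. (\<lambda>k. F x * \<theta> (real (Suc k) * (1 - (norm x)\<^sup>2))) \<longlonglongrightarrow> F x * L"
    using AE_ball_interior
  proof eventually_elim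
    case (elim x)
    hence "1 - (norm x)\<^sup>2 > 0" by (simp add: power_less_one_iff)
    hence "filterlim (\<lambda>k. (1 - (norm x)\<^sup>2) * real (Suc k)) at_top sequentially"
      by (intro filterlim_tendsto_pos_mult_at_top[OF tendsto_const]
          filterlim_compose[OF filterlim_real_sequentially filterlim_Suc])
    from filterlim_compose[OF \<theta>(3) this] show ?case
      by (intro tendsto_mult tendsto_const) (simp only: mult.commute)
  qed
  show "AE x in ball_measure. norm (F x * \<theta> (real (Suc k) * (1 - (norm x)\<^sup>2))) \<le> C * \<bar>F x\<bar>" for k
    using mult_left_mono[OF \<theta>(2) abs_ge_zero] by (intro AE_I2) (simp add: abs_mult mult.commute)
qed (use F in simp)

lemma cutoff_tendsto:
  fixes F :: "real^'n \<Rightarrow> real"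
  assumes F: "integrable ball_measure F"
  shows "(\<lambda>k. LINT x|ball_measure. F x * cutoff k x) \<longlonglongrightarrow> (LINT x|ball_measure. F x)"
    and "(\<lambda>k. LINT x|ball_measure. F x * cutoff_slope (real (Suc k) * (1 - (norm x)\<^sup>2))) \<longlonglongrightarrow> 0"
proof -
  have "\<bar>flat 1 (t - 1)\<bar> \<le> 1" for t by (simp add: flat_def)
  moreover have "continuous_on UNIV (\<lambda>t. flat 1 (t - 1))"
    by (intro continuous_on_compose2[OF continuous_flat[of UNIV]] continuous_on_diff continuous_on_id continuous_on_const subset_UNIV)
  ultimately show "(\<lambda>k. LINT x|ball_measure. F x * cutoff k x) \<longlonglongrightarrow> (LINT x|ball_measure. F x)"
    using cutoff_limit[OF F _ _ flat_tendsto_1, of 1] by (simp add: cutoff_def)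
  have "continuous_on UNIV cutoff_slope"
    unfolding cutoff_slope_def[abs_def]
    by (intro continuous_on_mult continuous_on_compose2[OF continuous_flat[of UNIV]] continuous_on_diff continuous_on_id continuous_on_const subset_UNIV)
  from cutoff_limit[OF F this cutoff_slope_bounds(1) cutoff_slope_tendsto_0]
  show "(\<lambda>k. LINT x|ball_measure. F x * cutoff_slope (real (Suc k) * (1 - (norm x)\<^sup>2))) \<longlonglongrightarrow> 0"
    by simp
qed

section \<open>Green's formula\<close>

lemma smooth_sq_integrable_mult:
  fixes P :: "real^'n \<Rightarrow> real"
  assumes "square_integrable ball_measure f" "smooth P"
  shows "integrable ball_measure (\<lambda>x. f x * P x)"
  by (rule integrable_bounded_mult(1)[OF smooth_continuous[OF assms(2)] ball_measure.square_integrable_integrable[OF assms(1)]])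

lemma partial_mult_cutoff:
  fixes P :: "real^'n \<Rightarrow> real"
  assumes P: "smooth P"
  shows "(1 - (norm x)\<^sup>2) * partial i (\<lambda>x. P x * cutoff k x) x =
    (1 - (norm x)\<^sup>2) * partial i P x * cutoff k x - 2 * x $ i * P x * cutoff_slope (real (Suc k) * (1 - (norm x)\<^sup>2))"
proof -
  have "(1 - (norm x)\<^sup>2) * partial i (\<lambda>x. P x * cutoff k x) x =
    (1 - (norm x)\<^sup>2) * partial i P x * cutoff k x + P x * ((1 - (norm x)\<^sup>2) * partial i (cutoff k) x)"
    by (simp add: smooth_partial_mult[OF P test_function_smooth[OF test_function_cutoff]] algebra_simps)
  thus ?thesis unfolding partial_cutoff by (simp add: algebra_simps)
qed

text \<open>
  Integration by parts against \<open>(1 - |x|\<^sup>2) P\<close>, which vanishes on the sphere but is not compactly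
  supported in the open ball. After multiplication by a cut-off, the derivative of the cut-off only occurs
  together with the factor \<open>1 - |x|\<^sup>2\<close> and disappears in the limit.
\<close>

lemma weak_partial_boundary:
  fixes f g P :: "real^'n \<Rightarrow> real"
  assumes f: "square_integrable ball_measure f" and g: "has_weak_partial i f g" and P: "smooth P"
  shows "(LINT x|ball_measure. f x * partial i (\<lambda>x. (1 - (norm x)\<^sup>2) * P x) x) =
    - (LINT x|ball_measure. g x * ((1 - (norm x)\<^sup>2) * P x))"
proof -
  let ?\<psi> = "\<lambda>x::real^'n. 1 - (norm x)\<^sup>2" and ?s = "\<lambda>k x::real^'n. cutoff_slope (real (Suc k) * (1 - (norm x)\<^sup>2))"
  note sb = smooth_bowl and sc = test_function_smooth[OF test_function_cutoff]
  have sg: "square_integrable ball_measure g" using g by (simp add: has_weak_partial_def)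
  have sP: "smooth (\<lambda>x. ?\<psi> x * P x)" by (intro smooth_mult sb P)
  have i1: "integrable ball_measure (\<lambda>x. f x * partial i (\<lambda>x. ?\<psi> x * P x) x)"
    by (rule smooth_sq_integrable_mult[OF f smooth_partial[OF sP]])
  have i2: "integrable ball_measure (\<lambda>x. f x * (- 2 * x $ i * P x))"
    by (rule smooth_sq_integrable_mult[OF f]) (intro smooth_intros P)
  have i3: "integrable ball_measure (\<lambda>x. g x * (?\<psi> x * P x))" by (rule smooth_sq_integrable_mult[OF sg sP])
  have eq: "(LINT x|ball_measure. f x * partial i (\<lambda>x. ?\<psi> x * P x) x * cutoff k x)
      + (LINT x|ball_measure. f x * (- 2 * x $ i * P x) * ?s k x)
      = - (LINT x|ball_measure. g x * (?\<psi> x * P x) * cutoff k x)" for k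
  proof -
    have "test_function (\<lambda>x. (?\<psi> x * P x) * cutoff k x)"
      by (rule test_function_mult(1)[OF sP test_function_cutoff])
    hence h1: "(LINT x|ball_measure. f x * partial i (\<lambda>x. (?\<psi> x * P x) * cutoff k x) x) =
        - (LINT x|ball_measure. g x * ((?\<psi> x * P x) * cutoff k x))"
      using g unfolding has_weak_partial_def by blast
    have h2: "f x * partial i (\<lambda>x. (?\<psi> x * P x) * cutoff k x) x =
      f x * partial i (\<lambda>x. ?\<psi> x * P x) x * cutoff k x + f x * (- 2 * x $ i * P x) * ?s k x" for x
    proof -
      have "partial i (\<lambda>x. (?\<psi> x * P x) * cutoff k x) x =
          partial i (\<lambda>x. ?\<psi> x * P x) x * cutoff k x + P x * (?\<psi> x * partial i (cutoff k) x)"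
        unfolding smooth_partial_mult[OF sP sc] by (simp only: mult_ac)
      from this[unfolded partial_cutoff] show ?thesis by (simp only: distrib_left mult_ac)
    qed
    have h3: "integrable ball_measure (\<lambda>x. f x * partial i (\<lambda>x. ?\<psi> x * P x) x * cutoff k x)"
      by (rule integrable_bounded_mult(1)[OF smooth_continuous[OF sc] i1])
    have h4: "integrable ball_measure (\<lambda>x. f x * (- 2 * x $ i * P x) * ?s k x)"
    proof (rule integrable_bounded_mult(1)[OF _ i2])
      show "continuous_on UNIV (?s k)"
        unfolding cutoff_slope_def
        by (intro continuous_on_mult continuous_on_compose2[OF continuous_flat[of UNIV]] continuous_on_diff
            smooth_continuous[OF sb] continuous_on_const subset_UNIV)
    qed
    have "(LINT x|ball_measure. f x * partial i (\<lambda>x. ?\<psi> x * P x) x * cutoff k x)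
      + (LINT x|ball_measure. f x * (- 2 * x $ i * P x) * ?s k x) =
      (LINT x|ball_measure. f x * partial i (\<lambda>x. (?\<psi> x * P x) * cutoff k x) x)"
      unfolding h2 by (rule Bochner_Integration.integral_add[OF h3 h4, symmetric])
    also have "\<dots> = - (LINT x|ball_measure. g x * ((?\<psi> x * P x) * cutoff k x))" by (rule h1)
    finally show ?thesis by (simp only: mult.assoc)
  qed
  have "(\<lambda>k. (LINT x|ball_measure. f x * partial i (\<lambda>x. ?\<psi> x * P x) x * cutoff k x)
      + (LINT x|ball_measure. f x * (- 2 * x $ i * P x) * ?s k x)) \<longlonglongrightarrow>
      (LINT x|ball_measure. f x * partial i (\<lambda>x. ?\<psi> x * P x) x) + 0"
    by (rule tendsto_add[OF cutoff_tendsto(1)[OF i1] cutoff_tendsto(2)[OF i2]])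
  moreover have "(\<lambda>k. - (LINT x|ball_measure. g x * (?\<psi> x * P x) * cutoff k x)) \<longlonglongrightarrow>
      - (LINT x|ball_measure. g x * (?\<psi> x * P x))"
    by (rule tendsto_minus[OF cutoff_tendsto(1)[OF i3]])
  ultimately show ?thesis unfolding eq by (simp add: LIMSEQ_unique)
qed

text \<open>
  The second identity writes \<open>(1 - |x|\<^sup>2) \<partial>\<^sub>i\<partial>\<^sub>i\<eta>\<close> as a sum of first derivatives of test functions and a term
  of order zero, so that it can be integrated against a function with weak first derivatives.
\<close>

lemma bowl_second_partial:
  fixes \<eta> :: "real^'n \<Rightarrow> real"
  assumes \<eta>: "smooth \<eta>"
  shows "partial i (\<lambda>x. (1 - (norm x)\<^sup>2) * partial i \<eta> x) x =
      (1 - (norm x)\<^sup>2) * partial i (partial i \<eta>) x - 2 * x $ i * partial i \<eta> x"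
    and "(1 - (norm x)\<^sup>2) * partial i (partial i \<eta>) x =
      partial i (\<lambda>x. (1 - (norm x)\<^sup>2) * partial i \<eta> x) x + 2 * partial i (\<lambda>x. x $ i * \<eta> x) x - 2 * \<eta> x"
proof -
  show 1: "partial i (\<lambda>x. (1 - (norm x)\<^sup>2) * partial i \<eta> x) x =
      (1 - (norm x)\<^sup>2) * partial i (partial i \<eta>) x - 2 * x $ i * partial i \<eta> x"
    by (simp add: smooth_partial_mult[OF smooth_bowl smooth_partial[OF \<eta>]] partial_bowl)
  show "(1 - (norm x)\<^sup>2) * partial i (partial i \<eta>) x =
      partial i (\<lambda>x. (1 - (norm x)\<^sup>2) * partial i \<eta> x) x + 2 * partial i (\<lambda>x. x $ i * \<eta> x) x - 2 * \<eta> x"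
    unfolding 1 by (simp add: smooth_partial_mult[OF smooth_coord \<eta>] partial_coord)
qed

text \<open>
  Testing the weak Laplacian with \<open>P \<chi>\<^sub>k\<close> and moving one derivative to \<open>f\<close> in each direction gives, in the
  limit, \<open>\<Sum>\<^sub>i \<integral> (f \<partial>\<^sub>i((1 - |x|\<^sup>2) \<partial>\<^sub>iP) - 2 x\<^sub>i P \<partial>\<^sub>if - 2 f P)\<close>. Expanding the derivative leaves
  \<open>\<integral> f (1 - |x|\<^sup>2) \<Delta>P\<close> and \<open>-2\<close> times the expression that \<open>integral_trace\<close> identifies as the boundary integral.
\<close>

lemma green_formula:
  fixes f P :: "real^'n \<Rightarrow> real"
  assumes f: "f \<in> W12" and tr: "has_trace f g" and P: "smooth P"
    and w: "has_weak_laplacian (\<lambda>x. (1 - (norm x)\<^sup>2) * f x) w"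
  shows "(LINT x|ball_measure. w x * P x) =
    (LINT x|ball_measure. f x * ((1 - (norm x)\<^sup>2) * laplacian P x)) - 2 * (LINT y|sphere_measure. P y * g y)"
proof -
  let ?\<psi> = "\<lambda>x::real^'n. 1 - (norm x)\<^sup>2" and ?s = "\<lambda>k x::real^'n. cutoff_slope (real (Suc k) * (1 - (norm x)\<^sup>2))"
  define G where "G i = weak_partial i f" for i
  note sb = smooth_bowl and tc = test_function_cutoff and sc = test_function_smooth[OF test_function_cutoff]
  have sf: "square_integrable ball_measure f" using f by (simp add: W12_def)
  have G: "has_weak_partial i f (G i)" for i unfolding G_def by (rule W12_weak_partial[OF f])
  have sG: "square_integrable ball_measure (G i)" for i using G by (simp add: has_weak_partial_def)
  have sw: "square_integrable ball_measure w" using w by (simp add: has_weak_laplacian_def)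
  have iw: "integrable ball_measure (\<lambda>x. w x * P x)" by (rule smooth_sq_integrable_mult[OF sw P])
  have a1: "integrable ball_measure (\<lambda>x. G i x * (?\<psi> x * partial i P x))" for i
    by (rule smooth_sq_integrable_mult[OF sG]) (intro smooth_mult sb smooth_partial P)
  have a2: "integrable ball_measure (\<lambda>x. G i x * (x $ i * P x))" for i
    by (rule smooth_sq_integrable_mult[OF sG]) (intro smooth_intros P)
  have a3: "integrable ball_measure (\<lambda>x. f x * P x)" by (rule smooth_sq_integrable_mult[OF sf P])
  have cs: "continuous_on UNIV (?s k)" for k
    unfolding cutoff_slope_def
    by (intro continuous_on_mult continuous_on_compose2[OF continuous_flat[of UNIV]] continuous_on_diff
        smooth_continuous[OF sb] continuous_on_const subset_UNIV)
  note cc = smooth_continuous[OF sc]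
  \<comment> \<open>The identity before the passage to the limit, for one cut-off.\<close>
  have eq: "(LINT x|ball_measure. w x * P x * cutoff k x) =
    (\<Sum>i\<in>UNIV. - (LINT x|ball_measure. G i x * (?\<psi> x * partial i P x) * cutoff k x)
      + 2 * (LINT x|ball_measure. G i x * (x $ i * P x) * ?s k x)
      - 2 * (LINT x|ball_measure. G i x * (x $ i * P x) * cutoff k x)
      - 2 * (LINT x|ball_measure. f x * P x * cutoff k x))" for k
  proof -
    define \<eta> where "\<eta> x = P x * cutoff k x" for x
    have t\<eta>: "test_function \<eta>" unfolding \<eta>_def[abs_def] by (rule test_function_mult(1)[OF P tc])
    note s\<eta> = test_function_smooth[OF t\<eta>]
    have T1: "test_function (\<lambda>x. ?\<psi> x * partial i \<eta> x)" for i
      by (rule test_function_mult(1)[OF sb test_function_partial[OF t\<eta>]])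
    have T2: "test_function (\<lambda>x. x $ i * \<eta> x)" for i by (rule test_function_mult(1)[OF smooth_coord t\<eta>])
    have i0: "integrable ball_measure (\<lambda>x. f x * (?\<psi> x * partial i (partial i \<eta>) x))" for i
      by (rule smooth_sq_integrable_mult[OF sf]) (intro smooth_mult sb smooth_partial s\<eta>)
    have i1: "integrable ball_measure (\<lambda>x. f x * partial i (\<lambda>x. ?\<psi> x * partial i \<eta> x) x)" for i
      by (rule smooth_sq_integrable_mult[OF sf smooth_partial[OF test_function_smooth[OF T1]]])
    have i2: "integrable ball_measure (\<lambda>x. f x * partial i (\<lambda>x. x $ i * \<eta> x) x)" for i
      by (rule smooth_sq_integrable_mult[OF sf smooth_partial[OF test_function_smooth[OF T2]]])
    have i3: "integrable ball_measure (\<lambda>x. f x * \<eta> x)"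
      by (rule smooth_sq_integrable_mult[OF sf s\<eta>])
    have summand: "(LINT x|ball_measure. f x * (?\<psi> x * partial i (partial i \<eta>) x)) =
      - (LINT x|ball_measure. G i x * (?\<psi> x * partial i P x) * cutoff k x)
      + 2 * (LINT x|ball_measure. G i x * (x $ i * P x) * ?s k x)
      - 2 * (LINT x|ball_measure. G i x * (x $ i * P x) * cutoff k x)
      - 2 * (LINT x|ball_measure. f x * P x * cutoff k x)" for i
    proof -
      have "(LINT x|ball_measure. f x * (?\<psi> x * partial i (partial i \<eta>) x)) =
        (LINT x|ball_measure. f x * partial i (\<lambda>x. ?\<psi> x * partial i \<eta> x) x
          + 2 * (f x * partial i (\<lambda>x. x $ i * \<eta> x) x) - 2 * (f x * \<eta> x))"
        unfolding bowl_second_partial(2)[OF s\<eta>] by (intro Bochner_Integration.integral_cong) (simp_all add: algebra_simps)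
      also have "\<dots> = (LINT x|ball_measure. f x * partial i (\<lambda>x. ?\<psi> x * partial i \<eta> x) x)
          + 2 * (LINT x|ball_measure. f x * partial i (\<lambda>x. x $ i * \<eta> x) x) - 2 * (LINT x|ball_measure. f x * \<eta> x)"
        using i1 i2 i3 by simp
      also have "(LINT x|ball_measure. f x * partial i (\<lambda>x. ?\<psi> x * partial i \<eta> x) x) =
          - (LINT x|ball_measure. G i x * (?\<psi> x * partial i \<eta> x))"
        using G[of i] T1[of i] unfolding has_weak_partial_def by blast
      also have "(LINT x|ball_measure. G i x * (?\<psi> x * partial i \<eta> x)) =
          (LINT x|ball_measure. G i x * (?\<psi> x * partial i P x) * cutoff k x - 2 * (G i x * (x $ i * P x) * ?s k x))"
        unfolding \<eta>_def partial_mult_cutoff[OF P]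
        by (intro Bochner_Integration.integral_cong) (simp_all add: algebra_simps)
      also have "\<dots> = (LINT x|ball_measure. G i x * (?\<psi> x * partial i P x) * cutoff k x)
          - 2 * (LINT x|ball_measure. G i x * (x $ i * P x) * ?s k x)"
        using integrable_bounded_mult(1)[OF cc a1[of i], of k] integrable_bounded_mult(1)[OF cs a2[of i], of k] by simp
      also have "(LINT x|ball_measure. f x * partial i (\<lambda>x. x $ i * \<eta> x) x) = - (LINT x|ball_measure. G i x * (x $ i * \<eta> x))"
        using G[of i] T2[of i] unfolding has_weak_partial_def by blast
      finally show ?thesis by (simp add: \<eta>_def[abs_def] mult.assoc)
    qed
    have "(LINT x|ball_measure. w x * P x * cutoff k x) = (LINT x|ball_measure. w x * \<eta> x)"
      by (simp add: \<eta>_def mult.assoc)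
    also have "\<dots> = (LINT x|ball_measure. ?\<psi> x * f x * laplacian \<eta> x)"
      using w t\<eta> unfolding has_weak_laplacian_def by simp
    also have "\<dots> = (LINT x|ball_measure. (\<Sum>i\<in>UNIV. f x * (?\<psi> x * partial i (partial i \<eta>) x)))"
      by (simp add: laplacian_def sum_distrib_left mult_ac)
    also have "\<dots> = (\<Sum>i\<in>UNIV. LINT x|ball_measure. f x * (?\<psi> x * partial i (partial i \<eta>) x))"
      by (rule Bochner_Integration.integral_sum) (rule i0)
    finally show ?thesis unfolding summand .
  qed
  have "(\<lambda>k. \<Sum>i\<in>UNIV. - (LINT x|ball_measure. G i x * (?\<psi> x * partial i P x) * cutoff k x)
      + 2 * (LINT x|ball_measure. G i x * (x $ i * P x) * ?s k x)
      - 2 * (LINT x|ball_measure. G i x * (x $ i * P x) * cutoff k x)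
      - 2 * (LINT x|ball_measure. f x * P x * cutoff k x)) \<longlonglongrightarrow>
    (\<Sum>i\<in>UNIV. - (LINT x|ball_measure. G i x * (?\<psi> x * partial i P x)) + 2 * 0
      - 2 * (LINT x|ball_measure. G i x * (x $ i * P x)) - 2 * (LINT x|ball_measure. f x * P x))"
    by (intro tendsto_sum tendsto_add tendsto_diff tendsto_minus tendsto_mult tendsto_const
        cutoff_tendsto(1)[OF a1] cutoff_tendsto(1)[OF a2] cutoff_tendsto(1)[OF a3] cutoff_tendsto(2)[OF a2])
  with cutoff_tendsto(1)[OF iw] have "(LINT x|ball_measure. w x * P x) =
    (\<Sum>i\<in>UNIV. - (LINT x|ball_measure. G i x * (?\<psi> x * partial i P x)) + 2 * 0
      - 2 * (LINT x|ball_measure. G i x * (x $ i * P x)) - 2 * (LINT x|ball_measure. f x * P x))"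
    unfolding eq by (rule LIMSEQ_unique)
  also have "\<dots> = (\<Sum>i\<in>UNIV. (LINT x|ball_measure. f x * (?\<psi> x * partial i (partial i P) x))
      - 2 * (LINT x|ball_measure. f x * (x $ i * partial i P x))
      - 2 * (LINT x|ball_measure. G i x * (x $ i * P x)) - 2 * (LINT x|ball_measure. f x * P x))"
  proof (rule sum.cong[OF refl])
    fix i
    have j: "integrable ball_measure (\<lambda>x. f x * (?\<psi> x * partial i (partial i P) x))"
      "integrable ball_measure (\<lambda>x. f x * (x $ i * partial i P x))"
      by (rule smooth_sq_integrable_mult[OF sf]; intro smooth_mult sb smooth_partial smooth_coord P)+
    have "- (LINT x|ball_measure. G i x * (?\<psi> x * partial i P x)) =
      (LINT x|ball_measure. f x * partial i (\<lambda>x. ?\<psi> x * partial i P x) x)"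
      using weak_partial_boundary[OF sf G smooth_partial[OF P], of i] by simp
    also have "\<dots> = (LINT x|ball_measure. f x * (?\<psi> x * partial i (partial i P) x) - 2 * (f x * (x $ i * partial i P x)))"
      unfolding bowl_second_partial(1)[OF P] by (intro Bochner_Integration.integral_cong) (simp_all add: algebra_simps)
    also have "\<dots> = (LINT x|ball_measure. f x * (?\<psi> x * partial i (partial i P) x))
      - 2 * (LINT x|ball_measure. f x * (x $ i * partial i P x))"
      using j by simp
    finally show "- (LINT x|ball_measure. G i x * (?\<psi> x * partial i P x)) + 2 * 0
      - 2 * (LINT x|ball_measure. G i x * (x $ i * P x)) - 2 * (LINT x|ball_measure. f x * P x) =
      (LINT x|ball_measure. f x * (?\<psi> x * partial i (partial i P) x))
      - 2 * (LINT x|ball_measure. f x * (x $ i * partial i P x))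
      - 2 * (LINT x|ball_measure. G i x * (x $ i * P x)) - 2 * (LINT x|ball_measure. f x * P x)" by simp
  qed
  also have "\<dots> = (\<Sum>i\<in>UNIV. LINT x|ball_measure. f x * (?\<psi> x * partial i (partial i P) x))
      - 2 * (\<Sum>i\<in>UNIV. LINT x|ball_measure. f x * (x $ i * partial i P x))
      - 2 * (\<Sum>i\<in>UNIV. LINT x|ball_measure. G i x * (x $ i * P x)) - 2 * (CARD('n) * (LINT x|ball_measure. f x * P x))"
    by (simp add: sum_subtractf sum_distrib_left)
  also have "(\<Sum>i\<in>UNIV. LINT x|ball_measure. f x * (?\<psi> x * partial i (partial i P) x)) =
      (LINT x|ball_measure. f x * (?\<psi> x * laplacian P x))"
  proof -
    have "(\<Sum>i\<in>UNIV. LINT x|ball_measure. f x * (?\<psi> x * partial i (partial i P) x)) =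
      (LINT x|ball_measure. (\<Sum>i\<in>UNIV. f x * (?\<psi> x * partial i (partial i P) x)))"
      by (rule Bochner_Integration.integral_sum[symmetric], rule smooth_sq_integrable_mult[OF sf])
         (intro smooth_mult sb smooth_partial P)
    thus ?thesis by (simp add: laplacian_def sum_distrib_left)
  qed
  also have "(\<Sum>i\<in>UNIV. LINT x|ball_measure. f x * (x $ i * partial i P x)) = (LINT x|ball_measure. radial P x * f x)"
  proof -
    have "(\<Sum>i\<in>UNIV. LINT x|ball_measure. f x * (x $ i * partial i P x)) =
      (LINT x|ball_measure. (\<Sum>i\<in>UNIV. f x * (x $ i * partial i P x)))"
      by (rule Bochner_Integration.integral_sum[symmetric], rule smooth_sq_integrable_mult[OF sf])
         (intro smooth_mult smooth_coord smooth_partial P)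
    thus ?thesis by (simp add: radial_def sum_distrib_left sum_distrib_right mult.commute)
  qed
  finally have "(LINT x|ball_measure. w x * P x) = (LINT x|ball_measure. f x * (?\<psi> x * laplacian P x))
    - 2 * ((LINT x|ball_measure. radial P x * f x) + (\<Sum>i\<in>UNIV. LINT x|ball_measure. G i x * (x $ i * P x))
      + CARD('n) * (LINT x|ball_measure. f x * P x))" by (simp add: algebra_simps)
  moreover have "C_k 1 P" using P unfolding smooth_def by blast
  hence "(LINT y|sphere_measure. P y * g y) =
    (LINT x|ball_measure. radial P x * f x) + (\<Sum>i\<in>UNIV. LINT x|ball_measure. G i x * (x $ i * P x))
      + CARD('n) * (LINT x|ball_measure. f x * P x)"
  proof -
    have "CARD('n) * P x * f x = CARD('n) * (f x * P x)" "P x * x $ i * weak_partial i f x = weak_partial i f x * (x $ i * P x)" for x i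
      by (simp_all add: mult_ac)
    with integral_trace[OF f tr \<open>C_k 1 P\<close>] show ?thesis by (simp add: G_def)
  qed
  ultimately show ?thesis by simp
qed

section \<open>Weak Laplacians\<close>

lemma has_weak_laplacian_classical:
  fixes U :: "real^'n \<Rightarrow> real"
  assumes U: "smooth U"
  shows "has_weak_laplacian U (laplacian U)"
  unfolding has_weak_laplacian_def
proof (intro conjI allI impI)
  show "square_integrable ball_measure (laplacian U)"
    by (rule square_integrable_continuous_ball[OF smooth_continuous[OF smooth_laplacian[OF U]]])
  fix \<phi> :: "real^'n \<Rightarrow> real" assume \<phi>: "test_function \<phi>"
  note s\<phi> = test_function_smooth[OF \<phi>]
  note icb = integrable_continuous_ball[OF smooth_continuous]
  have i: "integrable ball_measure (\<lambda>x. U x * partial i (partial i \<phi>) x)"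
     "integrable ball_measure (\<lambda>x. partial i (partial i U) x * \<phi> x)" for i
    by (intro icb smooth_mult smooth_partial U s\<phi>)+
  have "(LINT x|ball_measure. U x * partial i (partial i \<phi>) x) = (LINT x|ball_measure. partial i (partial i U) x * \<phi> x)" for i
  proof -
    have "0 = (LINT x|ball_measure. partial i (\<lambda>x. U x * partial i \<phi> x) x)"
      by (rule integral_partial_test_function[symmetric, OF test_function_mult(1)[OF U test_function_partial[OF \<phi>]]])
    also have "\<dots> = (LINT x|ball_measure. partial i U x * partial i \<phi> x + U x * partial i (partial i \<phi>) x)"
      by (simp add: smooth_partial_mult[OF U smooth_partial[OF s\<phi>]])
    also have "\<dots> = (LINT x|ball_measure. partial i U x * partial i \<phi> x) + (LINT x|ball_measure. U x * partial i (partial i \<phi>) x)"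
      by (intro Bochner_Integration.integral_add i icb smooth_mult smooth_partial U s\<phi>)
    finally have 1: "(LINT x|ball_measure. U x * partial i (partial i \<phi>) x) = - (LINT x|ball_measure. partial i U x * partial i \<phi> x)"
      by simp
    have "0 = (LINT x|ball_measure. partial i (\<lambda>x. partial i U x * \<phi> x) x)"
      by (rule integral_partial_test_function[symmetric, OF test_function_mult(1)[OF smooth_partial[OF U] \<phi>]])
    also have "\<dots> = (LINT x|ball_measure. partial i (partial i U) x * \<phi> x + partial i U x * partial i \<phi> x)"
      by (simp add: smooth_partial_mult[OF smooth_partial[OF U] s\<phi>])
    also have "\<dots> = (LINT x|ball_measure. partial i (partial i U) x * \<phi> x) + (LINT x|ball_measure. partial i U x * partial i \<phi> x)"
      by (intro Bochner_Integration.integral_add i icb smooth_mult smooth_partial U s\<phi>)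
    finally show ?thesis using 1 by simp
  qed
  thus "(LINT x|ball_measure. U x * laplacian \<phi> x) = (LINT x|ball_measure. laplacian U x * \<phi> x)"
    using i by (simp add: laplacian_def sum_distrib_left sum_distrib_right)
qed

lemma weak_laplacian_AE_unique:
  fixes u :: "real^'n \<Rightarrow> real"
  assumes v: "has_weak_laplacian u v" and w: "has_weak_laplacian u w"
  shows "AE x in ball_measure. v x = w x"
proof -
  have s: "square_integrable ball_measure v" "square_integrable ball_measure w"
    using v w by (auto simp: has_weak_laplacian_def)
  have "AE x in ball_measure. v x - w x = 0"
  proof (rule AE_zero_if_orthogonal_to_test_functions[OF square_integrable_diff[OF s]])
    fix \<phi> :: "real^'n \<Rightarrow> real" assume \<phi>: "test_function \<phi>"
    note i = smooth_sq_integrable_mult[OF s(1) test_function_smooth[OF \<phi>]]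
      smooth_sq_integrable_mult[OF s(2) test_function_smooth[OF \<phi>]]
    have "(LINT x|ball_measure. v x * \<phi> x) = (LINT x|ball_measure. w x * \<phi> x)"
      using v w \<phi> unfolding has_weak_laplacian_def by metis
    thus "(LINT x|ball_measure. (v x - w x) * \<phi> x) = 0"
      using i by (simp add: left_diff_distrib)
  qed
  thus ?thesis by simp
qed

lemma weak_laplacian_works:
  "has_weak_laplacian u w \<Longrightarrow> has_weak_laplacian u (weak_laplacian u)"
  unfolding weak_laplacian_def by (rule someI[of "has_weak_laplacian u"])

text \<open>
  The weak Laplacian chosen for \<open>(1 - |x|\<^sup>2) Q\<close> agrees almost everywhere with the classical one, which is
  smooth; so it can take the role of the test function in Green's formula for \<open>f\<close>.
\<close>

lemma inner_Delta_smooth: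
  fixes f Q :: "real^'n \<Rightarrow> real"
  assumes f: "f \<in> H2" and Q: "smooth Q"
  defines "P \<equiv> laplacian (\<lambda>x. (1 - (norm x)\<^sup>2) * Q x)"
  shows "inner_Delta f Q = 1 / (4 * (real CARD('n))\<^sup>2 * measure lebesgue (cball 0 1 :: (real^'n) set)) *
    ((LINT x|ball_measure. f x * ((1 - (norm x)\<^sup>2) * laplacian P x))
      - 2 * (LINT y|sphere_measure. P y * sobolev_trace f y))"
proof -
  let ?U = "\<lambda>x. (1 - (norm x)\<^sup>2) * Q x" and ?u = "\<lambda>x. (1 - (norm x)\<^sup>2) * f x"
  have W: "f \<in> W12" and "\<exists>w. has_weak_laplacian ?u w" using f by (auto simp: H2_def)
  hence w: "has_weak_laplacian ?u (weak_laplacian ?u)" using weak_laplacian_works by blast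
  have sU: "smooth ?U" by (intro smooth_mult smooth_bowl Q)
  have sP: "smooth P" unfolding P_def by (rule smooth_laplacian[OF sU])
  have U: "has_weak_laplacian ?U P" unfolding P_def by (rule has_weak_laplacian_classical[OF sU])
  have "AE x in ball_measure. weak_laplacian ?U x = P x"
    by (rule weak_laplacian_AE_unique[OF weak_laplacian_works[OF U] U])
  hence "(LINT x|ball_measure. weak_laplacian ?u x * weak_laplacian ?U x) = (LINT x|ball_measure. weak_laplacian ?u x * P x)"
    using w weak_laplacian_works[OF U] U unfolding has_weak_laplacian_def square_integrable_def
    by (intro integral_cong_AE borel_measurable_times) auto
  also have "\<dots> = (LINT x|ball_measure. f x * ((1 - (norm x)\<^sup>2) * laplacian P x))
      - 2 * (LINT y|sphere_measure. P y * sobolev_trace f y)"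
    by (rule green_formula[OF W sobolev_trace_exists[OF W] sP w])
  finally show ?thesis unfolding inner_Delta_def by simp
qed

section \<open>Jacobi polynomials\<close>

definition jacobi_weight :: "real \<Rightarrow> real \<Rightarrow> real \<Rightarrow> real"
  where "jacobi_weight \<alpha> \<beta> s = (1 - s) powr \<alpha> * (1 + s) powr \<beta>"

definition jacobi_integral :: "real \<Rightarrow> real \<Rightarrow> (real \<Rightarrow> real) \<Rightarrow> real"
  where "jacobi_integral \<alpha> \<beta> h = (LINT s:{-1..1}|lborel. h s * jacobi_weight \<alpha> \<beta> s)"

text \<open>
  The weight is the integrand of the Beta function, transported from \<open>[0, 1]\<close> to \<open>[-1, 1]\<close>.
\<close>

lemma jacobi_weight_integrable:
  assumes "\<alpha> > -1" "\<beta> > -1"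
  shows "set_integrable lborel {-1..1} (jacobi_weight \<alpha> \<beta>)"
proof -
  have "set_integrable lborel {0..1} (\<lambda>t. t powr ((\<beta> + 1) - 1) * (1 - t) powr ((\<alpha> + 1) - 1))"
    using assms by (intro integrable_Beta) auto
  hence "integrable lborel (\<lambda>t. indicator {0..1} t * (t powr \<beta> * (1 - t) powr \<alpha>))"
    by (simp add: set_integrable_def)
  from lborel_integrable_real_affine[OF this, of "1 / 2" "1 / 2"]
  have "integrable lborel (\<lambda>x. indicator {0..1} (1 / 2 + 1 / 2 * x) *
      ((1 / 2 + 1 / 2 * x) powr \<beta> * (1 - (1 / 2 + 1 / 2 * x)) powr \<alpha>))" by simp
  hence A: "integrable lborel (\<lambda>x. 2 powr \<alpha> * 2 powr \<beta> * (indicator {0..1} (1 / 2 + 1 / 2 * x) *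
      ((1 / 2 + 1 / 2 * x) powr \<beta> * (1 - (1 / 2 + 1 / 2 * x)) powr \<alpha>)))"
    by (rule integrable_mult_right)
  have B: "2 powr \<alpha> * 2 powr \<beta> * (indicator {0..1} (1 / 2 + 1 / 2 * x) *
      ((1 / 2 + 1 / 2 * x) powr \<beta> * (1 - (1 / 2 + 1 / 2 * x)) powr \<alpha>)) =
      indicator {-1..1} x *\<^sub>R jacobi_weight \<alpha> \<beta> x" for x :: real
  proof (cases "x \<in> {-1..1}")
    case True
    have "2 powr \<beta> * (1 / 2 + 1 / 2 * x) powr \<beta> = (2 * (1 / 2 + 1 / 2 * x)) powr \<beta>"
      by (rule powr_mult[symmetric])
    moreover have "2 powr \<alpha> * (1 - (1 / 2 + 1 / 2 * x)) powr \<alpha> = (2 * (1 - (1 / 2 + 1 / 2 * x))) powr \<alpha>"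
      by (rule powr_mult[symmetric])
    moreover have "2 * (1 / 2 + 1 / 2 * x) = 1 + x" "2 * (1 - (1 / 2 + 1 / 2 * x)) = 1 - x" by simp_all
    ultimately have "2 powr \<beta> * (1 / 2 + 1 / 2 * x) powr \<beta> = (1 + x) powr \<beta>"
        "2 powr \<alpha> * (1 - (1 / 2 + 1 / 2 * x)) powr \<alpha> = (1 - x) powr \<alpha>" by (simp_all only:)
    moreover have "2 powr \<alpha> * 2 powr \<beta> * ((1 / 2 + 1 / 2 * x) powr \<beta> * (1 - (1 / 2 + 1 / 2 * x)) powr \<alpha>) =
      (2 powr \<alpha> * (1 - (1 / 2 + 1 / 2 * x)) powr \<alpha>) * (2 powr \<beta> * (1 / 2 + 1 / 2 * x) powr \<beta>)"
      by (simp only: mult_ac)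
    moreover have "indicator {0..1} (1 / 2 + 1 / 2 * x) = (1::real)" using True by (simp add: indicator_def)
    ultimately show ?thesis using True by (simp only: jacobi_weight_def) simp
  next
    case False
    hence "indicator {0..1} (1 / 2 + 1 / 2 * x) = (0::real)" by (auto simp: indicator_def)
    thus ?thesis using False by simp
  qed
  show ?thesis using A unfolding B set_integrable_def .
qed

lemma jacobi_integrable:
  assumes "\<alpha> > -1" "\<beta> > -1" "continuous_on UNIV h"
  shows "set_integrable lborel {-1..1} (\<lambda>s. h s * jacobi_weight \<alpha> \<beta> s)"
proof -
  have "compact (h ` {-1..1})"
    by (rule compact_continuous_image[OF continuous_on_subset[OF assms(3)]]) auto
  hence "bounded (h ` {-1..1})" by (rule compact_imp_bounded)
  then obtain C where "\<forall>y\<in>h ` {-1..1}. norm y \<le> C" unfolding bounded_iff by blast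
  hence C: "\<And>s. s \<in> {-1..1} \<Longrightarrow> \<bar>h s\<bar> \<le> C" by simp
  note i = jacobi_weight_integrable[OF assms(1,2), unfolded set_integrable_def]
  have hm: "h \<in> borel_measurable borel" by (rule borel_measurable_continuous_onI[OF assms(3)])
  have "integrable lborel (\<lambda>s. C * (indicator {-1..1} s *\<^sub>R jacobi_weight \<alpha> \<beta> s))"
    by (rule integrable_mult_right) (use i in simp)
  hence "integrable lborel (\<lambda>s. h s * (indicator {-1..1} s *\<^sub>R jacobi_weight \<alpha> \<beta> s))"
  proof (rule Bochner_Integration.integrable_bound)
    show "(\<lambda>s. h s * (indicator {-1..1} s *\<^sub>R jacobi_weight \<alpha> \<beta> s)) \<in> borel_measurable lborel"
      using hm borel_measurable_integrable[OF i] by (intro borel_measurable_times) auto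
    show "AE s in lborel. norm (h s * (indicator {-1..1} s *\<^sub>R jacobi_weight \<alpha> \<beta> s)) \<le>
        norm (C * (indicator {-1..1} s *\<^sub>R jacobi_weight \<alpha> \<beta> s))"
    proof (rule AE_I2)
      fix s
      show "norm (h s * (indicator {-1..1} s *\<^sub>R jacobi_weight \<alpha> \<beta> s)) \<le>
        norm (C * (indicator {-1..1} s *\<^sub>R jacobi_weight \<alpha> \<beta> s))"
      proof (cases "s \<in> {-1..1}")
        case True
        with C[OF True] have "\<bar>h s\<bar> \<le> \<bar>C\<bar>" by linarith
        with True show ?thesis by (simp add: abs_mult mult_right_mono)
      qed simp
    qed
  qed
  thus ?thesis unfolding set_integrable_def by (simp add: mult.left_commute)
qed

lemma jacobi_integral_add:
  assumes "\<alpha> > -1" "\<beta> > -1" "continuous_on UNIV h" "continuous_on UNIV g"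
  shows "jacobi_integral \<alpha> \<beta> (\<lambda>s. h s + g s) = jacobi_integral \<alpha> \<beta> h + jacobi_integral \<alpha> \<beta> g"
  unfolding jacobi_integral_def distrib_right
  by (rule set_integral_add(2)) (intro jacobi_integrable assms)+

lemma jacobi_integral_cmult:
  "jacobi_integral \<alpha> \<beta> (\<lambda>s. c * h s) = c * jacobi_integral \<alpha> \<beta> h"
  unfolding jacobi_integral_def mult.assoc by (rule set_integral_mult_right)

lemma jacobi_integral_sum:
  assumes "\<alpha> > -1" "\<beta> > -1" "\<And>i. i \<in> A \<Longrightarrow> continuous_on UNIV (h i)"
  shows "jacobi_integral \<alpha> \<beta> (\<lambda>s. \<Sum>i\<in>A. h i s) = (\<Sum>i\<in>A. jacobi_integral \<alpha> \<beta> (h i))"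
  using assms(3)
proof (induction A rule: infinite_finite_induct)
  case (insert a A)
  have "jacobi_integral \<alpha> \<beta> (\<lambda>s. h a s + (\<Sum>i\<in>A. h i s)) =
      jacobi_integral \<alpha> \<beta> (h a) + jacobi_integral \<alpha> \<beta> (\<lambda>s. \<Sum>i\<in>A. h i s)"
    by (intro jacobi_integral_add assms(1,2) continuous_on_sum insert.prems) auto
  with insert show ?case by simp
qed (simp_all add: jacobi_integral_def)

definition jacobi_moment :: "real \<Rightarrow> real \<Rightarrow> nat \<Rightarrow> real"
  where "jacobi_moment \<alpha> \<beta> n = jacobi_integral \<alpha> \<beta> (\<lambda>s. ((1 - s) / 2) ^ n)"

text \<open>
  Integrate the derivative of \<open>(1 - s)\<^bsup>n+\<alpha>+1\<^esup> (1 + s)\<^bsup>\<beta>+1\<^esup>\<close>, which vanishes at both ends of the interval.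
\<close>

lemma jacobi_moment_Suc:
  assumes ab: "\<alpha> > -1" "\<beta> > -1"
  shows "(real n + \<alpha> + \<beta> + 2) * jacobi_moment \<alpha> \<beta> (Suc n) = (real n + \<alpha> + 1) * jacobi_moment \<alpha> \<beta> n"
proof -
  let ?F = "\<lambda>s. (1 - s) powr (real n + \<alpha> + 1) * (1 + s) powr (\<beta> + 1)"
  define h where "h s = (real n + \<alpha> + \<beta> + 2) * (1 - s) ^ Suc n + - 2 * (real n + \<alpha> + 1) * (1 - s) ^ n" for s
  have hc: "continuous_on UNIV h"
    unfolding h_def[abs_def]
    by (intro continuous_on_add continuous_on_mult continuous_on_const continuous_on_power continuous_on_diff continuous_on_id)
  have "((\<lambda>s. h s * jacobi_weight \<alpha> \<beta> s) has_integral (?F 1 - ?F (- 1))) {-1..1}"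
  proof (rule fundamental_theorem_of_calculus_interior)
    show "continuous_on {-1..1} ?F"
      using ab by (intro continuous_on_mult continuous_on_powr' continuous_on_diff continuous_on_add continuous_on_const continuous_on_id) auto
    fix s :: real assume s: "s \<in> {-1<..<1}"
    define u where "u = 1 - s"
    define v where "v = 1 + s"
    have uv: "u > 0" "v > 0" "v = 2 - u" using s by (auto simp: u_def v_def)
    have "(?F has_real_derivative
        - ((real n + \<alpha> + 1) * u powr (real n + \<alpha>)) * v powr (\<beta> + 1) + u powr (real n + \<alpha> + 1) * ((\<beta> + 1) * v powr \<beta>)) (at s)"
      using s by (auto intro!: derivative_eq_intros simp: u_def v_def)
    also have "u powr (real n + \<alpha>) = u ^ n * u powr \<alpha>" using uv by (simp add: powr_add powr_realpow)
    also have "u powr (real n + \<alpha> + 1) = u * (u ^ n * u powr \<alpha>)" using uv by (simp add: powr_add powr_realpow)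
    also have "v powr (\<beta> + 1) = (2 - u) * v powr \<beta>" using uv by (simp add: powr_add)
    also have "- ((real n + \<alpha> + 1) * (u ^ n * u powr \<alpha>)) * ((2 - u) * v powr \<beta>) + u * (u ^ n * u powr \<alpha>) * ((\<beta> + 1) * v powr \<beta>) =
      ((real n + \<alpha> + \<beta> + 2) * u ^ Suc n + - 2 * (real n + \<alpha> + 1) * u ^ n) * (u powr \<alpha> * v powr \<beta>)"
      by (simp add: algebra_simps)
    finally show "(?F has_vector_derivative h s * jacobi_weight \<alpha> \<beta> s) (at s)"
      by (simp add: has_real_derivative_iff_has_vector_derivative h_def jacobi_weight_def u_def v_def)
  qed simp
  hence "integral {-1..1} (\<lambda>s. h s * jacobi_weight \<alpha> \<beta> s) = 0"
    using ab by (simp add: integral_unique)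
  hence "jacobi_integral \<alpha> \<beta> h = 0"
    using set_borel_integral_eq_integral(2)[OF jacobi_integrable[OF ab hc]] by (simp add: jacobi_integral_def)
  moreover have "h s = 2 ^ Suc n * ((real n + \<alpha> + \<beta> + 2) * ((1 - s) / 2) ^ Suc n + - (real n + \<alpha> + 1) * ((1 - s) / 2) ^ n)" for s
  proof -
    have e: "2 ^ m * ((1 - s) / 2) ^ m = (1 - s) ^ m" for m by (simp add: power_divide)
    have "2 ^ Suc n * (A * X + - B * Z) = A * (2 ^ Suc n * X) + - 2 * B * (2 ^ n * Z)" for A B X Z :: real
      by (simp add: algebra_simps)
    thus ?thesis unfolding h_def by (simp only: e)
  qed
  hence "h = (\<lambda>s. 2 ^ Suc n * ((real n + \<alpha> + \<beta> + 2) * ((1 - s) / 2) ^ Suc n + - (real n + \<alpha> + 1) * ((1 - s) / 2) ^ n))" by blast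
  ultimately have "2 ^ Suc n * jacobi_integral \<alpha> \<beta> (\<lambda>s. (real n + \<alpha> + \<beta> + 2) * ((1 - s) / 2) ^ Suc n + - (real n + \<alpha> + 1) * ((1 - s) / 2) ^ n) = 0"
    by (simp only: jacobi_integral_cmult)
  moreover have "jacobi_integral \<alpha> \<beta> (\<lambda>s. (real n + \<alpha> + \<beta> + 2) * ((1 - s) / 2) ^ Suc n + - (real n + \<alpha> + 1) * ((1 - s) / 2) ^ n) =
      (real n + \<alpha> + \<beta> + 2) * jacobi_moment \<alpha> \<beta> (Suc n) + - (real n + \<alpha> + 1) * jacobi_moment \<alpha> \<beta> n"
  proof -
    have c: "continuous_on UNIV (\<lambda>s::real. c * ((1 - s) / 2) ^ m)" for c m
      unfolding divide_inverse by (intro continuous_on_mult continuous_on_const continuous_on_power continuous_on_diff continuous_on_id)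
    show ?thesis unfolding jacobi_integral_add[OF ab c c] jacobi_integral_cmult jacobi_moment_def ..
  qed
  ultimately have "(real n + \<alpha> + \<beta> + 2) * jacobi_moment \<alpha> \<beta> (Suc n) + - (real n + \<alpha> + 1) * jacobi_moment \<alpha> \<beta> n = 0"
    by (simp only: mult_eq_0_iff) simp
  thus ?thesis by algebra
qed

text \<open>
  The coefficients of the Jacobi polynomial in powers of \<open>(1 - s) / 2\<close>: the terminating hypergeometric
  series, in the form of its two-term recursion.
\<close>

primrec jacobi_coeff :: "real \<Rightarrow> real \<Rightarrow> nat \<Rightarrow> nat \<Rightarrow> real" where
  "jacobi_coeff \<alpha> \<beta> k 0 = (real k + \<alpha>) gchoose k"
| "jacobi_coeff \<alpha> \<beta> k (Suc i) =
    - ((real k - real i) * (real k + real i + \<alpha> + \<beta> + 1)) / ((real i + 1) * (real i + \<alpha> + 1)) * jacobi_coeff \<alpha> \<beta> k i"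

lemma jacobi_coeff_Suc:
  assumes "\<alpha> > -1"
  shows "(real i + 1) * (real i + \<alpha> + 1) * jacobi_coeff \<alpha> \<beta> k (Suc i) =
    - ((real k - real i) * (real k + real i + \<alpha> + \<beta> + 1)) * jacobi_coeff \<alpha> \<beta> k i"
  using assms by simp

lemma jacobi_coeff_eq_0: "i > k \<Longrightarrow> jacobi_coeff \<alpha> \<beta> k i = 0"
proof (induction i)
  case (Suc i)
  thus ?case by (cases "i = k") auto
qed simp

lemma gbinomial_shift_pos:
  assumes "\<alpha> > -1"
  shows "(real k + \<alpha>) gchoose k > 0"
  unfolding gbinomial_prod_rev using assms by (intro divide_pos_pos prod_pos) auto

lemma jacobi_coeff_nonzero:
  assumes "\<alpha> > -1" "\<beta> > -1" "i \<le> k"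
  shows "jacobi_coeff \<alpha> \<beta> k i \<noteq> 0"
  using assms(3)
proof (induction i)
  case 0
  thus ?case using gbinomial_shift_pos[OF assms(1), of k] by simp
next
  case (Suc i)
  hence "real k - real i > 0" "real k + real i + \<alpha> + \<beta> + 1 > 0" "real i + \<alpha> + 1 > 0" using assms(1,2) by auto
  moreover have "jacobi_coeff \<alpha> \<beta> k i \<noteq> 0" using Suc by simp
  ultimately show ?case by simp
qed

declare jacobi_coeff.simps [simp del]

definition jacobi_shifted :: "real \<Rightarrow> real \<Rightarrow> nat \<Rightarrow> real poly"
  where "jacobi_shifted \<alpha> \<beta> k = (\<Sum>i\<le>k. monom (jacobi_coeff \<alpha> \<beta> k i) i)"

lemma coeff_jacobi_shifted: "coeff (jacobi_shifted \<alpha> \<beta> k) i = jacobi_coeff \<alpha> \<beta> k i"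
proof -
  have "coeff (jacobi_shifted \<alpha> \<beta> k) i = (\<Sum>j\<le>k. if j = i then jacobi_coeff \<alpha> \<beta> k j else 0)"
    by (simp add: jacobi_shifted_def coeff_sum)
  also have "\<dots> = jacobi_coeff \<alpha> \<beta> k i" by (auto simp: jacobi_coeff_eq_0)
  finally show ?thesis .
qed

lemma degree_jacobi_shifted:
  assumes "\<alpha> > -1" "\<beta> > -1"
  shows "degree (jacobi_shifted \<alpha> \<beta> k) = k"
proof (rule antisym)
  show "degree (jacobi_shifted \<alpha> \<beta> k) \<le> k"
    by (rule degree_le) (simp add: coeff_jacobi_shifted jacobi_coeff_eq_0)
  show "k \<le> degree (jacobi_shifted \<alpha> \<beta> k)"
    using jacobi_coeff_nonzero[OF assms, of k k] by (intro le_degree) (simp add: coeff_jacobi_shifted)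
qed

text \<open>
  The hypergeometric differential operator \<open>D\<close> maps \<open>v\<^sup>i\<close>, \<open>v = (1 - s) / 2\<close>, to
  \<open>i (i + \<alpha>) v\<^bsup>i-1\<^esup> - i (i + \<gamma>) v\<^sup>i\<close>, where \<open>\<gamma> = \<alpha> + \<beta> + 1\<close>. The moment recursion says that \<open>D\<close> is symmetric with respect to the
  weight (\<open>sym\<close>), and the recursion of the coefficients says that the polynomial is an eigenfunction with
  eigenvalue \<open>-k (k + \<gamma>)\<close>. Since \<open>D\<close> is triangular in the powers of \<open>v\<close> and its other diagonal entries
  \<open>-l (l + \<gamma>)\<close> differ from this eigenvalue, orthogonality to \<open>v\<^sup>l\<close> follows by induction on \<open>l\<close>.
\<close>

lemma jacobi_shifted_moment_orthogonal:
  assumes ab: "\<alpha> > -1" "\<beta> > -1" and "l < k"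
  shows "(\<Sum>i\<le>k. jacobi_coeff \<alpha> \<beta> k i * jacobi_moment \<alpha> \<beta> (i + l)) = 0"
  using \<open>l < k\<close>
proof (induction l)
  let ?c = "jacobi_coeff \<alpha> \<beta> k" and ?m = "jacobi_moment \<alpha> \<beta>"
  define \<gamma> where "\<gamma> = \<alpha> + \<beta> + 1"
  have raise: "(\<Sum>i\<le>k. ?c i * (real i * (real i + \<alpha>) * ?m (i + l - 1))) =
      (\<Sum>i\<le>k. - ((real k - real i) * (real k + real i + \<gamma>)) * (?c i * ?m (i + l)))" for l
  proof -
    have "(\<Sum>i\<le>k. ?c i * (real i * (real i + \<alpha>) * ?m (i + l - 1))) =
        (\<Sum>i\<le>Suc k. ?c i * (real i * (real i + \<alpha>) * ?m (i + l - 1)))" by (simp add: jacobi_coeff_eq_0)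
    also have "\<dots> = (\<Sum>i\<le>k. ?c (Suc i) * (real (Suc i) * (real (Suc i) + \<alpha>) * ?m (i + l)))"
      by (subst sum.atMost_Suc_shift) simp
    also have "\<dots> = (\<Sum>i\<le>k. ((real i + 1) * (real i + \<alpha> + 1) * ?c (Suc i)) * ?m (i + l))"
      by (intro sum.cong refl) (simp add: algebra_simps)
    also have "\<dots> = (\<Sum>i\<le>k. - ((real k - real i) * (real k + real i + \<gamma>)) * (?c i * ?m (i + l)))"
      unfolding jacobi_coeff_Suc[OF ab(1)] \<gamma>_def by (simp only: mult.assoc add.assoc)
    finally show ?thesis .
  qed
  have sym: "real i * (real i + \<alpha>) * ?m (i + l - 1) - real i * (real i + \<gamma>) * ?m (i + l) =
      real l * (real l + \<alpha>) * ?m (i + l - 1) - real l * (real l + \<gamma>) * ?m (i + l)" for i l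
  proof (cases "i + l")
    case (Suc n)
    have "(real i + real l + \<gamma>) * ?m (Suc n) = (real i + real l + \<alpha>) * ?m n"
      using jacobi_moment_Suc[OF ab, of n] arg_cong[OF Suc, of real] by (simp add: \<gamma>_def algebra_simps)
    hence "(real i - real l) * ((real i + real l + \<gamma>) * ?m (Suc n)) = (real i - real l) * ((real i + real l + \<alpha>) * ?m n)"
      by simp
    thus ?thesis unfolding Suc by (simp add: algebra_simps)
  qed simp
  have key: "(real l * (real l + \<gamma>) - real k * (real k + \<gamma>)) * (\<Sum>i\<le>k. ?c i * ?m (i + l)) =
      real l * (real l + \<alpha>) * (\<Sum>i\<le>k. ?c i * ?m (i + l - 1))" for l
  proof -
    have "(\<Sum>i\<le>k. ?c i * (real l * (real l + \<alpha>) * ?m (i + l - 1) - real l * (real l + \<gamma>) * ?m (i + l))) =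
        (\<Sum>i\<le>k. ?c i * (real i * (real i + \<alpha>) * ?m (i + l - 1) - real i * (real i + \<gamma>) * ?m (i + l)))"
    proof (rule sum.cong[OF refl])
      fix i
      show "?c i * (real l * (real l + \<alpha>) * ?m (i + l - 1) - real l * (real l + \<gamma>) * ?m (i + l)) =
          ?c i * (real i * (real i + \<alpha>) * ?m (i + l - 1) - real i * (real i + \<gamma>) * ?m (i + l))"
        by (rule arg_cong[where f = "\<lambda>x. ?c i * x", OF sym[symmetric]])
    qed
    also have "\<dots> = (\<Sum>i\<le>k. ?c i * (real i * (real i + \<alpha>) * ?m (i + l - 1))) - (\<Sum>i\<le>k. real i * (real i + \<gamma>) * (?c i * ?m (i + l)))"
      by (simp add: right_diff_distrib sum_subtractf mult_ac)
    also have "\<dots> = (\<Sum>i\<le>k. - ((real k - real i) * (real k + real i + \<gamma>)) * (?c i * ?m (i + l)) - real i * (real i + \<gamma>) * (?c i * ?m (i + l)))"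
      unfolding raise by (rule sum_subtractf[symmetric])
    also have "\<dots> = (\<Sum>i\<le>k. - (real k * (real k + \<gamma>)) * (?c i * ?m (i + l)))"
      by (intro sum.cong refl) (simp add: algebra_simps)
    also have "\<dots> = - (real k * (real k + \<gamma>)) * (\<Sum>i\<le>k. ?c i * ?m (i + l))" by (rule sum_distrib_left[symmetric])
    finally have "(\<Sum>i\<le>k. ?c i * (real l * (real l + \<alpha>) * ?m (i + l - 1) - real l * (real l + \<gamma>) * ?m (i + l))) = \<dots>" .
    moreover have "(\<Sum>i\<le>k. ?c i * (real l * (real l + \<alpha>) * ?m (i + l - 1) - real l * (real l + \<gamma>) * ?m (i + l))) =
      real l * (real l + \<alpha>) * (\<Sum>i\<le>k. ?c i * ?m (i + l - 1)) - real l * (real l + \<gamma>) * (\<Sum>i\<le>k. ?c i * ?m (i + l))"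
      unfolding sum_distrib_left sum_subtractf[symmetric]
      by (intro sum.cong refl) (simp add: algebra_simps)
    ultimately show ?thesis by (simp add: algebra_simps)
  qed
  have nz: "real l * (real l + \<gamma>) - real k * (real k + \<gamma>) \<noteq> 0" if "l < k" for l
  proof -
    have "real l * (real l + \<gamma>) - real k * (real k + \<gamma>) = (real l - real k) * (real l + real k + \<gamma>)"
      by (simp add: algebra_simps)
    moreover have "real l - real k < 0" "real l + real k + \<gamma> > 0" using that ab by (auto simp: \<gamma>_def)
    ultimately show ?thesis by simp
  qed
  {
    case 0
    show ?case using key[of 0] nz[OF 0] by (simp)
  next
    case (Suc l)
    have "(\<Sum>i\<le>k. ?c i * ?m (i + Suc l - 1)) = 0" using Suc by (simp)
    with key[of "Suc l"] nz[OF Suc.prems] show ?case by (simp)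
  }
qed

lemma jacobi_integral_shifted_orthogonal:
  assumes ab: "\<alpha> > -1" "\<beta> > -1" and q: "degree q < k"
  shows "jacobi_integral \<alpha> \<beta> (\<lambda>s. poly (jacobi_shifted \<alpha> \<beta> k) ((1 - s) / 2) * poly q s) = 0"
proof -
  define r where "r = q \<circ>\<^sub>p [:1, -2:]"
  have dr: "degree r < k" using q by (simp add: r_def degree_pcompose)
  let ?c = "jacobi_coeff \<alpha> \<beta> k" and ?S = "\<lambda>s::real. (1 - s) / 2"
  have qr: "poly q s = (\<Sum>l\<le>degree r. coeff r l * ?S s ^ l)" for s
  proof -
    have "poly q s = poly r (?S s)" by (simp add: r_def poly_pcompose diff_divide_distrib)
    thus ?thesis by (simp add: poly_altdef)
  qed
  have "poly (jacobi_shifted \<alpha> \<beta> k) (?S s) * poly q s =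
      (\<Sum>l\<le>degree r. coeff r l * (\<Sum>i\<le>k. ?c i * ?S s ^ (i + l)))" for s
    unfolding qr by (simp add: jacobi_shifted_def poly_sum poly_monom sum_product sum_distrib_left power_add mult_ac
        sum.swap[of _ "{..k}"])
  moreover have c: "continuous_on UNIV (\<lambda>s::real. ?S s ^ m)" for m
    unfolding divide_inverse by (intro continuous_on_mult continuous_on_const continuous_on_power continuous_on_diff continuous_on_id)
  ultimately have "jacobi_integral \<alpha> \<beta> (\<lambda>s. poly (jacobi_shifted \<alpha> \<beta> k) (?S s) * poly q s) =
      (\<Sum>l\<le>degree r. coeff r l * (\<Sum>i\<le>k. ?c i * jacobi_moment \<alpha> \<beta> (i + l)))"
    by (simp add: jacobi_integral_sum[OF ab] jacobi_integral_cmult jacobi_moment_def continuous_on_sum continuous_on_mult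
        continuous_on_const)
  also have "\<dots> = 0"
    using dr by (intro sum.neutral ballI) (simp add: jacobi_shifted_moment_orthogonal[OF ab])
  finally show ?thesis .
qed

lemma jacobi_integral_square_eq_0:
  assumes ab: "\<alpha> > -1" "\<beta> > -1" and 0: "jacobi_integral \<alpha> \<beta> (\<lambda>s. poly q s * poly q s) = 0"
  shows "q = 0"
proof (rule ccontr)
  assume "q \<noteq> 0"
  let ?h = "\<lambda>s. indicator {-1..1} s *\<^sub>R (poly q s * poly q s * jacobi_weight \<alpha> \<beta> s)"
  have "continuous_on UNIV (\<lambda>s. poly q s * poly q s)" by (intro continuous_on_mult continuous_on_poly continuous_on_id)
  from jacobi_integrable[OF ab this] have i: "integrable lborel ?h" by (simp add: set_integrable_def)
  have nn: "?h s \<ge> 0" for s by (auto simp: jacobi_weight_def indicator_def)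
  have "(LINT s|lborel. ?h s) = 0" using 0 by (simp add: jacobi_integral_def set_lebesgue_integral_def)
  with integral_nonneg_eq_0_iff_AE[OF i] nn have "AE s in lborel. ?h s = 0" by auto
  moreover have "AE s in lborel. s \<notin> {s. poly q s = 0}"
    using poly_roots_finite[OF \<open>q \<noteq> 0\<close>] by (intro AE_not_in finite_imp_null_set_lborel)
  ultimately have "AE s in lborel. s \<notin> {-1<..<1::real}"
    by eventually_elim (auto simp: jacobi_weight_def indicator_def split: if_splits)
  hence "{-1<..<1::real} \<in> null_sets lborel" by (rule iffD2[OF AE_iff_null_sets, rotated]) auto
  thus False by (simp add: null_sets_def)
qed

text \<open>
  Two polynomials with the defining properties agree after scaling the leading coefficients: their
  difference then has lower degree, is orthogonal to itself, and so vanishes. The value at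
  \<open>1\<close>, which is positive, excludes a scaling factor other than \<open>1\<close>.
\<close>

theorem jacobi_eq_shifted:
  assumes ab: "\<alpha> > -1" "\<beta> > -1"
  shows "jacobi \<alpha> \<beta> k = jacobi_shifted \<alpha> \<beta> k \<circ>\<^sub>p [:1 / 2, - 1 / 2:]"
  unfolding jacobi_def
proof (rule the_equality)
  define p where "p = jacobi_shifted \<alpha> \<beta> k \<circ>\<^sub>p [:1 / 2, - 1 / 2:]"
  have pS: "poly p s = poly (jacobi_shifted \<alpha> \<beta> k) ((1 - s) / 2)" for s
    by (simp add: p_def poly_pcompose diff_divide_distrib)
  have dp: "degree p = k" by (simp add: p_def degree_pcompose degree_jacobi_shifted[OF ab])
  have p1: "poly p 1 = (real k + \<alpha>) gchoose k"
    by (simp add: pS poly_0_coeff_0 coeff_jacobi_shifted jacobi_coeff.simps)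
  have orth: "jacobi_integral \<alpha> \<beta> (\<lambda>s. poly p s * poly q s) = 0" if "degree q < k" for q
    unfolding pS by (rule jacobi_integral_shifted_orthogonal[OF ab that])
  have int: "(LINT s:{-1..1}|lborel. poly p' s * poly q s * ((1 - s) powr \<alpha> * (1 + s) powr \<beta>)) =
      jacobi_integral \<alpha> \<beta> (\<lambda>s. poly p' s * poly q s)" for p' q
    by (simp add: jacobi_integral_def jacobi_weight_def)
  show "degree p = k \<and> (\<forall>q. degree q < k \<longrightarrow>
      (LINT s:{-1..1}|lborel. poly p s * poly q s * ((1 - s) powr \<alpha> * (1 + s) powr \<beta>)) = 0) \<and>
      poly p 1 = (real k + \<alpha>) gchoose k"
    using dp p1 orth unfolding int by blast
  fix p' assume p': "degree p' = k \<and> (\<forall>q. degree q < k \<longrightarrow>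
      (LINT s:{-1..1}|lborel. poly p' s * poly q s * ((1 - s) powr \<alpha> * (1 + s) powr \<beta>)) = 0) \<and>
      poly p' 1 = (real k + \<alpha>) gchoose k"
  define c0 where "c0 = coeff p' k / coeff p k"
  define D where "D = p' - smult c0 p"
  have pk: "coeff p k \<noteq> 0" using dp p1 gbinomial_shift_pos[OF ab(1), of k]
    by (metis leading_coeff_0_iff poly_0 order_less_irrefl)
  have "D = 0"
  proof (cases "D = 0")
    case False
    have "coeff D k = 0" using pk by (simp add: D_def c0_def)
    moreover have "degree D \<le> k"
      unfolding D_def using p' dp by (intro degree_diff_le) (auto intro: order.trans[OF degree_smult_le])
    ultimately have dD: "degree D < k" using False by (metis le_neq_implies_less leading_coeff_0_iff)
    have "jacobi_integral \<alpha> \<beta> (\<lambda>s. poly D s * poly D s) =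
        jacobi_integral \<alpha> \<beta> (\<lambda>s. poly p' s * poly D s + - c0 * (poly p s * poly D s))"
      by (simp add: D_def algebra_simps)
    also have "\<dots> = jacobi_integral \<alpha> \<beta> (\<lambda>s. poly p' s * poly D s) + - c0 * jacobi_integral \<alpha> \<beta> (\<lambda>s. poly p s * poly D s)"
      unfolding jacobi_integral_cmult[symmetric]
      by (intro jacobi_integral_add ab continuous_on_mult continuous_on_const continuous_on_poly continuous_on_id)
    also have "\<dots> = 0" using orth[OF dD] p' dD unfolding int by simp
    finally show ?thesis by (rule jacobi_integral_square_eq_0[OF ab])
  qed
  hence eq: "p' = smult c0 p" by (simp add: D_def)
  hence "c0 = 1" using p' p1 gbinomial_shift_pos[OF ab(1), of k] by auto
  thus "p' = p" using eq by simp
qed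

section \<open>Radial factors times harmonic polynomials\<close>

lemma homogeneous_polynomial_smooth: "homogeneous_polynomial m Y \<Longrightarrow> smooth Y"
proof -
  assume "homogeneous_polynomial m Y"
  then obtain c where "Y = (\<lambda>x. \<Sum>\<alpha> | (\<Sum>i\<in>UNIV. \<alpha> i) = m. c \<alpha> * (\<Prod>i\<in>UNIV. (x $ i) ^ \<alpha> i))"
    unfolding homogeneous_polynomial_def by blast
  thus "smooth Y" by (simp add: smooth_intros)
qed

lemma homogeneous_polynomial_scale:
  assumes "homogeneous_polynomial m Y"
  shows "Y (t *\<^sub>R x) = t ^ m * Y x"
proof -
  obtain c where c: "\<And>x. Y x = (\<Sum>\<alpha> | (\<Sum>i\<in>UNIV. \<alpha> i) = m. c \<alpha> * (\<Prod>i\<in>UNIV. (x $ i) ^ \<alpha> i))"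
    using assms unfolding homogeneous_polynomial_def by blast
  have "c \<alpha> * (\<Prod>i\<in>UNIV. ((t *\<^sub>R x) $ i) ^ \<alpha> i) = t ^ m * (c \<alpha> * (\<Prod>i\<in>UNIV. (x $ i) ^ \<alpha> i))"
    if "(\<Sum>i\<in>UNIV. \<alpha> i) = m" for \<alpha>
    using that by (simp add: power_mult_distrib prod.distrib flip: power_sum)
  hence "Y (t *\<^sub>R x) = (\<Sum>\<alpha> | (\<Sum>i\<in>UNIV. \<alpha> i) = m. t ^ m * (c \<alpha> * (\<Prod>i\<in>UNIV. (x $ i) ^ \<alpha> i)))"
    unfolding c by (intro sum.cong refl) simp
  thus ?thesis unfolding c by (simp only: sum_distrib_left)
qed

text \<open>
  Differentiate \<open>Y(t x) = t\<^sup>m Y(x)\<close> at \<open>t = 1\<close>.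
\<close>

lemma euler_identity:
  assumes "homogeneous_polynomial m Y"
  shows "radial Y x = real m * Y x"
proof -
  have "((\<lambda>t. t *\<^sub>R x) has_derivative (\<lambda>h. h *\<^sub>R x)) (at 1)"
    by (auto intro!: derivative_eq_intros)
  from has_derivative_compose[OF this derivative_eq_sum_partial[OF smooth_differentiable[OF homogeneous_polynomial_smooth[OF assms]]]]
  have "((\<lambda>t. Y (t *\<^sub>R x)) has_derivative (\<lambda>h. \<Sum>i\<in>UNIV. (h *\<^sub>R x) $ i * partial i Y (1 *\<^sub>R x))) (at 1)" .
  hence "((\<lambda>t. t ^ m * Y x) has_derivative (\<lambda>h. h * radial Y x)) (at 1)"
    unfolding homogeneous_polynomial_scale[OF assms] by (simp add: radial_def sum_distrib_left mult.assoc)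
  hence 1: "((\<lambda>t. t ^ m * Y x) has_real_derivative radial Y x) (at 1)"
    unfolding has_field_derivative_def by (rule has_derivative_eq_rhs) (simp add: fun_eq_iff mult.commute)
  have "((\<lambda>t. t ^ m * Y x) has_real_derivative real m * Y x) (at 1)"
    by (auto intro!: derivative_eq_intros)
  from DERIV_unique[OF 1 this] show ?thesis .
qed

text \<open>
  \<open>t g'' + (\<beta> + 1) g'\<close>: a quarter of the action of the Laplacian on the radial factor of \<open>g(|x|\<^sup>2) Y\<close>.
\<close>

definition radial_op :: "real \<Rightarrow> real poly \<Rightarrow> real poly"
  where "radial_op \<beta> p = [:0, 1:] * pderiv (pderiv p) + smult (\<beta> + 1) (pderiv p)"

lemma partial_poly_norm: "partial i (\<lambda>x. poly g ((norm x)\<^sup>2)) = (\<lambda>x. 2 * x $ i * poly (pderiv g) ((norm x)\<^sup>2))"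
proof
  fix x :: "real^'a"
  show "partial i (\<lambda>x. poly g ((norm x)\<^sup>2)) x = 2 * x $ i * poly (pderiv g) ((norm x)\<^sup>2)"
    by (subst partial_chain[OF poly_DERIV smooth_differentiable[OF smooth_norm_power2]])
       (simp add: partial_norm_power2 mult_ac)
qed

text \<open>
  The mixed term \<open>2 \<nabla>g(|x|\<^sup>2) \<bullet> \<nabla>Y\<close> is \<open>4 g'(|x|\<^sup>2)\<close> times the radial derivative of \<open>Y\<close>, which Euler's
  identity evaluates; the term with \<open>\<Delta>Y\<close> vanishes.
\<close>

lemma laplacian_poly_norm_mult_harmonic:
  fixes Y :: "real^'n \<Rightarrow> real"
  assumes Y: "Y \<in> harmonic_space m"
  shows "laplacian (\<lambda>x. poly g ((norm x)\<^sup>2) * Y x) =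
    (\<lambda>x. 4 * poly (radial_op (real m + (real CARD('n) - 2) / 2) g) ((norm x)\<^sup>2) * Y x)"
proof
  fix x :: "real^'n"
  have h: "homogeneous_polynomial m Y" and lap: "laplacian Y x = 0" using Y by (auto simp: harmonic_space_def)
  have sY: "smooth Y" by (rule homogeneous_polynomial_smooth[OF h])
  let ?G = "\<lambda>g (x::real^'n). poly g ((norm x)\<^sup>2)"
  have sG: "smooth (?G g)" for g by (intro smooth_intros)
  define g1 where "g1 = pderiv g"
  define g2 where "g2 = pderiv g1"
  have d1: "partial i (\<lambda>x. ?G g x * Y x) = (\<lambda>x. 2 * x $ i * ?G g1 x * Y x + ?G g x * partial i Y x)" for i
    by (simp add: smooth_partial_mult[OF sG sY] partial_poly_norm g1_def)
  have s2: "smooth (\<lambda>x. 2 * x $ i)" for i :: 'n by (intro smooth_intros)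
  have p2: "partial i (\<lambda>x. 2 * x $ i) = (\<lambda>x. 2)" for i :: 'n
    by (simp add: smooth_partial_mult[OF smooth_const smooth_coord] partial_coord)
  have d2: "partial i (\<lambda>x. 2 * x $ i * ?G g1 x * Y x) =
      (\<lambda>x. (2 * ?G g1 x + 2 * x $ i * (2 * x $ i * ?G g2 x)) * Y x + 2 * x $ i * ?G g1 x * partial i Y x)" for i
    unfolding smooth_partial_mult[OF smooth_mult[OF s2 sG] sY] smooth_partial_mult[OF s2 sG] p2 partial_poly_norm g2_def ..
  have d3: "partial i (\<lambda>x. ?G g x * partial i Y x) =
      (\<lambda>x. 2 * x $ i * ?G g1 x * partial i Y x + ?G g x * partial i (partial i Y) x)" for i
    unfolding smooth_partial_mult[OF sG smooth_partial[OF sY]] partial_poly_norm g1_def ..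
  have d4: "partial i (partial i (\<lambda>x. ?G g x * Y x)) x =
      2 * ?G g1 x * Y x + 4 * ?G g2 x * Y x * (x $ i)\<^sup>2 + 4 * ?G g1 x * (x $ i * partial i Y x) + ?G g x * partial i (partial i Y) x" for i
  proof -
    have sA: "smooth (\<lambda>x. 2 * x $ i * ?G g1 x * Y x)" and sB: "smooth (\<lambda>x. ?G g x * partial i Y x)"
      by (intro smooth_mult smooth_const smooth_coord sG sY smooth_partial)+
    show ?thesis
      unfolding d1 smooth_partial_add[OF sA sB] d2 d3 by (simp add: power2_eq_square algebra_simps)
  qed
  have "laplacian (\<lambda>x. ?G g x * Y x) x =
      2 * real CARD('n) * ?G g1 x * Y x + 4 * ?G g2 x * Y x * (norm x)\<^sup>2 + 4 * ?G g1 x * radial Y x + ?G g x * laplacian Y x"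
  proof -
    have n2: "c * (norm x)\<^sup>2 = (\<Sum>i\<in>UNIV. c * (x $ i)\<^sup>2)" for c
      by (simp add: norm_power2_eq_sum sum_distrib_left)
    show ?thesis unfolding laplacian_def d4 radial_def n2 by (simp add: sum.distrib sum_distrib_left)
  qed
  also have "\<dots> = 4 * poly (radial_op (real m + (real CARD('n) - 2) / 2) g) ((norm x)\<^sup>2) * Y x"
    unfolding lap euler_identity[OF h] radial_op_def g1_def[symmetric] g2_def[symmetric]
    by (simp add: field_simps)
  finally show "laplacian (\<lambda>x. ?G g x * Y x) x =
      4 * poly (radial_op (real m + (real CARD('n) - 2) / 2) g) ((norm x)\<^sup>2) * Y x" .
qed

section \<open>The fourth-order eigenvalue equation\<close>

text \<open>
  The operator \<open>radial_op\<close> in the variable \<open>1 - t\<close>, in which the coefficients of the Jacobi polynomial are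
  known explicitly.
\<close>

definition reflected_op :: "real \<Rightarrow> real poly \<Rightarrow> real poly"
  where "reflected_op \<beta> r = [:1, -1:] * pderiv (pderiv r) - smult (\<beta> + 1) (pderiv r)"

lemma radial_op_reflect: "radial_op \<beta> (r \<circ>\<^sub>p [:1, -1:]) = reflected_op \<beta> r \<circ>\<^sub>p [:1, -1:]"
proof -
  have 1: "pderiv (r \<circ>\<^sub>p [:1, -1:]) = - (pderiv r \<circ>\<^sub>p [:1, -1:])" for r :: "real poly"
    by (simp add: pderiv_pcompose pderiv_pCons)
  have 2: "[:1, -1:] \<circ>\<^sub>p [:1, -1:] = [:0, 1 :: real:]" by (simp add: pcompose_pCons)
  show ?thesis
    unfolding radial_op_def reflected_op_def 1 pderiv_minus pcompose_diff pcompose_mult pcompose_smult 2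
    by simp
qed

lemma coeff_reflected_op:
  "coeff (reflected_op \<beta> r) n = (real n + 1) * ((real n + 2) * coeff r (n + 2) - (real n + 1 + \<beta>) * coeff r (n + 1))"
proof -
  have eq: "reflected_op \<beta> r = pderiv (pderiv r) - pCons 0 (pderiv (pderiv r)) - smult (\<beta> + 1) (pderiv r)"
    by (simp add: reflected_op_def)
  show ?thesis unfolding eq by (cases n) (simp_all add: coeff_pderiv algebra_simps)
qed

text \<open>
  Comparing coefficients gives a three-term expression in the coefficients of the Jacobi polynomial. Their two-term
  recursion, used twice, reduces it to a multiple of one of them, and the factor turns out to be
  independent of the degree \<open>n\<close>.
\<close>

lemma reflected_op_jacobi:
  assumes \<beta>: "\<beta> > -1"
  shows "reflected_op \<beta> (reflected_op \<beta> ([:0, 0, 1:] * jacobi_shifted 2 \<beta> k)) =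
    smult ((real k + 1) * (real k + 2) * (real k + 1 + \<beta>) * (real k + 2 + \<beta>)) (jacobi_shifted 2 \<beta> k)"
proof (rule poly_eqI)
  fix n
  let ?c = "jacobi_coeff 2 \<beta> k" and ?q = "[:0, 0, 1:] * jacobi_shifted 2 \<beta> k"
  define N where "N = real n"
  define K where "K = real k"
  have q: "coeff ?q (i + 2) = ?c i" for i by (simp add: coeff_jacobi_shifted)
  have q': "coeff ?q (n + 1 + 1) = ?c n" "coeff ?q (n + 1 + 2) = ?c (n + 1)" "coeff ?q (n + 2 + 1) = ?c (n + 1)"
    "coeff ?q (n + 2 + 2) = ?c (n + 2)"
    using q[of n] q[of "n + 1"] q[of "n + 2"] by (simp_all)
  have c1: "(N + 1) * (N + 3) * ?c (n + 1) = - ((K - N) * (K + N + 3 + \<beta>)) * ?c n"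
    using jacobi_coeff_Suc[of 2 n \<beta> k] by (simp add: N_def K_def add_ac)
  have c2: "(N + 2) * (N + 4) * ?c (n + 2) = - ((K - N - 1) * (K + N + 4 + \<beta>)) * ?c (n + 1)"
    using jacobi_coeff_Suc[of 2 "n + 1" \<beta> k] by (simp add: N_def K_def add_ac diff_diff_eq)
  have "coeff (reflected_op \<beta> (reflected_op \<beta> ?q)) n =
      (N + 1) * ((N + 2) * ((N + 3) * ((N + 4) * ?c (n + 2) - (N + 3 + \<beta>) * ?c (n + 1)))
        - (N + 1 + \<beta>) * ((N + 2) * ((N + 3) * ?c (n + 1) - (N + 2 + \<beta>) * ?c n)))"
    unfolding coeff_reflected_op q' by (simp add: N_def add_ac)
  also have "\<dots> = (N + 1) * (N + 3) * ((N + 2) * (N + 4) * ?c (n + 2)) - (N + 2) * (2 * N + 4 + 2 * \<beta>) * ((N + 1) * (N + 3) * ?c (n + 1))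
      + (N + 1) * (N + 2) * (N + 1 + \<beta>) * (N + 2 + \<beta>) * ?c n" by algebra
  also have "\<dots> = (- ((K - N - 1) * (K + N + 4 + \<beta>)) - (N + 2) * (2 * N + 4 + 2 * \<beta>)) * ((N + 1) * (N + 3) * ?c (n + 1))
      + (N + 1) * (N + 2) * (N + 1 + \<beta>) * (N + 2 + \<beta>) * ?c n" unfolding c2 by algebra
  also have "\<dots> = (K + 1) * (K + 2) * (K + 1 + \<beta>) * (K + 2 + \<beta>) * ?c n" unfolding c1 by algebra
  finally show "coeff (reflected_op \<beta> (reflected_op \<beta> ?q)) n =
      coeff (smult ((real k + 1) * (real k + 2) * (real k + 1 + \<beta>) * (real k + 2 + \<beta>)) (jacobi_shifted 2 \<beta> k)) n"
    by (simp add: coeff_jacobi_shifted K_def)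
qed

text \<open>
  The radial profile of \<open>(1 - |x|\<^sup>2) Q\<close> as a polynomial in \<open>t = |x|\<^sup>2\<close>.
\<close>

definition weighted_jacobi :: "real \<Rightarrow> nat \<Rightarrow> real poly"
  where "weighted_jacobi \<beta> k = [:1, -1:]\<^sup>2 * (jacobi 2 \<beta> k \<circ>\<^sub>p [:-1, 2:])"

lemma weighted_jacobi_reflect:
  assumes "\<beta> > -1"
  shows "jacobi 2 \<beta> k \<circ>\<^sub>p [:-1, 2:] = jacobi_shifted 2 \<beta> k \<circ>\<^sub>p [:1, -1:]"
    and "weighted_jacobi \<beta> k = ([:0, 0, 1:] * jacobi_shifted 2 \<beta> k) \<circ>\<^sub>p [:1, -1:]"
proof -
  have "[:1 / 2, - 1 / 2:] \<circ>\<^sub>p [:-1, 2:] = [:1, - 1 :: real:]" by (simp add: pcompose_pCons)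
  thus 1: "jacobi 2 \<beta> k \<circ>\<^sub>p [:-1, 2:] = jacobi_shifted 2 \<beta> k \<circ>\<^sub>p [:1, -1:]"
    using assms by (simp add: jacobi_eq_shifted flip: pcompose_assoc)
  show "weighted_jacobi \<beta> k = ([:0, 0, 1:] * jacobi_shifted 2 \<beta> k) \<circ>\<^sub>p [:1, -1:]"
  proof -
    have "[:0, 0, 1:] \<circ>\<^sub>p [:1, -1:] = [:1, -1 :: real:]\<^sup>2" by (simp add: pcompose_pCons power2_eq_square)
    thus ?thesis unfolding weighted_jacobi_def 1 by (simp only: pcompose_mult)
  qed
qed

text \<open>
  The value at \<open>t = 1\<close> only involves the double zero of the weight there: it is twice the value of
  the Jacobi polynomial at \<open>1\<close>.
\<close>

lemma radial_op_weighted_jacobi: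
  assumes "\<beta> > -1"
  shows "radial_op \<beta> (radial_op \<beta> (weighted_jacobi \<beta> k)) =
      smult ((real k + 1) * (real k + 2) * (real k + 1 + \<beta>) * (real k + 2 + \<beta>)) (jacobi 2 \<beta> k \<circ>\<^sub>p [:-1, 2:])"
    and "poly (radial_op \<beta> (weighted_jacobi \<beta> k)) 1 = (real k + 1) * (real k + 2)"
proof -
  show "radial_op \<beta> (radial_op \<beta> (weighted_jacobi \<beta> k)) =
      smult ((real k + 1) * (real k + 2) * (real k + 1 + \<beta>) * (real k + 2 + \<beta>)) (jacobi 2 \<beta> k \<circ>\<^sub>p [:-1, 2:])"
    unfolding weighted_jacobi_reflect[OF assms] radial_op_reflect reflected_op_jacobi[OF assms] by (simp only: pcompose_smult)
  have "(real k + 2) gchoose k = real ((k + 2) choose k)"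
    using binomial_gbinomial[of "k + 2" k, where 'a = real] by (simp add: add.commute)
  also have "(k + 2) choose k = (k + 2) choose 2" using binomial_symmetric[of k "k + 2"] by simp
  also have "real ((k + 2) choose 2) = (real k + 1) * (real k + 2) / 2"
    by (simp add: choose_two real_of_nat_div field_simps)
  finally have g: "(real k + 2) gchoose k = (real k + 1) * (real k + 2) / 2" .
  have "poly (radial_op \<beta> (weighted_jacobi \<beta> k)) 1 = coeff (reflected_op \<beta> ([:0, 0, 1:] * jacobi_shifted 2 \<beta> k)) 0"
    unfolding weighted_jacobi_reflect(2)[OF assms] radial_op_reflect by (simp add: poly_pcompose poly_0_coeff_0)
  also have "\<dots> = 2 * ((real k + 2) gchoose k)"
    unfolding coeff_reflected_op by (simp add: coeff_jacobi_shifted jacobi_coeff.simps numeral_2_eq_2)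
  finally show "poly (radial_op \<beta> (weighted_jacobi \<beta> k)) 1 = (real k + 1) * (real k + 2)"
    using g by simp
qed

section \<open>The coefficients\<close>

lemma basis_harmonic:
  fixes B :: "nat \<Rightarrow> real^'n \<Rightarrow> real"
  assumes "orthonormal_harmonic_basis m B" "\<nu> \<in> {1..harmonic_dim TYPE('n) m}"
  shows "B \<nu> \<in> harmonic_space m"
proof -
  have "B \<nu> \<in> B ` {1..harmonic_dim TYPE('n) m}" using assms(2) by (rule imageI)
  hence "B \<nu> \<in> real_fun.span (B ` {1..harmonic_dim TYPE('n) m})" by (rule real_fun.span_base)
  also have "\<dots> = harmonic_space m"
    using assms(1) unfolding orthonormal_harmonic_basis_def by (elim conjE)
  finally show ?thesis .
qed

text \<open>
  By the volume of the unit ball and the recursion \<open>\<Gamma>(z + 1) = z \<Gamma>(z)\<close>.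
\<close>

lemma sphere_area_eq: "sphere_area CARD('n) = real CARD('n) * measure lebesgue (cball 0 1 :: (real^'n) set)"
proof -
  have "measure lebesgue (cball 0 1 :: (real^'n) set) = unit_ball_vol (real CARD('n))"
    using content_ball[of 1 "0::real^'n"] content_cball_conv_ball[of "0::real^'n" 1] by simp
  moreover have "Gamma (real CARD('n) / 2 + 1) = (real CARD('n) / 2) * Gamma (real CARD('n) / 2)"
    by (rule Gamma_plus1) (auto dest: nonpos_Ints_nonpos)
  ultimately show ?thesis by (simp add: sphere_area_def unit_ball_vol_def)
qed

lemma integral_sphere_cong:
  fixes F G :: "real^'n \<Rightarrow> real"
  assumes "\<And>y. norm y = 1 \<Longrightarrow> F y = G y"
  shows "(LINT y|sphere_measure. F y) = (LINT y|sphere_measure. G y)"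
proof (rule Bochner_Integration.integral_cong[OF refl])
  fix y :: "real^'n" assume "y \<in> space sphere_measure"
  hence "norm y = 1" by (simp add: sphere_measure_def space_scale_measure space_restrict_space)
  thus "F y = G y" by (rule assms)
qed

text \<open>
  Here \<open>P = -(2 d + 4 n) Y\<close> is harmonic, so that only the boundary term of Green's formula remains.
\<close>

lemma inner_Delta_harmonic:
  fixes f Y :: "real^'n \<Rightarrow> real"
  assumes f: "f \<in> H2" and Y: "Y \<in> harmonic_space n"
  shows "inner_Delta f Y = (real CARD('n) + 2 * real n) / real CARD('n) * (1 / sphere_area CARD('n)) *
    (LINT y|sphere_measure. Y y * sobolev_trace f y)"
proof -
  let ?d = "real CARD('n)" and ?vol = "measure lebesgue (cball 0 1 :: (real^'n) set)"
  define \<beta> where "\<beta> = real n + (?d - 2) / 2"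
  have sY: "smooth Y" using Y homogeneous_polynomial_smooth by (auto simp: harmonic_space_def)
  have "laplacian (\<lambda>x. (1 - (norm x)\<^sup>2) * Y x) = laplacian (\<lambda>x. poly [:1, -1:] ((norm x)\<^sup>2) * Y x)"
    by simp
  also have "\<dots> = (\<lambda>x. 4 * poly (radial_op \<beta> [:1, -1:]) ((norm x)\<^sup>2) * Y x)"
    unfolding \<beta>_def by (rule laplacian_poly_norm_mult_harmonic[OF Y])
  also have "radial_op \<beta> [:1, -1:] = [:- (\<beta> + 1):]"
    by (simp add: radial_op_def pderiv_pCons)
  finally have P: "laplacian (\<lambda>x. (1 - (norm x)\<^sup>2) * Y x) = (\<lambda>x. poly [:- 4 * (\<beta> + 1):] ((norm x)\<^sup>2) * Y x)"
    by (simp add: algebra_simps)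
  have PP: "laplacian (\<lambda>x. poly [:- 4 * (\<beta> + 1):] ((norm x)\<^sup>2) * Y x) = (\<lambda>x. 0)"
    unfolding laplacian_poly_norm_mult_harmonic[OF Y] by (simp add: radial_op_def pderiv_pCons)
  have b: "4 * (\<beta> + 1) = 2 * (?d + 2 * real n)" by (simp add: \<beta>_def field_simps)
  have vol: "?vol > 0" by (simp add: content_cball_pos)
  have "inner_Delta f Y = 1 / (4 * ?d\<^sup>2 * ?vol) * (- 2 * (LINT y|sphere_measure. - 4 * (\<beta> + 1) * (Y y * sobolev_trace f y)))"
    unfolding inner_Delta_smooth[OF f sY] P PP by (simp add: mult.assoc)
  also have "\<dots> = 1 / (4 * ?d\<^sup>2 * ?vol) * (2 * (4 * (\<beta> + 1)) * (LINT y|sphere_measure. Y y * sobolev_trace f y))"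
  proof -
    have "- 2 * (- 4 * (\<beta> + 1) * S) = 2 * (4 * (\<beta> + 1)) * S" for S by (simp add: algebra_simps)
    thus ?thesis by (simp only: integral_mult_right_zero)
  qed
  also have "\<dots> = (?d + 2 * real n) / ?d * (1 / sphere_area CARD('n)) * (LINT y|sphere_measure. Y y * sobolev_trace f y)"
  proof -
    have alg: "1 / (4 * D\<^sup>2 * V) * (2 * (2 * N) * S) = N / D * (1 / (D * V)) * S" if "D > 0" "V > 0" for D V N S :: real
      using that by (simp add: power2_eq_square)
    have "?d > 0" by simp
    from alg[OF this vol] show ?thesis unfolding b sphere_area_eq .
  qed
  finally show ?thesis .
qed

text \<open>
  Each of the two Laplacians contributes a factor \<open>4\<close> besides \<open>radial_op\<close>; this is the origin of the
  factors \<open>16\<close> in the ball and \<open>4\<close> on the sphere.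
\<close>

lemma inner_Delta_jacobi:
  fixes f Y :: "real^'n \<Rightarrow> real" and j m :: nat
  assumes f: "f \<in> H2" and Y: "Y \<in> harmonic_space m" and j: "j \<ge> 1"
  defines "\<beta> \<equiv> real m + (real CARD('n) - 2) / 2"
  defines "Q \<equiv> \<lambda>x. (1 - (norm x)\<^sup>2) * poly (jacobi 2 \<beta> (j - 1)) (2 * (norm x)\<^sup>2 - 1) * Y x"
  shows "inner_Delta f Q =
    4 * real j * (real j + 1) / ((real CARD('n))\<^sup>2 * measure lebesgue (cball 0 1 :: (real^'n) set)) *
      ((\<beta> + real j) * (\<beta> + real j + 1) * (LINT x|ball_measure. f x * Q x)
        - 1 / 2 * (LINT y|sphere_measure. sobolev_trace f y * Y y))"
proof -
  let ?d = "real CARD('n)" and ?vol = "measure lebesgue (cball 0 1 :: (real^'n) set)"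
  define k where "k = j - 1"
  have k: "real j = real k + 1" using j by (simp add: k_def)
  have \<beta>: "\<beta> > -1"
  proof -
    have "0 < ?d / 2 + real m" by (intro add_pos_nonneg) auto
    thus ?thesis unfolding \<beta>_def by (simp add: diff_divide_distrib)
  qed
  have sY: "smooth Y" using Y homogeneous_polynomial_smooth by (auto simp: harmonic_space_def)
  let ?p = "jacobi 2 \<beta> k \<circ>\<^sub>p [:-1, 2:]" and ?w = "weighted_jacobi \<beta> k"
  let ?ev = "(real k + 1) * (real k + 2) * (real k + 1 + \<beta>) * (real k + 2 + \<beta>)"
  have Q: "Q = (\<lambda>x. (1 - (norm x)\<^sup>2) * poly ?p ((norm x)\<^sup>2) * Y x)"
    unfolding Q_def k_def[symmetric] by (simp add: poly_pcompose algebra_simps)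
  have sQ: "smooth Q" unfolding Q by (intro smooth_mult smooth_bowl smooth_poly smooth_norm_power2 sY)
  have w: "poly ?w t = (1 - t) * ((1 - t) * poly ?p t)" for t
    by (simp add: weighted_jacobi_def power2_eq_square algebra_simps)
  have "(\<lambda>x. (1 - (norm x)\<^sup>2) * Q x) = (\<lambda>x. poly ?w ((norm x)\<^sup>2) * Y x)"
    unfolding Q w by (simp only: mult.assoc)
  hence "laplacian (\<lambda>x. (1 - (norm x)\<^sup>2) * Q x) = (\<lambda>x. 4 * poly (radial_op \<beta> ?w) ((norm x)\<^sup>2) * Y x)"
    unfolding \<beta>_def by (simp only: laplacian_poly_norm_mult_harmonic[OF Y])
  hence P: "laplacian (\<lambda>x. (1 - (norm x)\<^sup>2) * Q x) = (\<lambda>x. poly (smult 4 (radial_op \<beta> ?w)) ((norm x)\<^sup>2) * Y x)"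
    by simp
  have op4: "radial_op \<beta> (smult 4 g) = smult 4 (radial_op \<beta> g)" for g
    by (simp add: radial_op_def pderiv_smult smult_add_right algebra_simps)
  have PP: "laplacian (\<lambda>x. poly (smult 4 (radial_op \<beta> ?w)) ((norm x)\<^sup>2) * Y x) = (\<lambda>x. 16 * ?ev * poly ?p ((norm x)\<^sup>2) * Y x)"
  proof -
    have "4 * poly (smult 4 (smult c q)) t * y = 16 * c * poly q t * y" for c t y and q :: "real poly"
      by (simp add: algebra_simps)
    thus ?thesis
      unfolding laplacian_poly_norm_mult_harmonic[OF Y, folded \<beta>_def] op4 radial_op_weighted_jacobi(1)[OF \<beta>]
      by (simp only:)
  qed
  have I1: "(LINT x|ball_measure. f x * ((1 - (norm x)\<^sup>2) * (16 * ?ev * poly ?p ((norm x)\<^sup>2) * Y x))) =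
      16 * ?ev * (LINT x|ball_measure. f x * Q x)"
  proof -
    have "f x * ((1 - (norm x)\<^sup>2) * (16 * ?ev * poly ?p ((norm x)\<^sup>2) * Y x)) = 16 * ?ev * (f x * Q x)" for x
      unfolding Q by (simp only: mult_ac)
    thus ?thesis by (simp only: integral_mult_right_zero)
  qed
  have I2: "(LINT y|sphere_measure. poly (smult 4 (radial_op \<beta> ?w)) ((norm y)\<^sup>2) * Y y * sobolev_trace f y) =
      4 * ((real k + 1) * (real k + 2)) * (LINT y|sphere_measure. sobolev_trace f y * Y y)"
  proof -
    have "(LINT y|sphere_measure. poly (smult 4 (radial_op \<beta> ?w)) ((norm y)\<^sup>2) * Y y * sobolev_trace f y) =
      (LINT y|sphere_measure. 4 * ((real k + 1) * (real k + 2)) * (sobolev_trace f y * Y y))"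
      by (rule integral_sphere_cong) (simp add: radial_op_weighted_jacobi(2)[OF \<beta>])
    thus ?thesis by (simp only: integral_mult_right_zero)
  qed
  have vol: "?vol > 0" by (simp add: content_cball_pos)
  define p where "p = (real k + 1) * (real k + 2)"
  define z where "z = (real k + 1 + \<beta>) * (real k + 2 + \<beta>)"
  have e: "4 * (real k + 1) * (real k + 1 + 1) = 4 * p" "(\<beta> + (real k + 1)) * (\<beta> + (real k + 1) + 1) = z"
      "(real k + 1) * (real k + 2) = p" "p * (real k + 1 + \<beta>) * (real k + 2 + \<beta>) = p * z"
      "4 * ?d\<^sup>2 * ?vol = 4 * (?d\<^sup>2 * ?vol)"
    by (simp_all add: p_def z_def algebra_simps)
  have alg: "1 / (4 * D) * (16 * (p * z) * A - 2 * (4 * p * S)) = 4 * p / D * (z * A - 1 / 2 * S)" if "D > 0" for D A S :: real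
    using that by (simp add: field_simps)
  have "?d\<^sup>2 * ?vol > 0" using vol by simp
  from alg[OF this] show ?thesis
    unfolding inner_Delta_smooth[OF f sQ] P PP unfolding I1 I2 unfolding k unfolding e .
qed

theorem proposition3p1:
  fixes f :: "real^'n \<Rightarrow> real"
    and Y :: "nat \<Rightarrow> nat \<Rightarrow> real^'n \<Rightarrow> real"
    and n :: nat
  assumes "f \<in> H2"
    and "\<And>m. orthonormal_harmonic_basis m (Y m)"
  defines "d \<equiv> real CARD('n)"
    and "vol \<equiv> measure lebesgue (cball 0 1 :: (real^'n) set)"
  shows "(\<forall>j \<nu>. 1 \<le> j \<and> 2 * j \<le> n \<and> \<nu> \<in> {1..harmonic_dim TYPE('n) (n - 2 * j)} \<longrightarrow>
      (let \<beta> = real (n - 2 * j) + (d - 2) / 2 in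
        inner_Delta f (Q_poly Y n j \<nu>) =
          4 * real j * (real j + 1) / (d\<^sup>2 * vol) *
            ((\<beta> + real j) * (\<beta> + real j + 1) * (LINT x|ball_measure. f x * Q_poly Y n j \<nu> x)
             - 1 / 2 * (LINT y|sphere_measure. sobolev_trace f y * Y (n - 2 * j) \<nu> y)))) \<and>
    (\<forall>\<nu>\<in>{1..harmonic_dim TYPE('n) n}.
      inner_Delta f (Q_poly Y n 0 \<nu>) =
        (d + 2 * real n) / d * (1 / sphere_area CARD('n)) *
          (LINT y|sphere_measure. Y n \<nu> y * sobolev_trace f y))"
proof (intro conjI allI impI ballI)
  fix j \<nu> assume "1 \<le> j \<and> 2 * j \<le> n \<and> \<nu> \<in> {1..harmonic_dim TYPE('n) (n - 2 * j)}"
  hence j: "j \<ge> 1" and \<nu>: "\<nu> \<in> {1..harmonic_dim TYPE('n) (n - 2 * j)}" by blast+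
  have "Q_poly Y n j \<nu> = (\<lambda>x. (1 - (norm x)\<^sup>2) *
      poly (jacobi 2 (real (n - 2 * j) + (real CARD('n) - 2) / 2) (j - 1)) (2 * (norm x)\<^sup>2 - 1) * Y (n - 2 * j) \<nu> x)"
    using j by (simp add: Q_poly_def fun_eq_iff)
  thus "let \<beta> = real (n - 2 * j) + (d - 2) / 2 in
        inner_Delta f (Q_poly Y n j \<nu>) =
          4 * real j * (real j + 1) / (d\<^sup>2 * vol) *
            ((\<beta> + real j) * (\<beta> + real j + 1) * (LINT x|ball_measure. f x * Q_poly Y n j \<nu> x)
             - 1 / 2 * (LINT y|sphere_measure. sobolev_trace f y * Y (n - 2 * j) \<nu> y))"
    unfolding Let_def d_def vol_def
    using inner_Delta_jacobi[OF assms(1) basis_harmonic[OF assms(2) \<nu>] j] by (simp only:)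
next
  fix \<nu> assume \<nu>: "\<nu> \<in> {1..harmonic_dim TYPE('n) n}"
  have "Q_poly Y n 0 \<nu> = Y n \<nu>" by (simp add: Q_poly_def fun_eq_iff)
  thus "inner_Delta f (Q_poly Y n 0 \<nu>) =
        (d + 2 * real n) / d * (1 / sphere_area CARD('n)) *
          (LINT y|sphere_measure. Y n \<nu> y * sobolev_trace f y)"
    unfolding d_def using inner_Delta_harmonic[OF assms(1) basis_harmonic[OF assms(2) \<nu>]] by simp
qed

end
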